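(* Let $p\ge m\ge1$ and let $G(s)=D+\int_0^\infty e^{-st}g(t)\,dt$ ($\Re s\ge0$), where $D$ is a complex $m\times p$ matrix and $g\in L^1_{m\times p}(\mathbb{R}_+)\cap L^2_{m\times p}(\mathbb{R}_+)$. Assume that $T_GT_G^*$ is strictly positive, where $T_G$ is the Wiener-Hopf operator of $G$. Let $$Y(s)=I_p-\int_0^\infty e^{-st}y(t)\,dt,\quad \Re s\ge0,\qquad y=T_G^*(T_GT_G^* )^{-1}g,$$ let $D^+=D^*(DD^* )^{-1}$, let $E$ be an isometry from $\mathbb{C}^{p-m}$ into $\mathbb{C}^p$ with $\operatorname{Im}E=\operatorname{Ker}D$, and put $\Xi(s)=Y(s)D^+$, $\Theta(s)=Y(s)E$. Then $Y$ belongs to $\mathcal{W}_+^{p\times p}$, $\det Y(s)\ne0$ whenever $\Re s\ge0$, and hence $Y$ is invertible in $\mathcal{W}_+^{p\times p}$. Furthermore, the $p\times p$ matrix function $$\begin{bmatrix}G(s)\\ E^*Y(s)^{-1}\end{bmatrix},\qquad \Re s\ge0,$$ is invertible in the Wiener algebra $\mathcal{W}_+^{p\times p}$ and its inverse is given by $$\begin{bmatrix}G(s)\\ E^*Y(s)^{-1}\end{bmatrix}^{-1}=Y(s)\begin{bmatrix}D^+&E\end{bmatrix}=\begin{bmatrix}\Xi(s)&\Theta(s)\end{bmatrix},\qquad \Re s\ge0 .$$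
   Context: $\mathbb{R}_+=[0,\infty)$. $L^q_k(\mathbb{R}_+)$ ($q=1,2$) is the space of $\mathbb{C}^k$-valued functions on $\mathbb{R}_+$ with entries in $L^q(\mathbb{R}_+)$, and $L^q_{k\times r}(\mathbb{R}_+)$ is the space of $k\times r$ matrix functions with entries in $L^q(\mathbb{R}_+)$; functions on $\mathbb{R}_+$ are extended by $0$ to $\mathbb{R}$ when needed. $\mathcal{W}_+^{k\times r}$ is the set of functions $F(s)=D_F+\int_0^\infty e^{-st}f(t)\,dt$, $\Re s\ge0$, with $D_F$ a constant complex $k\times r$ matrix and $f\in L^1_{k\times r}(\mathbb{R}_+)$. A function $F\in\mathcal{W}_+^{k\times k}$ is invertible in $\mathcal{W}_+^{k\times k}$ if $F(s)$ is invertible for all $\Re s\ge0$ and $F(\cdot)^{-1}\in\mathcal{W}_+^{k\times k}$. Wiener-Hopf operator: $(T_Gh)(t)=Dh(t)+\int_0^\infty g(t-\tau)h(\tau)\,d\tau$, $t\ge0$, for $h\in L^2_p(\mathbb{R}_+)$; it is a bounded operator $L^2_p(\mathbb{R}_+)\to L^2_m(\mathbb{R}_+)$. An operator is strictly positive if it is bounded below by a positive multiple of the identity. Strict positivity of $T_GT_G^*$ implies that $D=G(\infty)$ is surjective, so $DD^*$ is invertible. Operators are applied to matrix functions column by column, so $y=T_G^*(T_GT_G^* )^{-1}g$ is a $p\times p$ matrix function on $\mathbb{R}_+$ with entries in $L^2(\mathbb{R}_+)$; the assertion $Y\in\mathcal{W}_+^{p\times p}$ includes that $y\in L^1_{p\times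 p}(\mathbb{R}_+)$, so that the integral defining $Y(s)$ converges for all $\Re s\ge0$. *)

theory Defs
  imports "HOL-Analysis.Analysis" "Jordan_Normal_Form.Schur_Decomposition"
    "Jordan_Normal_Form.Matrix_Kernel"
begin

(* Matrices and vectors are those of Jordan_Normal_Form, whose dimensions are natural numbers and
   may be 0; this is needed for the isometry E : C^(p-m) -> C^p when p = m. *)

abbreviation half_line :: "real measure" where
  "half_line \<equiv> lebesgue_on {0..}"

abbreviation minv :: "complex mat \<Rightarrow> complex mat" where
  "minv A \<equiv> the (mat_inverse A)"

definition append_cols :: "complex mat \<Rightarrow> complex mat \<Rightarrow> complex mat" (infixr "@\<^sub>c" 65) where
  "A @\<^sub>c B = four_block_mat A B (0\<^sub>m 0 (dim_col A)) (0\<^sub>m 0 (dim_col B))"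

definition vec_norm :: "complex vec \<Rightarrow> real" where
  "vec_norm v = L2_set (\<lambda>i. cmod (v $ i)) {..<dim_vec v}"

definition isometry_mat :: "complex mat \<Rightarrow> bool" where
  "isometry_mat E \<longleftrightarrow> (\<forall>x \<in> carrier_vec (dim_col E). vec_norm (E *\<^sub>v x) = vec_norm x)"

definition mat_image :: "complex mat \<Rightarrow> complex vec set" where
  "mat_image E = (\<lambda>x. E *\<^sub>v x) ` carrier_vec (dim_col E)"


(* L^q functions are represented by functions on the reals of which only the values on [0,\<infinity>)
   matter. The elements of the Hilbert space L^2 are these representatives up to equality
   almost everywhere on [0,\<infinity>). *)

definition L1_mat :: "nat \<Rightarrow> nat \<Rightarrow> (real \<Rightarrow> complex mat) set" where
  "L1_mat k r = {f. (\<forall>t\<ge>0. f t \<in> carrier_mat k r) \<and>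
     (\<forall>i<k. \<forall>j<r. integrable half_line (\<lambda>t. f t $$ (i, j)))}"

definition L2_scalar :: "(real \<Rightarrow> complex) set" where
  "L2_scalar = {f. f \<in> borel_measurable half_line \<and> integrable half_line (\<lambda>t. (cmod (f t))\<^sup>2)}"

definition L2_mat :: "nat \<Rightarrow> nat \<Rightarrow> (real \<Rightarrow> complex mat) set" where
  "L2_mat k r = {f. (\<forall>t\<ge>0. f t \<in> carrier_mat k r) \<and>
     (\<forall>i<k. \<forall>j<r. (\<lambda>t. f t $$ (i, j)) \<in> L2_scalar)}"

definition L2_vec :: "nat \<Rightarrow> (real \<Rightarrow> complex vec) set" where
  "L2_vec k = {h. (\<forall>t\<ge>0. h t \<in> carrier_vec k) \<and> (\<forall>i<k. (\<lambda>t. h t $ i) \<in> L2_scalar)}"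

definition L2_inner :: "(real \<Rightarrow> complex vec) \<Rightarrow> (real \<Rightarrow> complex vec) \<Rightarrow> complex" where
  "L2_inner f h = (LINT t|half_line. f t \<bullet>c h t)"


type_synonym vec_op = "(real \<Rightarrow> complex vec) \<Rightarrow> (real \<Rightarrow> complex vec)"

(* For a bounded operator T from L2_vec n to L2_vec k and h in L2_vec k, the function chosen here
   is unique up to a null set. *)
definition L2_adjoint :: "nat \<Rightarrow> vec_op \<Rightarrow> vec_op" where
  "L2_adjoint n T h =
     (SOME u. u \<in> L2_vec n \<and> (\<forall>f \<in> L2_vec n. L2_inner (T f) h = L2_inner f u))"

(* For a bijective operator A on L2_vec k (modulo null sets), A^(-1) v, up to a null set. *)
definition L2_inverse :: "nat \<Rightarrow> vec_op \<Rightarrow> vec_op" where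
  "L2_inverse k A v = (SOME w. w \<in> L2_vec k \<and> (AE t in half_line. A w t = v t))"

(* A >= c I for some c > 0. In the order of Complex_Order, z <= w means that w - z is real
   and nonnegative. *)
definition strictly_positive :: "nat \<Rightarrow> vec_op \<Rightarrow> bool" where
  "strictly_positive k A \<longleftrightarrow>
     (\<exists>c::real. c > 0 \<and>
       (\<forall>h \<in> L2_vec k. complex_of_real c * L2_inner h h \<le> L2_inner (A h) h))"

(* An operator with values in C^n-valued functions, applied to the r columns of f. *)
definition columnwise :: "nat \<Rightarrow> nat \<Rightarrow> vec_op \<Rightarrow> (real \<Rightarrow> complex mat) \<Rightarrow> (real \<Rightarrow> complex mat)" where
  "columnwise n r S f t = mat_of_cols n (map (\<lambda>j. S (\<lambda>\<tau>. col (f \<tau>) j) t) [0..<r])"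

definition zero_extension :: "nat \<Rightarrow> nat \<Rightarrow> (real \<Rightarrow> complex mat) \<Rightarrow> (real \<Rightarrow> complex mat)" where
  "zero_extension k r f t = (if t \<ge> 0 then f t else 0\<^sub>m k r)"

definition wiener_hopf :: "complex mat \<Rightarrow> (real \<Rightarrow> complex mat) \<Rightarrow> vec_op" where
  "wiener_hopf D g h t = D *\<^sub>v h t +
     vec (dim_row D) (\<lambda>i. LINT \<tau>|half_line.
       (zero_extension (dim_row D) (dim_col D) g (t - \<tau>) *\<^sub>v h \<tau>) $ i)"


definition laplace :: "nat \<Rightarrow> nat \<Rightarrow> (real \<Rightarrow> complex mat) \<Rightarrow> complex \<Rightarrow> complex mat" where
  "laplace k r f s =
     mat k r (\<lambda>(i, j). LINT t|half_line. exp (- (s * complex_of_real t)) * f t $$ (i, j))"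

(* Members are only constrained on the closed right half-plane. *)
definition wiener_plus :: "nat \<Rightarrow> nat \<Rightarrow> (complex \<Rightarrow> complex mat) set" where
  "wiener_plus k r = {F. \<exists>D \<in> carrier_mat k r. \<exists>f \<in> L1_mat k r.
     \<forall>s. Re s \<ge> 0 \<longrightarrow> F s = D + laplace k r f s}"

definition wiener_invertible :: "nat \<Rightarrow> (complex \<Rightarrow> complex mat) \<Rightarrow> bool" where
  "wiener_invertible k F \<longleftrightarrow> F \<in> wiener_plus k k \<and>
     (\<forall>s. Re s \<ge> 0 \<longrightarrow> invertible_mat (F s)) \<and> (\<lambda>s. minv (F s)) \<in> wiener_plus k k"

end

theory Submission
  imports Defs
begin

text \<open>Write \<open>A = T T\<^sup>*\<close> for \<open>T = T\<^sub>G\<close>, let \<open>w = A\<^sup>-\<^sup>1 g\<close>, so that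
\<open>y = T\<^sup>* w\<close> and \<open>T y = g\<close>. Under the Laplace transform \<open>T y = g\<close> reads \<open>G Y = D\<close>. Since
\<open>D D\<^sup>+ = I\<close>, \<open>D E = 0\<close>, \<open>E\<^sup>* D\<^sup>+ = 0\<close> and \<open>E\<^sup>* E = I\<close>, multiplying the block matrix with rows
\<open>G\<close>, \<open>E\<^sup>* Y\<^sup>-\<^sup>1\<close> by \<open>Y [D\<^sup>+ E]\<close> gives the identity. Two things carry the proof: \<open>y\<close> is integrable, and
\<open>Y\<close> has an inverse in the Wiener algebra.

Integrability of \<open>w\<close>, and hence of \<open>y\<close>, is dual to the statement that \<open>A u = f\<close> with bounded \<open>f\<close> has a
bounded solution, with a bound that depends on \<open>sup |f|\<close> only (\<open>sup_bound\<close>, \<open>solution_integrable\<close>).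
To get it, \<open>A u = f\<close> is written as the system \<open>T v = f\<close>, \<open>T\<^sup>* u = v\<close>. Strict positivity makes this
system bounded below in \<open>L\<^sup>2\<close> (\<open>system_lower\<close>), and it contains single convolutions only. The commutator of
a convolution with the weight \<open>exp (- \<eta> |t - a|)\<close> is small for small \<open>\<eta>\<close>, relative to the supremum over
\<open>a\<close> of the weighted norms (\<open>conv_commutator\<close>). So the lower bound survives for the weighted functions,
uniformly in \<open>a\<close>, and the weighted norms of \<open>u\<close> and \<open>v\<close> are bounded by a multiple of \<open>sup |f|\<close>
(\<open>weighted_bound\<close>). Finally \<open>g\<close> is split at \<open>|s| = N\<close>: the inner part maps weighted \<open>L\<^sup>2\<close> bounds to
pointwise bounds, the outer part is small in \<open>L\<^sup>1\<close> and is absorbed, because \<open>D D\<^sup>* \<ge> c\<close>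
(\<open>D_positive\<close>).

The inverse of \<open>Y\<close> is explicit. With \<open>q(\<tau>) = \<integral> w(t)\<^sup>* g(t + \<tau>) dt\<close> for \<open>\<tau> > 0\<close>, two applications
of the adjoint relation between \<open>T\<close> and \<open>T\<^sup>*\<close> give \<open>q - q * y = y - D\<^sup>* w\<close>
(\<open>causal_part_identity\<close>). The projection \<open>I - D\<^sup>+ D\<close> annihilates \<open>D\<^sup>*\<close>, so together with \<open>D y + g * y = g\<close> the
function \<open>z = D\<^sup>+ g + (I - D\<^sup>+ D) q\<close> satisfies \<open>z = y + z * y\<close>, that is, \<open>I\<close> plus the Laplace transform of
\<open>z\<close> is a left inverse of \<open>Y\<close> (\<open>resolvent_exists\<close>). Both are square matrices, hence \<open>det Y(s) \<noteq> 0\<close>.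

The analysis uses Borel functions on the line that vanish on the negative half line, so that Tonelli's theorem
applies to Borel product measures. Functions on the half line are replaced by such representatives in
\<open>borel_rep\<close>, and the adjoint and the inverse, which are chosen up to null sets, are expressed through representatives in \<open>Tad_rep\<close>
and \<open>inverse_rep\<close>.\<close>

section \<open>Square integrable functions on the line\<close>

definition sqint :: "(real \<Rightarrow> complex) \<Rightarrow> bool" where
  "sqint f \<longleftrightarrow> f \<in> borel_measurable borel \<and> integrable lborel (\<lambda>t. (cmod (f t))\<^sup>2)"

definition l2n :: "(real \<Rightarrow> complex) \<Rightarrow> real" where
  "l2n f = sqrt (LINT t|lborel. (cmod (f t))\<^sup>2)"

lemma sqint_measurable [measurable_dest]: "sqint f \<Longrightarrow> f \<in> borel_measurable borel"
  by (simp add: sqint_def)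

lemma l2n_nonneg [simp]: "0 \<le> l2n f"
  by (simp add: l2n_def)

lemma l2n_sq: "(l2n f)\<^sup>2 = (LINT t|lborel. (cmod (f t))\<^sup>2)"
  by (simp add: l2n_def)

lemma nn_integral_cmod_sq: "sqint f \<Longrightarrow> (\<integral>\<^sup>+t. ennreal ((cmod (f t))\<^sup>2) \<partial>lborel) = ennreal ((l2n f)\<^sup>2)"
  by (simp add: l2n_sq sqint_def nn_integral_eq_integral)

lemma sqintI_bound:
  assumes [measurable]: "f \<in> borel_measurable borel"
    and "(\<integral>\<^sup>+t. ennreal ((cmod (f t))\<^sup>2) \<partial>lborel) \<le> ennreal (B\<^sup>2)" and "0 \<le> B"
  shows "sqint f" and "l2n f \<le> B"
proof -
  have i: "integrable lborel (\<lambda>t. (cmod (f t))\<^sup>2)"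
    using assms(2) by (intro integrableI_bounded) (auto intro: le_less_trans)
  then show "sqint f" by (simp add: sqint_def)
  then have "ennreal ((l2n f)\<^sup>2) \<le> ennreal (B\<^sup>2)"
    using assms(2) by (simp add: nn_integral_cmod_sq)
  then have "(l2n f)\<^sup>2 \<le> B\<^sup>2" by simp
  then show "l2n f \<le> B" using assms(3) power2_le_imp_le by blast
qed

lemma sqint_mono:
  assumes "sqint g" and [measurable]: "f \<in> borel_measurable borel" and "\<And>t. cmod (f t) \<le> B * cmod (g t)" and "0 \<le> B"
  shows "sqint f" and "l2n f \<le> B * l2n g"
proof -
  have "(\<integral>\<^sup>+t. ennreal ((cmod (f t))\<^sup>2) \<partial>lborel) \<le> (\<integral>\<^sup>+t. ennreal (B\<^sup>2) * ennreal ((cmod (g t))\<^sup>2) \<partial>lborel)"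
  proof (rule nn_integral_mono)
    fix t
    have "(cmod (f t))\<^sup>2 \<le> (B * cmod (g t))\<^sup>2" by (intro power_mono assms) auto
    then show "ennreal ((cmod (f t))\<^sup>2) \<le> ennreal (B\<^sup>2) * ennreal ((cmod (g t))\<^sup>2)"
      by (simp add: ennreal_mult[symmetric] power_mult_distrib)
  qed
  also have "\<dots> = ennreal (B\<^sup>2) * ennreal ((l2n g)\<^sup>2)"
    using assms(1) by (subst nn_integral_cmult) (auto simp: nn_integral_cmod_sq sqint_def)
  also have "\<dots> = ennreal ((B * l2n g)\<^sup>2)"
    by (simp add: ennreal_mult[symmetric] power_mult_distrib)
  finally have *: "(\<integral>\<^sup>+t. ennreal ((cmod (f t))\<^sup>2) \<partial>lborel) \<le> ennreal ((B * l2n g)\<^sup>2)" .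
  have "0 \<le> B * l2n g" using assms(4) by simp
  from sqintI_bound[OF _ * this] show "sqint f" "l2n f \<le> B * l2n g" by auto
qed

lemma l2n_cong_AE:
  assumes "f \<in> borel_measurable borel" "g \<in> borel_measurable borel" "AE t in lborel. f t = g t"
  shows "l2n f = l2n g" and "sqint f \<longleftrightarrow> sqint g"
proof -
  have ae: "AE t in lborel. (cmod (f t))\<^sup>2 = (cmod (g t))\<^sup>2" using assms(3) by eventually_elim simp
  have [measurable]: "f \<in> borel_measurable borel" "g \<in> borel_measurable borel" by fact+
  show "l2n f = l2n g" unfolding l2n_def
    using assms(1,2) by (intro arg_cong[where f=sqrt] integral_cong_AE ae) auto
  show "sqint f \<longleftrightarrow> sqint g" unfolding sqint_def
    using assms(1,2) by (simp add: integrable_cong_AE[OF _ _ ae])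
qed

lemma sqint_zero [simp]: "sqint (\<lambda>t. 0)" "l2n (\<lambda>t. 0) = 0"
  by (auto simp: sqint_def l2n_def)

lemma sqint_cmult: "sqint f \<Longrightarrow> sqint (\<lambda>t. c * f t)"
  by (rule sqint_mono(1)[of f _ "cmod c"]) (auto simp: norm_mult)

lemma l2n_cmult: "l2n (\<lambda>t. c * f t) = cmod c * l2n f"
  by (simp add: l2n_def norm_mult power_mult_distrib real_sqrt_mult)

lemma sqint_prod_integrable:
  assumes "sqint f" "sqint g"
  shows "integrable lborel (\<lambda>t. cmod (f t) * cmod (g t))" "integrable lborel (\<lambda>t. f t * g t)"
proof -
  have [measurable]: "f \<in> borel_measurable borel" "g \<in> borel_measurable borel"
    using assms by (auto simp: sqint_def)
  have "integrable lborel (\<lambda>t. (cmod (f t))\<^sup>2 + (cmod (g t))\<^sup>2)"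
    using assms by (auto simp: sqint_def)
  then show *: "integrable lborel (\<lambda>t. cmod (f t) * cmod (g t))"
  proof (rule Bochner_Integration.integrable_bound)
    show "AE t in lborel. norm (cmod (f t) * cmod (g t)) \<le> norm ((cmod (f t))\<^sup>2 + (cmod (g t))\<^sup>2)"
    proof (rule AE_I2)
      fix t
      have "2 * (cmod (f t) * cmod (g t)) \<le> (cmod (f t))\<^sup>2 + (cmod (g t))\<^sup>2"
        using sum_squares_bound[of "cmod (f t)" "cmod (g t)"] by simp
      moreover have "0 \<le> cmod (f t) * cmod (g t)" by simp
      ultimately have "cmod (f t) * cmod (g t) \<le> (cmod (f t))\<^sup>2 + (cmod (g t))\<^sup>2" by linarith
      then show "norm (cmod (f t) * cmod (g t)) \<le> norm ((cmod (f t))\<^sup>2 + (cmod (g t))\<^sup>2)" by simp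
    qed
  qed simp
  show "integrable lborel (\<lambda>t. f t * g t)"
    by (rule Bochner_Integration.integrable_bound[OF *]) (auto simp: norm_mult)
qed

lemma l2_cauchy_schwarz:
  assumes "sqint f" "sqint g"
  shows "(LINT t|lborel. cmod (f t) * cmod (g t)) \<le> l2n f * l2n g"
proof -
  have [measurable]: "f \<in> borel_measurable borel" "g \<in> borel_measurable borel"
    using assms by (auto simp: sqint_def)
  let ?I = "LINT t|lborel. cmod (f t) * cmod (g t)"
  have "(\<integral>\<^sup>+t. ennreal (cmod (f t)) * ennreal (cmod (g t)) \<partial>lborel)\<^sup>2
     \<le> (\<integral>\<^sup>+t. (ennreal (cmod (f t)))\<^sup>2 \<partial>lborel) * (\<integral>\<^sup>+t. (ennreal (cmod (g t)))\<^sup>2 \<partial>lborel)"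
    by (rule Cauchy_Schwarz_nn_integral) auto
  moreover have "(\<integral>\<^sup>+t. ennreal (cmod (f t)) * ennreal (cmod (g t)) \<partial>lborel) = ennreal ?I"
    using sqint_prod_integrable(1)[OF assms] by (simp add: ennreal_mult[symmetric] nn_integral_eq_integral)
  ultimately have "ennreal (?I\<^sup>2) \<le> ennreal ((l2n f * l2n g)\<^sup>2)"
    by (simp add: ennreal_power nn_integral_cmod_sq[OF assms(1)] nn_integral_cmod_sq[OF assms(2)]
        ennreal_mult[symmetric] power_mult_distrib)
  then have "?I\<^sup>2 \<le> (l2n f * l2n g)\<^sup>2" by simp
  then show ?thesis by (rule power2_le_imp_le) simp
qed

lemma l2_inner_bound:
  assumes "sqint f" "sqint g"
  shows "cmod (LINT t|lborel. f t * g t) \<le> l2n f * l2n g"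
  using integral_norm_bound[of lborel "\<lambda>t. f t * g t"] l2_cauchy_schwarz[OF assms]
  by (simp add: norm_mult)

lemma borel_measurable_cnj [measurable (raw)]:
  "f \<in> borel_measurable M \<Longrightarrow> (\<lambda>x. cnj (f x)) \<in> borel_measurable M"
  by (erule measurable_compose) (intro borel_measurable_continuous_onI continuous_intros)

lemma sqint_cnj: "sqint f \<Longrightarrow> sqint (\<lambda>t. cnj (f t))" and l2n_cnj: "l2n (\<lambda>t. cnj (f t)) = l2n f"
  by (auto simp: sqint_def l2n_def)

lemma sqint_add:
  assumes "sqint f" "sqint g"
  shows "sqint (\<lambda>t. f t + g t)" and "l2n (\<lambda>t. f t + g t) \<le> l2n f + l2n g"
proof -
  have [measurable]: "f \<in> borel_measurable borel" "g \<in> borel_measurable borel"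
    using assms by (auto simp: sqint_def)
  let ?h = "\<lambda>t. (cmod (f t))\<^sup>2 + (2 * (cmod (f t) * cmod (g t)) + (cmod (g t))\<^sup>2)"
  have int: "integrable lborel (\<lambda>t. (cmod (f t))\<^sup>2)" "integrable lborel (\<lambda>t. (cmod (g t))\<^sup>2)"
    using assms by (auto simp: sqint_def)
  have ih: "integrable lborel ?h" using int sqint_prod_integrable(1)[OF assms] by auto
  have le: "(cmod (f t + g t))\<^sup>2 \<le> ?h t" for t
  proof -
    have "(cmod (f t + g t))\<^sup>2 \<le> (cmod (f t) + cmod (g t))\<^sup>2"
      by (intro power_mono norm_triangle_ineq) auto
    then show ?thesis by (simp add: power2_eq_square algebra_simps)
  qed
  have ii: "integrable lborel (\<lambda>t. (cmod (f t + g t))\<^sup>2)"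
    by (rule Bochner_Integration.integrable_bound[OF ih]) (auto intro!: AE_I2 order_trans[OF le])
  then show s: "sqint (\<lambda>t. f t + g t)" by (simp add: sqint_def)
  have "(l2n (\<lambda>t. f t + g t))\<^sup>2 \<le> (LINT t|lborel. ?h t)"
    unfolding l2n_sq by (rule integral_mono[OF ii ih le])
  also have "\<dots> = (l2n f)\<^sup>2 + (2 * (LINT t|lborel. cmod (f t) * cmod (g t)) + (l2n g)\<^sup>2)"
    using int sqint_prod_integrable(1)[OF assms] by (simp add: l2n_sq)
  also have "\<dots> \<le> (l2n f + l2n g)\<^sup>2"
    using l2_cauchy_schwarz[OF assms] by (simp add: power2_eq_square algebra_simps)
  finally show "l2n (\<lambda>t. f t + g t) \<le> l2n f + l2n g"
    using power2_le_imp_le l2n_nonneg add_nonneg_nonneg by metis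
qed

lemma sqint_diff:
  assumes "sqint f" "sqint g"
  shows "sqint (\<lambda>t. f t - g t)" and "l2n (\<lambda>t. f t - g t) \<le> l2n f + l2n g"
  using sqint_add[OF assms(1) sqint_cmult[OF assms(2), of "-1"]] l2n_cmult[of "-1" g] by auto

lemma sqint_sum:
  assumes "\<And>i. i \<in> I \<Longrightarrow> sqint (f i)"
  shows "sqint (\<lambda>t. \<Sum>i\<in>I. f i t)" and "l2n (\<lambda>t. \<Sum>i\<in>I. f i t) \<le> (\<Sum>i\<in>I. l2n (f i))"
proof -
  have "sqint (\<lambda>t. \<Sum>i\<in>I. f i t) \<and> l2n (\<lambda>t. \<Sum>i\<in>I. f i t) \<le> (\<Sum>i\<in>I. l2n (f i))"
    using assms
  proof (induction I rule: infinite_finite_induct)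
    case (insert x F)
    have "sqint (f x)" "sqint (\<lambda>t. \<Sum>i\<in>F. f i t)" using insert by auto
    from sqint_add[OF this] show ?case using insert by auto
  qed auto
  then show "sqint (\<lambda>t. \<Sum>i\<in>I. f i t)" and "l2n (\<lambda>t. \<Sum>i\<in>I. f i t) \<le> (\<Sum>i\<in>I. l2n (f i))" by auto
qed

lemma l2n_zero_AE:
  assumes "sqint f" "l2n f = 0" shows "AE t in lborel. f t = 0"
proof -
  have "(LINT t|lborel. (cmod (f t))\<^sup>2) = 0" using assms(2) l2n_sq[of f] by simp
  then have "AE t in lborel. (cmod (f t))\<^sup>2 = 0"
    using assms(1) by (subst (asm) integral_nonneg_eq_0_iff_AE) (auto simp: sqint_def)
  then show ?thesis by simp
qed

lemma sqint_shift:
  assumes "sqint f" "\<bar>c\<bar> = 1"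
  shows "sqint (\<lambda>t. f (a + c * t))" "l2n (\<lambda>t. f (a + c * t)) = l2n f"
proof -
  have c: "c \<noteq> 0" using assms(2) by auto
  have [measurable]: "f \<in> borel_measurable borel" using assms by (auto simp: sqint_def)
  show "sqint (\<lambda>t. f (a + c * t))"
    using lborel_integrable_real_affine[of "\<lambda>t. (cmod (f t))\<^sup>2" c a] c assms(1)
    by (simp add: sqint_def)
  show "l2n (\<lambda>t. f (a + c * t)) = l2n f"
    using lborel_integral_real_affine[OF c, of "\<lambda>t. (cmod (f t))\<^sup>2" a] assms(2)
    by (simp add: l2n_def)
qed

text \<open>Minkowski's inequality for a series, by monotone convergence from its finite sums. In the Riesz--Fischer theorem
below it shows that an absolutely convergent series in \<open>L\<^sup>2\<close> converges absolutely almost everywhere, and,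
applied to the shifted series, it bounds the tails.\<close>

lemma nn_sq_suminf:
  assumes f: "\<And>n. sqint (f n)" and s: "summable (\<lambda>n. l2n (f n))"
  shows "(\<integral>\<^sup>+t. (\<Sum>n. ennreal (cmod (f n t)))\<^sup>2 \<partial>lborel) \<le> ennreal ((\<Sum>n. l2n (f n))\<^sup>2)"
proof -
  have [measurable]: "\<And>n. f n \<in> borel_measurable borel" using f by (auto simp: sqint_def)
  define P where "P = (\<lambda>N t. (\<Sum>n<N. ennreal (cmod (f n t)))\<^sup>2)"
  have inc: "incseq P" unfolding P_def incseq_def le_fun_def
    by (auto intro!: power_mono sum_mono2 simp del: sum_ennreal)
  have lim: "(SUP N. P N t) = (\<Sum>n. ennreal (cmod (f n t)))\<^sup>2" for t
  proof (rule LIMSEQ_unique)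
    show "(\<lambda>N. P N t) \<longlonglongrightarrow> (SUP N. P N t)"
      using inc by (intro LIMSEQ_SUP) (auto simp: incseq_def le_fun_def)
    have "(\<lambda>N. \<Sum>n<N. ennreal (cmod (f n t))) \<longlonglongrightarrow> (\<Sum>n. ennreal (cmod (f n t)))"
      by (rule summable_LIMSEQ) simp
    then show "(\<lambda>N. P N t) \<longlonglongrightarrow> (\<Sum>n. ennreal (cmod (f n t)))\<^sup>2"
      unfolding P_def by (simp only: power2_eq_square) (intro tendsto_mult_ennreal, auto)
  qed
  have "(\<integral>\<^sup>+t. (\<Sum>n. ennreal (cmod (f n t)))\<^sup>2 \<partial>lborel) = (SUP N. \<integral>\<^sup>+t. P N t \<partial>lborel)"
    unfolding lim[symmetric] by (rule nn_integral_monotone_convergence_SUP[OF inc]) (auto simp: P_def)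
  also have "\<dots> \<le> ennreal ((\<Sum>n. l2n (f n))\<^sup>2)"
  proof (rule SUP_least)
    fix N
    have sq: "sqint (\<lambda>t. complex_of_real (cmod (f n t)))" "l2n (\<lambda>t. complex_of_real (cmod (f n t))) = l2n (f n)" for n
      using f[of n] by (auto simp: sqint_def l2n_def)
    let ?F = "\<lambda>t. \<Sum>n<N. complex_of_real (cmod (f n t))"
    have F: "sqint ?F" "l2n ?F \<le> (\<Sum>n<N. l2n (f n))"
      using sqint_sum[of "{..<N}" "\<lambda>n t. complex_of_real (cmod (f n t))"] sq by auto
    have "P N t = ennreal ((cmod (?F t))\<^sup>2)" for t
    proof -
      have "cmod (?F t) = (\<Sum>n<N. cmod (f n t))"
        by (simp only: of_real_sum[symmetric] norm_of_real) (simp add: sum_nonneg)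
      then show ?thesis by (simp add: P_def sum_ennreal ennreal_power sum_nonneg)
    qed
    then have "(\<integral>\<^sup>+t. P N t \<partial>lborel) = ennreal ((l2n ?F)\<^sup>2)"
      using nn_integral_cmod_sq[OF F(1)] by simp
    also have "\<dots> \<le> ennreal ((\<Sum>n. l2n (f n))\<^sup>2)"
      using F(2) sum_le_suminf[OF s, of "{..<N}"] by (intro ennreal_leI power_mono) auto
    finally show "(\<integral>\<^sup>+t. P N t \<partial>lborel) \<le> ennreal ((\<Sum>n. l2n (f n))\<^sup>2)" .
  qed
  finally show ?thesis .
qed

lemma riesz_fischer:
  assumes f: "\<And>n. sqint (f n)" and s: "summable (\<lambda>n. l2n (f n))"
    and z: "\<And>n t. t < 0 \<Longrightarrow> f n t = 0"
  obtains w where "sqint w" "\<And>t. t < 0 \<Longrightarrow> w t = 0"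
    "(\<lambda>N. l2n (\<lambda>t. w t - (\<Sum>n<N. f n t))) \<longlonglongrightarrow> 0"
proof -
  have [measurable]: "\<And>n. f n \<in> borel_measurable borel" using f by (auto simp: sqint_def)
  define w where "w = (\<lambda>t. (\<Sum>n. f n t))"
  have [measurable]: "w \<in> borel_measurable borel" unfolding w_def by measurable
  have bd: "(\<integral>\<^sup>+t. (\<Sum>n. ennreal (cmod (f n t)))\<^sup>2 \<partial>lborel) \<le> ennreal ((\<Sum>n. l2n (f n))\<^sup>2)"
    by (rule nn_sq_suminf[OF f s])
  have "AE t in lborel. (\<Sum>n. ennreal (cmod (f n t)))\<^sup>2 \<noteq> \<infinity>"
    by (rule nn_integral_noteq_infinite) (use bd in \<open>auto simp: top_unique\<close>)
  then have sm: "AE t in lborel. summable (\<lambda>n. cmod (f n t))"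
    by eventually_elim (auto intro!: summable_suminf_not_top)
  have tail: "sqint (\<lambda>t. w t - (\<Sum>n<N. f n t)) \<and> l2n (\<lambda>t. w t - (\<Sum>n<N. f n t)) \<le> (\<Sum>n. l2n (f (n + N)))" for N
  proof -
    have sN: "summable (\<lambda>n. l2n (f (n + N)))" using s by (subst summable_iff_shift)
    have "(\<integral>\<^sup>+t. ennreal ((cmod (w t - (\<Sum>n<N. f n t)))\<^sup>2) \<partial>lborel)
       \<le> (\<integral>\<^sup>+t. (\<Sum>n. ennreal (cmod (f (n + N) t)))\<^sup>2 \<partial>lborel)"
    proof (rule nn_integral_mono_AE)
      show "AE t in lborel. ennreal ((cmod (w t - (\<Sum>n<N. f n t)))\<^sup>2) \<le> (\<Sum>n. ennreal (cmod (f (n + N) t)))\<^sup>2"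
        using sm
      proof eventually_elim
        case (elim t)
        have e1: "w t - (\<Sum>n<N. f n t) = (\<Sum>n. f (n + N) t)"
          unfolding w_def using suminf_split_initial_segment[OF summable_norm_cancel[OF elim], of N] by simp
        have sn: "summable (\<lambda>n. cmod (f (n + N) t))" using elim by (subst summable_iff_shift)
        have "cmod (\<Sum>n. f (n + N) t) \<le> (\<Sum>n. cmod (f (n + N) t))" by (rule summable_norm[OF sn])
        then have "ennreal ((cmod (\<Sum>n. f (n + N) t))\<^sup>2) \<le> ennreal ((\<Sum>n. cmod (f (n + N) t))\<^sup>2)"
          by (intro ennreal_leI power_mono) auto
        also have "\<dots> = (\<Sum>n. ennreal (cmod (f (n + N) t)))\<^sup>2"
          by (subst suminf_ennreal2[OF _ sn]) (auto simp: ennreal_power suminf_nonneg[OF sn])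
        finally show ?case by (simp add: e1)
      qed
    qed
    also have "\<dots> \<le> ennreal ((\<Sum>n. l2n (f (n + N)))\<^sup>2)"
      by (rule nn_sq_suminf[OF f sN])
    finally show ?thesis
      by (intro conjI sqintI_bound) (auto simp: suminf_nonneg[OF sN])
  qed
  show ?thesis
  proof
    show "sqint w" using tail[of 0] by simp
    show "w t = 0" if "t < 0" for t using z that by (simp add: w_def)
    show "(\<lambda>N. l2n (\<lambda>t. w t - (\<Sum>n<N. f n t))) \<longlonglongrightarrow> 0"
    proof (rule tendsto_sandwich[OF _ _ tendsto_const])
      have "(\<lambda>N. (\<Sum>n. l2n (f n)) - (\<Sum>n<N. l2n (f n))) \<longlonglongrightarrow> (\<Sum>n. l2n (f n)) - (\<Sum>n. l2n (f n))"
        by (intro tendsto_diff tendsto_const summable_LIMSEQ s)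
      then show "(\<lambda>N. (\<Sum>n. l2n (f (n + N)))) \<longlonglongrightarrow> 0"
        using suminf_minus_initial_segment[OF s] by simp
      show "\<forall>\<^sub>F N in sequentially. 0 \<le> l2n (\<lambda>t. w t - (\<Sum>n<N. f n t))" by simp
      show "\<forall>\<^sub>F N in sequentially. l2n (\<lambda>t. w t - (\<Sum>n<N. f n t)) \<le> (\<Sum>n. l2n (f (n + N)))"
        using tail by simp
    qed
  qed
qed

section \<open>Convolution\<close>

definition conv :: "(real \<Rightarrow> complex) \<Rightarrow> (real \<Rightarrow> complex) \<Rightarrow> real \<Rightarrow> complex" where
  "conv a b t = (LINT s|lborel. a (t - s) * b s)"

text \<open>Convolution with \<open>reflect a\<close> is the adjoint of convolution with \<open>a\<close>.\<close>

definition reflect :: "(real \<Rightarrow> complex) \<Rightarrow> real \<Rightarrow> complex" where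
  "reflect a t = cnj (a (- t))"

definition l1n :: "(real \<Rightarrow> complex) \<Rightarrow> real" where
  "l1n a = (LINT t|lborel. cmod (a t))"

lemma l1n_nonneg [simp]: "0 \<le> l1n a"
  by (simp add: l1n_def)

lemma borel_measurable_conv [measurable]:
  assumes [measurable]: "a \<in> borel_measurable borel" "b \<in> borel_measurable borel"
  shows "conv a b \<in> borel_measurable borel"
  unfolding conv_def by measurable

lemma borel_measurable_reflect [measurable]:
  assumes [measurable]: "a \<in> borel_measurable borel"
  shows "reflect a \<in> borel_measurable borel"
  unfolding reflect_def by measurable

lemma sqint_reflect: "sqint a \<Longrightarrow> sqint (reflect a)" and l2n_reflect: "sqint a \<Longrightarrow> l2n (reflect a) = l2n a"
  using sqint_cnj[OF sqint_shift(1)[of a "-1" 0]] sqint_shift(2)[of a "-1" 0]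
  by (simp_all add: reflect_def[abs_def] l2n_cnj)

lemma integrable_reflect:
  assumes "integrable lborel a"
  shows "integrable lborel (reflect a)" and "l1n (reflect a) = l1n a"
proof -
  have "integrable lborel (\<lambda>t. a (0 + (-1) * t))"
    using assms by (rule lborel_integrable_real_affine) simp
  then show "integrable lborel (reflect a)"
    unfolding reflect_def using integrable_cnj by auto
  show "l1n (reflect a) = l1n a"
    using lborel_integral_real_affine[of "-1" "\<lambda>t. cmod (a t)" 0] by (simp add: l1n_def reflect_def)
qed

lemma sqint_flip: "sqint a \<Longrightarrow> sqint (\<lambda>s. a (t - s))" "sqint a \<Longrightarrow> l2n (\<lambda>s. a (t - s)) = l2n a"
  using sqint_shift[of a "-1" t] by simp_all

lemma conv_integrable:
  assumes "sqint a" "sqint b" shows "integrable lborel (\<lambda>s. a (t - s) * b s)"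
  by (intro sqint_prod_integrable sqint_flip assms)

lemma conv_bound:
  assumes "sqint a" "sqint b" shows "cmod (conv a b t) \<le> l2n a * l2n b"
  using l2_inner_bound[OF sqint_flip(1)[OF assms(1)] assms(2), of t] sqint_flip(2)[OF assms(1), of t]
  by (simp add: conv_def)

lemma lborel_integral_flip:
  fixes f :: "real \<Rightarrow> 'a :: {banach, second_countable_topology}"
  shows "(LINT s|lborel. f (t - s)) = (LINT s|lborel. f s)"
  using lborel_integral_real_affine[of "-1" f t] by simp

lemma conv_flip: "conv a b t = (LINT s|lborel. a s * b (t - s))"
  unfolding conv_def by (subst lborel_integral_flip[of _ t, symmetric]) simp

lemma conv_commute: "conv a b t = conv b a t"
  unfolding conv_flip[of a b] conv_def[of b a]
  by (rule Bochner_Integration.integral_cong[OF refl], rule mult.commute)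

lemma conv_add_right:
  assumes "sqint a" "sqint b" "sqint c"
  shows "conv a (\<lambda>s. b s + c s) t = conv a b t + conv a c t"
  using conv_integrable[OF assms(1,2), of t] conv_integrable[OF assms(1,3), of t]
  by (simp add: conv_def distrib_left)

lemma conv_cmult_right: "conv a (\<lambda>s. c * b s) t = c * conv a b t"
  by (simp add: conv_def mult.left_commute)

lemma conv_diff_right:
  assumes "sqint a" "sqint b" "sqint c"
  shows "conv a (\<lambda>s. b s - c s) t = conv a b t - conv a c t"
  using conv_integrable[OF assms(1,2), of t] conv_integrable[OF assms(1,3), of t]
  by (simp add: conv_def right_diff_distrib)

lemma norm_integral_le_nn_integral:
  fixes f :: "real \<Rightarrow> complex"
  shows "ennreal (cmod (LINT s|lborel. f s)) \<le> (\<integral>\<^sup>+s. ennreal (cmod (f s)) \<partial>lborel)"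
  by (cases "integrable lborel f") (auto intro: integral_norm_bound_ennreal simp: not_integrable_integral_eq)

text \<open>An integral version of the Schur test, from which Young's inequality and the commutator estimate below follow. It
is the Cauchy--Schwarz inequality for the measure with density \<open>\<alpha>\<close>, followed by Tonelli's theorem.\<close>

lemma schur_nn:
  fixes \<alpha> :: "real \<Rightarrow> ennreal" and F :: "real \<Rightarrow> real \<Rightarrow> ennreal"
  assumes [measurable]: "\<alpha> \<in> borel_measurable borel"
    "(\<lambda>x. F (fst x) (snd x)) \<in> borel_measurable (borel \<Otimes>\<^sub>M borel)"
    and B: "\<And>s. (\<integral>\<^sup>+t. (F t s)\<^sup>2 \<partial>lborel) \<le> B"
  shows "(\<integral>\<^sup>+t. (\<integral>\<^sup>+s. \<alpha> s * F t s \<partial>lborel)\<^sup>2 \<partial>lborel) \<le> (\<integral>\<^sup>+s. \<alpha> s \<partial>lborel)\<^sup>2 * B"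
proof -
  let ?I = "\<integral>\<^sup>+s. \<alpha> s \<partial>lborel"
  have [measurable]: "F t \<in> borel_measurable borel" for t
    using measurable_compose[OF measurable_Pair1'[of t borel borel] assms(2)] by simp
  have [measurable]: "(\<lambda>t. F t s) \<in> borel_measurable borel" for s
    using measurable_compose[OF measurable_Pair2'[of s borel borel] assms(2)] by simp
  have "(\<integral>\<^sup>+s. \<alpha> s * F t s \<partial>lborel)\<^sup>2 \<le> (\<integral>\<^sup>+s. \<alpha> s * (F t s)\<^sup>2 \<partial>lborel) * ?I" for t
  proof -
    let ?M = "density lborel \<alpha>"
    have "(\<integral>\<^sup>+s. F t s * 1 \<partial>?M)\<^sup>2 \<le> (\<integral>\<^sup>+s. (F t s)\<^sup>2 \<partial>?M) * (\<integral>\<^sup>+s. 1\<^sup>2 \<partial>?M)"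
      by (rule Cauchy_Schwarz_nn_integral) auto
    moreover have "(\<integral>\<^sup>+s. F t s * 1 \<partial>?M) = (\<integral>\<^sup>+s. \<alpha> s * F t s \<partial>lborel)"
      by (subst nn_integral_density) auto
    moreover have "(\<integral>\<^sup>+s. (F t s)\<^sup>2 \<partial>?M) = (\<integral>\<^sup>+s. \<alpha> s * (F t s)\<^sup>2 \<partial>lborel)"
      by (subst nn_integral_density) auto
    moreover have "(\<integral>\<^sup>+s. 1\<^sup>2 \<partial>?M) = ?I"
      by (subst nn_integral_density) auto
    ultimately show ?thesis by simp
  qed
  then have "(\<integral>\<^sup>+t. (\<integral>\<^sup>+s. \<alpha> s * F t s \<partial>lborel)\<^sup>2 \<partial>lborel)
      \<le> (\<integral>\<^sup>+t. (\<integral>\<^sup>+s. \<alpha> s * (F t s)\<^sup>2 \<partial>lborel) * ?I \<partial>lborel)"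
    by (intro nn_integral_mono)
  also have "\<dots> = (\<integral>\<^sup>+t. (\<integral>\<^sup>+s. \<alpha> s * (F t s)\<^sup>2 \<partial>lborel) \<partial>lborel) * ?I"
    by (rule nn_integral_multc) measurable
  also have "(\<integral>\<^sup>+t. (\<integral>\<^sup>+s. \<alpha> s * (F t s)\<^sup>2 \<partial>lborel) \<partial>lborel)
     = (\<integral>\<^sup>+s. (\<integral>\<^sup>+t. \<alpha> s * (F t s)\<^sup>2 \<partial>lborel) \<partial>lborel)"
    by (rule lborel_pair.Fubini'[symmetric]) measurable
  also have "\<dots> = (\<integral>\<^sup>+s. \<alpha> s * (\<integral>\<^sup>+t. (F t s)\<^sup>2 \<partial>lborel) \<partial>lborel)"
    by (intro nn_integral_cong nn_integral_cmult) measurable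
  also have "\<dots> \<le> (\<integral>\<^sup>+s. \<alpha> s * B \<partial>lborel)"
    by (intro nn_integral_mono mult_left_mono B) auto
  also have "\<dots> = ?I * B" by (rule nn_integral_multc) auto
  finally show ?thesis
    by (simp add: power2_eq_square mult_ac mult_right_mono mult_left_mono)
qed

lemma schur:
  fixes \<alpha> :: "real \<Rightarrow> real" and F :: "real \<Rightarrow> real \<Rightarrow> real"
  assumes [measurable]: "X \<in> borel_measurable borel"
    and \<alpha>: "integrable lborel \<alpha>" "\<And>s. 0 \<le> \<alpha> s"
    and [measurable]: "(\<lambda>x. F (fst x) (snd x)) \<in> borel_measurable (borel \<Otimes>\<^sub>M borel)"
    and F: "\<And>t s. 0 \<le> F t s"
    and B: "\<And>s. (\<integral>\<^sup>+t. ennreal ((F t s)\<^sup>2) \<partial>lborel) \<le> ennreal (B\<^sup>2)" "0 \<le> B"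
    and X: "\<And>t. ennreal (cmod (X t)) \<le> (\<integral>\<^sup>+s. ennreal (\<alpha> s * F t s) \<partial>lborel)"
  shows "sqint X" and "l2n X \<le> (LINT s|lborel. \<alpha> s) * B"
proof -
  have [measurable]: "\<alpha> \<in> borel_measurable borel" using \<alpha>(1) borel_measurable_integrable by auto
  have "(\<integral>\<^sup>+t. ennreal ((cmod (X t))\<^sup>2) \<partial>lborel) = (\<integral>\<^sup>+t. (ennreal (cmod (X t)))\<^sup>2 \<partial>lborel)"
    by (simp add: ennreal_power)
  also have "\<dots> \<le> (\<integral>\<^sup>+t. (\<integral>\<^sup>+s. ennreal (\<alpha> s) * ennreal (F t s) \<partial>lborel)\<^sup>2 \<partial>lborel)"
    using X by (intro nn_integral_mono power_mono) (auto simp: ennreal_mult[symmetric] F \<alpha>)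
  also have "\<dots> \<le> (\<integral>\<^sup>+s. ennreal (\<alpha> s) \<partial>lborel)\<^sup>2 * ennreal (B\<^sup>2)"
    using B(1) F by (intro schur_nn) (auto simp: ennreal_power)
  also have "\<dots> = ennreal (((LINT s|lborel. \<alpha> s) * B)\<^sup>2)"
    using \<alpha> B(2) by (simp add: nn_integral_eq_integral ennreal_mult[symmetric] ennreal_power power_mult_distrib)
  finally have *: "(\<integral>\<^sup>+t. ennreal ((cmod (X t))\<^sup>2) \<partial>lborel) \<le> ennreal (((LINT s|lborel. \<alpha> s) * B)\<^sup>2)" .
  have "0 \<le> (LINT s|lborel. \<alpha> s) * B" using \<alpha> B(2) by simp
  from sqintI_bound[OF _ * this] show "sqint X" and "l2n X \<le> (LINT s|lborel. \<alpha> s) * B" by auto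
qed

lemma young:
  assumes "integrable lborel a" "sqint b"
  shows "sqint (conv a b)" and "l2n (conv a b) \<le> l1n a * l2n b"
proof -
  have [measurable]: "a \<in> borel_measurable borel" "b \<in> borel_measurable borel"
    using assms borel_measurable_integrable by (auto simp: sqint_def)
  have B: "(\<integral>\<^sup>+t. ennreal ((cmod (b (t - s)))\<^sup>2) \<partial>lborel) \<le> ennreal ((l2n b)\<^sup>2)" for s
    using sqint_shift[OF assms(2), of 1 "-s"] by (auto dest: nn_integral_cmod_sq)
  have X: "ennreal (cmod (conv a b t)) \<le> (\<integral>\<^sup>+s. ennreal (cmod (a s) * cmod (b (t - s))) \<partial>lborel)" for t
    using norm_integral_le_nn_integral[of "\<lambda>s. a s * b (t - s)"] by (simp add: conv_flip norm_mult)
  show "sqint (conv a b)" and "l2n (conv a b) \<le> l1n a * l2n b"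
    unfolding l1n_def using assms(1)
    by (rule_tac schur[OF _ _ _ _ _ B _ X]; simp add: integrable_norm)+
qed

subsection \<open>Exponential weights\<close>

text \<open>Exponential weights are used because a shift by \<open>s\<close> changes them by at most the factor \<open>exp (\<eta> |s|)\<close>,
which tends to 1 with \<open>\<eta>\<close>.\<close>

definition wt :: "real \<Rightarrow> real \<Rightarrow> real \<Rightarrow> complex" where
  "wt \<eta> c t = complex_of_real (exp (- (\<eta> * \<bar>t - c\<bar>)))"

lemma borel_measurable_wt [measurable]: "wt \<eta> c \<in> borel_measurable borel"
  unfolding wt_def by measurable

lemma cmod_wt: "cmod (wt \<eta> c t) = exp (- (\<eta> * \<bar>t - c\<bar>))"
  by (simp add: wt_def)

lemma sqint_wt_mult:
  assumes "0 < \<eta>" "sqint b"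
  shows "sqint (\<lambda>t. wt \<eta> c t * b t)" and "l2n (\<lambda>t. wt \<eta> c t * b t) \<le> l2n b"
proof -
  have [measurable]: "b \<in> borel_measurable borel" using assms by (auto simp: sqint_def)
  have "cmod (wt \<eta> c t * b t) \<le> 1 * cmod (b t)" for t
    using assms(1) by (simp add: norm_mult cmod_wt mult_left_le_one_le)
  from sqint_mono[OF assms(2) _ this]
  show "sqint (\<lambda>t. wt \<eta> c t * b t)" and "l2n (\<lambda>t. wt \<eta> c t * b t) \<le> l2n b" by auto
qed

definition comm_const :: "real \<Rightarrow> (real \<Rightarrow> complex) \<Rightarrow> real" where
  "comm_const \<eta> a = (LINT s|lborel. cmod (a s) * min 1 (exp (\<eta> * \<bar>s\<bar>) - 1))"

lemma comm_const_integrable: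
  assumes "integrable lborel a" "0 < \<eta>"
  shows "integrable lborel (\<lambda>s. cmod (a s) * min 1 (exp (\<eta> * \<bar>s\<bar>) - 1))"
proof -
  have [measurable]: "a \<in> borel_measurable borel" using assms borel_measurable_integrable by auto
  have "\<bar>min 1 (exp (\<eta> * \<bar>s\<bar>) - 1)\<bar> \<le> 1" for s using assms(2) by simp
  then show ?thesis
    by (intro Bochner_Integration.integrable_bound[OF integrable_norm[OF assms(1)]])
       (auto simp: abs_mult mult_left_le)
qed

lemma comm_const_tendsto:
  assumes "integrable lborel a"
  shows "(\<lambda>n. comm_const (1 / real (Suc n)) a) \<longlonglongrightarrow> 0"
proof -
  have [measurable]: "a \<in> borel_measurable borel" using assms borel_measurable_integrable by auto
  have "(\<lambda>n. comm_const (1 / real (Suc n)) a) \<longlonglongrightarrow> (LINT s|(lborel :: real measure). (0::real))"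
    unfolding comm_const_def
  proof (rule integral_dominated_convergence[where w="\<lambda>s. cmod (a s)" and f="\<lambda>s. 0" and M=lborel and s="\<lambda>n s. cmod (a s) * min 1 (exp (1 / real (Suc n) * \<bar>s\<bar>) - 1)"])
    show "integrable lborel (\<lambda>s. cmod (a s))" using assms by simp
    show "AE s in lborel. (\<lambda>n. cmod (a s) * min 1 (exp (1 / real (Suc n) * \<bar>s\<bar>) - 1)) \<longlonglongrightarrow> 0"
    proof (rule AE_I2)
      fix s
      have "(\<lambda>n. 1 / real (Suc n) * \<bar>s\<bar>) \<longlonglongrightarrow> 0 * \<bar>s\<bar>"
        by (intro tendsto_mult tendsto_const LIMSEQ_Suc lim_1_over_n)
      then have "(\<lambda>n. cmod (a s) * min 1 (exp (1 / real (Suc n) * \<bar>s\<bar>) - 1)) \<longlonglongrightarrow> cmod (a s) * min 1 (exp (0 * \<bar>s\<bar>) - 1)"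
        by (intro tendsto_mult[OF tendsto_const] tendsto_min[OF tendsto_const] tendsto_diff[OF _ tendsto_const] tendsto_exp)
      then show "(\<lambda>n. cmod (a s) * min 1 (exp (1 / real (Suc n) * \<bar>s\<bar>) - 1)) \<longlonglongrightarrow> 0" by simp
    qed
    fix n
    have "\<bar>min 1 (exp (1 / real (Suc n) * \<bar>s\<bar>) - 1)\<bar> \<le> 1" for s by simp
    then show "AE s in lborel. norm (cmod (a s) * min 1 (exp (1 / real (Suc n) * \<bar>s\<bar>) - 1)) \<le> cmod (a s)"
      by (intro AE_I2) (auto simp: abs_mult mult_left_le)
  qed auto
  then show ?thesis by simp
qed

text \<open>Since \<open>wt \<eta> (c - s) (t - s) = wt \<eta> c t\<close>, the second summand on the right is the weight at \<open>t\<close>; in this form both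
weights multiply the value of the convolved function at the same point \<open>t - s\<close>.\<close>

lemma wt_diff:
  assumes "0 < \<eta>"
  shows "cmod (wt \<eta> c (t - s) - wt \<eta> c t)
    \<le> min 1 (exp (\<eta> * \<bar>s\<bar>) - 1) * (cmod (wt \<eta> c (t - s)) + cmod (wt \<eta> (c - s) (t - s)))"
proof -
  define x where "x = exp (- (\<eta> * \<bar>t - s - c\<bar>))"
  define y where "y = exp (- (\<eta> * \<bar>t - c\<bar>))"
  define e where "e = exp (\<eta> * \<bar>s\<bar>)"
  have pos: "0 < x" "0 < y" by (auto simp: x_def y_def)
  have e: "1 \<le> e" using assms by (simp add: e_def)
  have tri: "\<eta> * \<bar>t - s - c\<bar> \<le> \<eta> * (\<bar>s\<bar> + \<bar>t - c\<bar>)" "\<eta> * \<bar>t - c\<bar> \<le> \<eta> * (\<bar>s\<bar> + \<bar>t - s - c\<bar>)"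
    using assms by (auto intro!: mult_left_mono)
  have "y \<le> e * x" "x \<le> e * y"
    using tri unfolding x_def y_def e_def by (auto simp: exp_add[symmetric] algebra_simps)
  then have "\<bar>x - y\<bar> \<le> (e - 1) * (x + y)"
  proof -
    have "0 \<le> (e - 1) * x" "0 \<le> (e - 1) * y" using pos e by simp_all
    then show ?thesis using \<open>y \<le> e * x\<close> \<open>x \<le> e * y\<close>
      unfolding distrib_left left_diff_distrib by (intro abs_leI) linarith+
  qed
  moreover have "\<bar>x - y\<bar> \<le> 1 * (x + y)" using pos by auto
  ultimately have "\<bar>x - y\<bar> \<le> min 1 (e - 1) * (x + y)"
    by (simp add: min_def)
  moreover have "cmod (wt \<eta> c (t - s) - wt \<eta> c t) = \<bar>x - y\<bar>"
    by (simp add: wt_def x_def y_def of_real_diff[symmetric] del: of_real_diff)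
  moreover have "cmod (wt \<eta> c (t - s)) = x" "cmod (wt \<eta> (c - s) (t - s)) = y"
    by (simp_all add: cmod_wt x_def y_def)
  ultimately show ?thesis by (simp add: e_def)
qed

text \<open>Moving the centre of the weight by \<open>s\<close> is the same as shifting the argument by \<open>s\<close>. This is why the right
hand side needs the weighted norms of \<open>b\<close> for all centres, and why the estimate is uniform in the centre.\<close>

lemma conv_commutator:
  assumes a: "integrable lborel a" "sqint a" and b: "sqint b" and \<eta>: "0 < \<eta>"
    and S: "\<And>c. l2n (\<lambda>t. wt \<eta> c t * b t) \<le> S"
  shows "sqint (\<lambda>t. conv a (\<lambda>s. wt \<eta> c s * b s) t - wt \<eta> c t * conv a b t)"
    and "l2n (\<lambda>t. conv a (\<lambda>s. wt \<eta> c s * b s) t - wt \<eta> c t * conv a b t) \<le> comm_const \<eta> a * (2 * S)"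
proof -
  have [measurable]: "a \<in> borel_measurable borel" "b \<in> borel_measurable borel"
    using assms by (auto simp: sqint_def)
  define F where "F = (\<lambda>t s. (cmod (wt \<eta> c (t - s)) + cmod (wt \<eta> (c - s) (t - s))) * cmod (b (t - s)))"
  have S0: "0 \<le> S" using S[of 0] l2n_nonneg order_trans by blast
  have [measurable]: "(\<lambda>x. F (fst x) (snd x)) \<in> borel_measurable (borel \<Otimes>\<^sub>M borel)"
    unfolding F_def wt_def by measurable
  have B: "(\<integral>\<^sup>+t. ennreal ((F t s)\<^sup>2) \<partial>lborel) \<le> ennreal ((2 * S)\<^sup>2)" for s
  proof -
    define h where "h = (\<lambda>t. wt \<eta> c t * b t + wt \<eta> (c - s) t * b t)"
    have h: "sqint h" unfolding h_def by (intro sqint_add sqint_wt_mult \<eta> b)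
    have "l2n h \<le> 2 * S"
      unfolding h_def using sqint_add(2)[OF sqint_wt_mult(1)[OF \<eta> b, of c] sqint_wt_mult(1)[OF \<eta> b, of "c - s"]]
        S[of c] S[of "c - s"] by linarith
    then have "(l2n h)\<^sup>2 \<le> (2 * S)\<^sup>2" by (intro power_mono) auto
    moreover have "(\<integral>\<^sup>+t. ennreal ((F t s)\<^sup>2) \<partial>lborel) = ennreal ((l2n h)\<^sup>2)"
    proof -
      have "F t s = cmod (h (t - s))" for t
      proof -
        have "h (t - s) = complex_of_real (cmod (wt \<eta> c (t - s)) + cmod (wt \<eta> (c - s) (t - s))) * b (t - s)"
          by (simp add: h_def cmod_wt) (simp add: wt_def algebra_simps)
        then have "cmod (h (t - s)) = \<bar>cmod (wt \<eta> c (t - s)) + cmod (wt \<eta> (c - s) (t - s))\<bar> * cmod (b (t - s))"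
          by (simp only: norm_mult norm_of_real)
        then show ?thesis by (simp add: F_def)
      qed
      then show ?thesis
        using sqint_shift[OF h, of 1 "-s"] by (auto dest: nn_integral_cmod_sq)
    qed
    ultimately show ?thesis by simp
  qed
  have X: "ennreal (cmod (conv a (\<lambda>s. wt \<eta> c s * b s) t - wt \<eta> c t * conv a b t))
     \<le> (\<integral>\<^sup>+s. ennreal ((cmod (a s) * min 1 (exp (\<eta> * \<bar>s\<bar>) - 1)) * F t s) \<partial>lborel)" for t
  proof -
    have i1: "integrable lborel (\<lambda>s. a s * (wt \<eta> c (t - s) * b (t - s)))"
      using conv_integrable[OF sqint_wt_mult(1)[OF \<eta> b] a(2), of c t] by (simp add: mult_ac)
    have i2: "integrable lborel (\<lambda>s. wt \<eta> c t * (a s * b (t - s)))"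
      using conv_integrable[OF b a(2), of t] by (intro integrable_mult_right) (simp add: mult.commute)
    have "conv a (\<lambda>s. wt \<eta> c s * b s) t - wt \<eta> c t * conv a b t =
        (LINT s|lborel. a s * (wt \<eta> c (t - s) * b (t - s)) - wt \<eta> c t * (a s * b (t - s)))"
      using i1 i2 by (simp add: conv_flip)
    also have "\<dots> = (LINT s|lborel. a s * (wt \<eta> c (t - s) - wt \<eta> c t) * b (t - s))"
      by (simp add: algebra_simps)
    finally have "ennreal (cmod (conv a (\<lambda>s. wt \<eta> c s * b s) t - wt \<eta> c t * conv a b t))
      \<le> (\<integral>\<^sup>+s. ennreal (cmod (a s * (wt \<eta> c (t - s) - wt \<eta> c t) * b (t - s))) \<partial>lborel)"
      using norm_integral_le_nn_integral by simp
    also have "\<dots> \<le> (\<integral>\<^sup>+s. ennreal ((cmod (a s) * min 1 (exp (\<eta> * \<bar>s\<bar>) - 1)) * F t s) \<partial>lborel)"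
    proof (intro nn_integral_mono ennreal_leI)
      fix s
      have "cmod (a s * (wt \<eta> c (t - s) - wt \<eta> c t) * b (t - s))
        = cmod (a s) * cmod (wt \<eta> c (t - s) - wt \<eta> c t) * cmod (b (t - s))" by (simp add: norm_mult)
      also have "\<dots> \<le> cmod (a s) * (min 1 (exp (\<eta> * \<bar>s\<bar>) - 1) * (cmod (wt \<eta> c (t - s)) + cmod (wt \<eta> (c - s) (t - s)))) * cmod (b (t - s))"
        by (intro mult_right_mono mult_left_mono wt_diff \<eta>) auto
      finally show "cmod (a s * (wt \<eta> c (t - s) - wt \<eta> c t) * b (t - s)) \<le> (cmod (a s) * min 1 (exp (\<eta> * \<bar>s\<bar>) - 1)) * F t s"
        by (simp add: F_def mult_ac)
    qed
    finally show ?thesis .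
  qed
  have nn: "0 \<le> F t s" for t s by (simp add: F_def)
  have nn2: "0 \<le> cmod (a s) * min 1 (exp (\<eta> * \<bar>s\<bar>) - 1)" for s using \<eta> by simp
  have nn3: "0 \<le> 2 * S" using S0 by simp
  have mX: "(\<lambda>t. conv a (\<lambda>s. wt \<eta> c s * b s) t - wt \<eta> c t * conv a b t) \<in> borel_measurable borel"
    by measurable
  note * = schur[OF mX comm_const_integrable[OF a(1) \<eta>] nn2 \<open>(\<lambda>x. F (fst x) (snd x)) \<in> _\<close> nn B nn3 X]
  from * show "sqint (\<lambda>t. conv a (\<lambda>s. wt \<eta> c s * b s) t - wt \<eta> c t * conv a b t)" by blast
  from * show "l2n (\<lambda>t. conv a (\<lambda>s. wt \<eta> c s * b s) t - wt \<eta> c t * conv a b t) \<le> comm_const \<eta> a * (2 * S)"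
    by (simp add: comm_const_def)
qed

text \<open>The part of \<open>a\<close> on \<open>|s| \<le> N\<close> meets \<open>b\<close> only within distance \<open>N\<close> of \<open>t\<close>, where the weight centred at
\<open>t\<close> is at least \<open>exp (- \<eta> N)\<close>. The rest of \<open>a\<close> has small \<open>L\<^sup>1\<close> norm and acts on the bound \<open>M\<close>.\<close>

lemma conv_local_bound:
  assumes a: "integrable lborel a" "sqint a" and b: "sqint b" and \<eta>: "0 < \<eta>"
    and M: "AE t in lborel. cmod (b t) \<le> M" "0 \<le> M"
  shows "cmod (conv a b t) \<le> l2n a * (exp (\<eta> * N) * l2n (\<lambda>s. wt \<eta> t s * b s))
    + (LINT s|lborel. indicator {s. N < \<bar>s\<bar>} s * cmod (a s)) * M"
proof -
  have [measurable]: "a \<in> borel_measurable borel" "b \<in> borel_measurable borel"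
    using assms by (auto simp: sqint_def)
  let ?I = "\<lambda>s. indicator {s. N < \<bar>s\<bar>} s :: real"
  define e where "e = (\<lambda>s. complex_of_real (exp (\<eta> * N)) * (wt \<eta> t (t - s) * b (t - s)))"
  have e: "sqint e" "l2n e = exp (\<eta> * N) * l2n (\<lambda>s. wt \<eta> t s * b s)"
    unfolding e_def using sqint_flip[OF sqint_wt_mult(1)[OF \<eta> b, of t], of t]
    by (auto intro!: sqint_cmult simp: l2n_cmult)
  have i1: "integrable lborel (\<lambda>s. cmod (a s) * cmod (e s))"
    by (rule sqint_prod_integrable(1)[OF a(2) e(1)])
  have i2: "integrable lborel (\<lambda>s. (?I s * cmod (a s)) * M)"
    by (intro integrable_mult_left Bochner_Integration.integrable_bound[OF integrable_norm[OF a(1)]])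
       (auto simp: indicator_def)
  have i3: "integrable lborel (\<lambda>s. a s * b (t - s))"
    using conv_integrable[OF b a(2), of t] by (simp add: mult.commute)
  have M': "AE s in lborel. cmod (b (t - s)) \<le> M"
    using AE_borel_affine[of "-1" "\<lambda>s. cmod (b s) \<le> M" t] M(1) by simp
  have "cmod (conv a b t) \<le> (LINT s|lborel. cmod (a s * b (t - s)))"
    unfolding conv_flip by (rule integral_norm_bound)
  also have "\<dots> \<le> (LINT s|lborel. cmod (a s) * cmod (e s) + (?I s * cmod (a s)) * M)"
  proof (rule integral_mono_AE)
    show "AE s in lborel. cmod (a s * b (t - s)) \<le> cmod (a s) * cmod (e s) + (?I s * cmod (a s)) * M"
      using M'
    proof eventually_elim
      case (elim s)
      show ?case
      proof (cases "N < \<bar>s\<bar>")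
        case True
        have "cmod (a s) * cmod (b (t - s)) \<le> cmod (a s) * M" using elim by (intro mult_left_mono) auto
        then show ?thesis using True by (simp add: norm_mult add_increasing)
      next
        case False
        have "1 * cmod (b (t - s)) \<le> exp (\<eta> * N - \<eta> * \<bar>s\<bar>) * cmod (b (t - s))"
          using False \<eta> by (intro mult_right_mono) auto
        then have "cmod (b (t - s)) \<le> cmod (e s)"
          by (simp add: e_def norm_mult cmod_wt exp_diff exp_minus field_simps)
        then have "cmod (a s) * cmod (b (t - s)) \<le> cmod (a s) * cmod (e s)" by (intro mult_left_mono) auto
        then show ?thesis using False by (simp add: norm_mult)
      qed
    qed
  qed (use i1 i2 i3 in auto)
  also have "\<dots> = (LINT s|lborel. cmod (a s) * cmod (e s)) + (LINT s|lborel. ?I s * cmod (a s)) * M"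
    by (subst Bochner_Integration.integral_add[OF i1 i2]) simp
  also have "(LINT s|lborel. cmod (a s) * cmod (e s)) \<le> l2n a * l2n e"
    by (rule l2_cauchy_schwarz[OF a(2) e(1)])
  finally show ?thesis by (simp add: e(2))
qed

lemma tail_tendsto:
  assumes "integrable lborel (a :: real \<Rightarrow> complex)"
  shows "(\<lambda>N. LINT s|lborel. indicator {s. real N < \<bar>s\<bar>} s * cmod (a s)) \<longlonglongrightarrow> 0"
proof -
  have [measurable]: "a \<in> borel_measurable borel" using assms borel_measurable_integrable by auto
  have "(\<lambda>N. LINT s|lborel. indicator {s. real N < \<bar>s\<bar>} s * cmod (a s)) \<longlonglongrightarrow> (LINT s|(lborel :: real measure). (0::real))"
  proof (rule integral_dominated_convergence[where w="\<lambda>s. cmod (a s)" and f="\<lambda>s. 0" and M=lborel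
        and s="\<lambda>N s. indicator {s. real N < \<bar>s\<bar>} s * cmod (a s)"])
    show "AE s in lborel. (\<lambda>N. indicator {s. real N < \<bar>s\<bar>} s * cmod (a s)) \<longlonglongrightarrow> 0"
    proof (rule AE_I2, rule tendsto_eventually)
      fix s
      obtain N0 where "\<bar>s\<bar> \<le> real N0" using real_arch_simple by blast
      then show "\<forall>\<^sub>F N in sequentially. indicator {s. real N < \<bar>s\<bar>} s * cmod (a s) = 0"
        by (intro eventually_sequentiallyI[of N0]) (auto simp: indicator_def)
    qed
  qed (use assms in \<open>auto simp: indicator_def\<close>)
  then show ?thesis by simp
qed

subsection \<open>Adjoints and products\<close>

lemma conv_adjoint:
  assumes a: "integrable lborel a" "sqint a" and b: "sqint b" and c: "sqint c"
  shows "(LINT t|lborel. conv a b t * cnj (c t)) = (LINT s|lborel. b s * cnj (conv (reflect a) c s))"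
proof -
  have [measurable]: "a \<in> borel_measurable borel" "b \<in> borel_measurable borel" "c \<in> borel_measurable borel"
    using assms by (auto simp: sqint_def)
  define A where "A = (\<lambda>t. complex_of_real (cmod (a t)))"
  define B where "B = (\<lambda>t. complex_of_real (cmod (b t)))"
  have A: "integrable lborel A" "sqint A" using a unfolding A_def by (auto simp: sqint_def)
  have B: "sqint B" using b unfolding B_def by (auto simp: sqint_def)
  have K: "integrable lborel (\<lambda>t. conv A B t * c t)"
    by (intro sqint_prod_integrable young A B c)
  have eqK: "(LINT s|lborel. norm (a (t - s) * b s * cnj (c t))) = cmod (conv A B t * c t)" for t
  proof -
    have "conv A B t = complex_of_real (LINT s|lborel. cmod (a (t - s)) * cmod (b s))"
      unfolding conv_def A_def B_def by (simp add: integral_complex_of_real[symmetric])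
    then have "cmod (conv A B t * c t) = \<bar>LINT s|lborel. cmod (a (t - s)) * cmod (b s)\<bar> * cmod (c t)"
      by (simp only: norm_mult norm_of_real)
    also have "\<bar>LINT s|lborel. cmod (a (t - s)) * cmod (b s)\<bar> = (LINT s|lborel. cmod (a (t - s)) * cmod (b s))"
      by (intro abs_of_nonneg Bochner_Integration.integral_nonneg) simp
    finally have E: "cmod (conv A B t * c t) = (LINT s|lborel. cmod (a (t - s)) * cmod (b s)) * cmod (c t)" .
    show ?thesis unfolding E by (simp add: norm_mult)
  qed
  have int: "integrable (lborel \<Otimes>\<^sub>M lborel) (\<lambda>(t, s). a (t - s) * b s * cnj (c t))"
  proof (rule lborel_pair.Fubini_integrable)
    show "AE t in lborel. integrable lborel (\<lambda>s. case (t, s) of (t, s) \<Rightarrow> a (t - s) * b s * cnj (c t))"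
      using conv_integrable[OF a(2) b] by auto
    show "integrable lborel (\<lambda>t. LINT s|lborel. norm (case (t, s) of (t, s) \<Rightarrow> a (t - s) * b s * cnj (c t)))"
      using integrable_norm[OF K] by (simp add: eqK)
  qed measurable
  have "(LINT t|lborel. conv a b t * cnj (c t)) = (LINT t|lborel. LINT s|lborel. a (t - s) * b s * cnj (c t))"
    by (simp add: conv_def)
  also have "\<dots> = (LINT s|lborel. LINT t|lborel. a (t - s) * b s * cnj (c t))"
    by (rule lborel_pair.Fubini_integral[symmetric]) (use int in \<open>simp add: case_prod_beta'\<close>)
  also have "\<dots> = (LINT s|lborel. b s * cnj (conv (reflect a) c s))"
  proof (rule Bochner_Integration.integral_cong[OF refl])
    fix s
    have "(LINT t|lborel. a (t - s) * b s * cnj (c t)) = (LINT t|lborel. b s * (a (t - s) * cnj (c t)))"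
      by (simp add: mult_ac)
    also have "\<dots> = b s * (LINT t|lborel. cnj (cnj (a (t - s)) * c t))" by simp
    also have "\<dots> = b s * cnj (LINT t|lborel. cnj (a (t - s)) * c t)"
      by (simp only: Bochner_Integration.integral_cnj)
    finally show "(LINT t|lborel. a (t - s) * b s * cnj (c t)) = b s * cnj (conv (reflect a) c s)"
      by (simp add: conv_def reflect_def)
  qed
  finally show ?thesis .
qed

lemma conv_L1:
  assumes a: "integrable lborel a" and b: "integrable lborel b"
  shows "integrable lborel (conv a b)"
    and "(LINT t|lborel. conv a b t) = (LINT t|lborel. a t) * (LINT t|lborel. b t)"
proof -
  have [measurable]: "a \<in> borel_measurable borel" "b \<in> borel_measurable borel"
    using assms borel_measurable_integrable by auto
  have sh: "integrable lborel (\<lambda>t. a (t - s))" "(LINT t|lborel. a (t - s)) = (LINT t|lborel. a t)"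
     "(LINT t|lborel. cmod (a (t - s))) = l1n a" for s
    using lborel_integrable_real_affine[OF a, of 1 "-s"] lborel_integral_real_affine[of 1 a "-s"]
      lborel_integral_real_affine[of 1 "\<lambda>t. cmod (a t)" "-s"] by (simp_all add: l1n_def)
  have int: "integrable (lborel \<Otimes>\<^sub>M lborel) (\<lambda>(s, t). a (t - s) * b s)"
  proof (rule lborel_pair.Fubini_integrable)
    show "AE s in lborel. integrable lborel (\<lambda>t. case (s, t) of (s, t) \<Rightarrow> a (t - s) * b s)"
      using sh(1) by auto
    show "integrable lborel (\<lambda>s. LINT t|lborel. norm (case (s, t) of (s, t) \<Rightarrow> a (t - s) * b s))"
      using b by (simp add: norm_mult sh(3))
  qed measurable
  have "integrable lborel (\<lambda>t. LINT s|lborel. a (t - s) * b s)"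
    using lborel_pair.integrable_snd[OF int] by simp
  then show "integrable lborel (conv a b)" by (simp add: conv_def[abs_def])
  have "(LINT t|lborel. conv a b t) = (LINT s|lborel. LINT t|lborel. a (t - s) * b s)"
    unfolding conv_def by (rule lborel_pair.Fubini_integral) (use int in \<open>simp add: case_prod_beta'\<close>)
  also have "\<dots> = (LINT s|lborel. (LINT t|lborel. a t) * b s)" by (simp add: sh(2))
  finally show "(LINT t|lborel. conv a b t) = (LINT t|lborel. a t) * (LINT t|lborel. b t)" by simp
qed

definition lap :: "complex \<Rightarrow> (real \<Rightarrow> complex) \<Rightarrow> complex" where
  "lap z f = (LINT t|lborel. exp (- (z * complex_of_real t)) * f t)"

lemma lap_integrable:
  assumes f: "integrable lborel f" "\<And>t. t < 0 \<Longrightarrow> f t = 0" and z: "0 \<le> Re z"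
  shows "integrable lborel (\<lambda>t. exp (- (z * complex_of_real t)) * f t)"
proof (rule Bochner_Integration.integrable_bound[OF f(1)])
  have [measurable]: "f \<in> borel_measurable borel" using f borel_measurable_integrable by auto
  show "(\<lambda>t. exp (- (z * complex_of_real t)) * f t) \<in> borel_measurable lborel" by measurable
  show "AE t in lborel. norm (exp (- (z * complex_of_real t)) * f t) \<le> norm (f t)"
  proof (rule AE_I2)
    fix t
    show "norm (exp (- (z * complex_of_real t)) * f t) \<le> norm (f t)"
      using f(2)[of t] z by (cases "t < 0") (auto simp: norm_mult norm_exp_eq_Re intro!: mult_left_le_one_le)
  qed
qed

lemma lap_conv:
  assumes a: "integrable lborel a" "\<And>t. t < 0 \<Longrightarrow> a t = 0"
    and b: "integrable lborel b" "\<And>t. t < 0 \<Longrightarrow> b t = 0" and z: "0 \<le> Re z"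
  shows "lap z (conv a b) = lap z a * lap z b"
proof -
  let ?e = "\<lambda>f t. exp (- (z * complex_of_real t)) * f t"
  have "exp (- (z * complex_of_real t)) * conv a b t = conv (?e a) (?e b) t" for t
  proof -
    have "exp (- (z * complex_of_real t)) * (a (t - s) * b s) = ?e a (t - s) * ?e b s" for s
    proof -
      have "exp (- (z * complex_of_real t)) = exp (- (z * complex_of_real (t - s))) * exp (- (z * complex_of_real s))"
        by (simp add: exp_add[symmetric] algebra_simps)
      then show ?thesis by (simp add: mult_ac)
    qed
    then show ?thesis unfolding conv_def integral_mult_right_zero[symmetric]
      by (rule Bochner_Integration.integral_cong[OF refl])
  qed
  then have "lap z (conv a b) = (LINT t|lborel. conv (?e a) (?e b) t)" by (simp add: lap_def)
  also have "\<dots> = lap z a * lap z b"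
    unfolding lap_def by (intro conv_L1(2) lap_integrable assms)
  finally show ?thesis .
qed

lemma conv_causal:
  assumes "\<And>t. t < 0 \<Longrightarrow> a t = 0" "\<And>t. t < 0 \<Longrightarrow> b t = 0" "t < 0"
  shows "conv a b t = 0"
proof -
  have "(\<lambda>s. a (t - s) * b s) = (\<lambda>s. 0)" using assms by (intro ext, rename_tac s, case_tac "s < 0") auto
  then show ?thesis by (simp add: conv_def)
qed

section \<open>The Wiener--Hopf operator and its adjoint in components\<close>

definition hl2 :: "(real \<Rightarrow> complex) \<Rightarrow> bool" where
  "hl2 f \<longleftrightarrow> sqint f \<and> (\<forall>t<0. f t = 0)"

definition vhl2 :: "nat \<Rightarrow> (nat \<Rightarrow> real \<Rightarrow> complex) \<Rightarrow> bool" where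
  "vhl2 n h \<longleftrightarrow> (\<forall>i<n. hl2 (h i))"

text \<open>A sum of norms instead of a Euclidean norm: it is equivalent, and estimates can be made entry by entry.\<close>

definition vnorm :: "nat \<Rightarrow> (nat \<Rightarrow> real \<Rightarrow> complex) \<Rightarrow> real" where
  "vnorm n h = (\<Sum>i<n. l2n (h i))"

definition ip :: "(real \<Rightarrow> complex) \<Rightarrow> (real \<Rightarrow> complex) \<Rightarrow> complex" where
  "ip f h = (LINT t|lborel. f t * cnj (h t))"

lemma hl2_sqint: "hl2 f \<Longrightarrow> sqint f" and hl2_neg: "hl2 f \<Longrightarrow> t < 0 \<Longrightarrow> f t = 0"
  by (auto simp: hl2_def)

lemma hl2_measurable: "hl2 f \<Longrightarrow> f \<in> borel_measurable borel"
  by (simp add: hl2_def sqint_def)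

lemma vhl2D: "vhl2 n h \<Longrightarrow> i < n \<Longrightarrow> hl2 (h i)" "vhl2 n h \<Longrightarrow> i < n \<Longrightarrow> sqint (h i)"
  by (auto simp: vhl2_def hl2_def)

lemma hl2_add: "hl2 f \<Longrightarrow> hl2 h \<Longrightarrow> hl2 (\<lambda>t. f t + h t)"
  and hl2_diff: "hl2 f \<Longrightarrow> hl2 h \<Longrightarrow> hl2 (\<lambda>t. f t - h t)"
  and hl2_cmult: "hl2 f \<Longrightarrow> hl2 (\<lambda>t. c * f t)"
  by (auto simp: hl2_def intro: sqint_add sqint_diff sqint_cmult)

lemma hl2_sum: "(\<And>i. i \<in> I \<Longrightarrow> hl2 (f i)) \<Longrightarrow> hl2 (\<lambda>t. \<Sum>i\<in>I. f i t)"
  by (auto simp: hl2_def intro!: sqint_sum(1) sum.neutral)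

lemma vhl2_diff: "vhl2 n f \<Longrightarrow> vhl2 n h \<Longrightarrow> vhl2 n (\<lambda>i t. f i t - h i t)"
  and vhl2_cmult: "vhl2 n f \<Longrightarrow> vhl2 n (\<lambda>i t. c * f i t)"
  by (auto simp: vhl2_def intro: hl2_diff hl2_cmult)

lemma vnorm_nonneg [simp]: "0 \<le> vnorm n h"
  by (simp add: vnorm_def sum_nonneg)

lemma l2n_le_vnorm: "i < n \<Longrightarrow> l2n (h i) \<le> vnorm n h"
  unfolding vnorm_def by (intro member_le_sum) auto

lemma vnorm_sq_le: "(vnorm n h)\<^sup>2 \<le> real n * (\<Sum>i<n. (l2n (h i))\<^sup>2)"
  unfolding vnorm_def using sum_squared_le_sum_of_squares[of "\<lambda>i. l2n (h i)" "{..<n}"] by (simp add: mult.commute)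

lemma sq_le_vnorm: "(\<Sum>i<n. (l2n (h i))\<^sup>2) \<le> (vnorm n h)\<^sup>2"
proof -
  have "(\<Sum>i<n. (l2n (h i))\<^sup>2) \<le> (\<Sum>i<n. l2n (h i) * vnorm n h)"
    unfolding power2_eq_square by (intro sum_mono mult_left_mono l2n_le_vnorm) auto
  also have "\<dots> = (vnorm n h)\<^sup>2" by (simp add: vnorm_def sum_distrib_right power2_eq_square)
  finally show ?thesis .
qed

lemma vnorm_add: "vhl2 n f \<Longrightarrow> vhl2 n h \<Longrightarrow> vnorm n (\<lambda>i t. f i t + h i t) \<le> vnorm n f + vnorm n h"
  unfolding vnorm_def sum.distrib[symmetric] by (intro sum_mono sqint_add vhl2D(2)) simp_all

lemma ip_integrable: "sqint f \<Longrightarrow> sqint h \<Longrightarrow> integrable lborel (\<lambda>t. f t * cnj (h t))"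
  by (intro sqint_prod_integrable sqint_cnj)

lemma ip_bound: "sqint f \<Longrightarrow> sqint h \<Longrightarrow> cmod (ip f h) \<le> l2n f * l2n h"
  unfolding ip_def using l2_inner_bound[of f "\<lambda>t. cnj (h t)"] sqint_cnj[of h] by (simp add: l2n_cnj)

lemma ip_self: "ip f f = complex_of_real ((l2n f)\<^sup>2)"
proof -
  have "(\<lambda>t. f t * cnj (f t)) = (\<lambda>t. complex_of_real ((cmod (f t))\<^sup>2))"
    by (rule ext) (rule complex_norm_square[symmetric])
  then show ?thesis unfolding ip_def l2n_sq by (simp only: integral_complex_of_real)
qed

lemma ip_cnj: "cnj (ip f h) = ip h f"
  unfolding ip_def Bochner_Integration.integral_cnj[symmetric] complex_cnj_mult complex_cnj_cnj
  by (rule Bochner_Integration.integral_cong[OF refl], rule mult.commute)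

lemma ip_sum_left: "(\<And>i. i \<in> I \<Longrightarrow> sqint (f i)) \<Longrightarrow> sqint h \<Longrightarrow> ip (\<lambda>t. \<Sum>i\<in>I. f i t) h = (\<Sum>i\<in>I. ip (f i) h)"
  unfolding ip_def sum_distrib_right by (intro Bochner_Integration.integral_sum ip_integrable)

lemma ip_cong_AE:
  assumes "f \<in> borel_measurable borel" "f' \<in> borel_measurable borel" "h \<in> borel_measurable borel"
    "AE t in lborel. f t = f' t"
  shows "ip f h = ip f' h" "ip h f = ip h f'"
proof -
  have [measurable]: "f \<in> borel_measurable borel" "f' \<in> borel_measurable borel" "h \<in> borel_measurable borel" by fact+
  show "ip f h = ip f' h" "ip h f = ip h f'"
    unfolding ip_def by (intro integral_cong_AE; use assms(4) in auto)+
qed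

lemma l2n_diff_scaled:
  assumes "sqint f" "sqint h"
  shows "(l2n (\<lambda>t. f t - complex_of_real k * h t))\<^sup>2 = (l2n f)\<^sup>2 - 2 * k * Re (ip h f) + k\<^sup>2 * (l2n h)\<^sup>2"
proof -
  have i: "integrable lborel (\<lambda>t. h t * cnj (f t))" by (rule ip_integrable[OF assms(2,1)])
  have i1: "integrable lborel (\<lambda>t. (cmod (f t))\<^sup>2)" "integrable lborel (\<lambda>t. (cmod (h t))\<^sup>2)"
    using assms by (auto simp: sqint_def)
  have "(cmod (f t - complex_of_real k * h t))\<^sup>2 = (cmod (f t))\<^sup>2 - 2 * k * Re (h t * cnj (f t)) + k\<^sup>2 * (cmod (h t))\<^sup>2" for t
    unfolding cmod_power2 by (simp add: power2_eq_square algebra_simps)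
  then have "(l2n (\<lambda>t. f t - complex_of_real k * h t))\<^sup>2
     = (LINT t|lborel. (cmod (f t))\<^sup>2 - 2 * k * Re (h t * cnj (f t)) + k\<^sup>2 * (cmod (h t))\<^sup>2)"
    by (simp add: l2n_sq)
  also have "\<dots> = (l2n f)\<^sup>2 - 2 * k * Re (ip h f) + k\<^sup>2 * (l2n h)\<^sup>2"
  proof -
    define R where "R = (\<lambda>t. Re (h t * cnj (f t)))"
    have R: "integrable lborel R" "(LINT t|lborel. R t) = Re (ip h f)"
      unfolding R_def ip_def using i by (auto simp del: times_complex.sel complex_cnj)
    have "(\<lambda>t. (cmod (f t))\<^sup>2 - 2 * k * Re (h t * cnj (f t)) + k\<^sup>2 * (cmod (h t))\<^sup>2)
       = (\<lambda>t. (cmod (f t))\<^sup>2 - 2 * k * R t + k\<^sup>2 * (cmod (h t))\<^sup>2)" unfolding R_def ..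
    then show ?thesis using i1 R(1) unfolding l2n_sq R(2)[symmetric] by simp
  qed
  finally show ?thesis .
qed

text \<open>The entries \<open>g i j\<close> are defined for all indices, with zero outside the format of the matrix, so that the assumptions
on them need no index range.\<close>

locale wh_symbol =
  fixes m p :: nat and D :: "nat \<Rightarrow> nat \<Rightarrow> complex" and g :: "nat \<Rightarrow> nat \<Rightarrow> real \<Rightarrow> complex"
  assumes g_sqint: "sqint (g i j)" and g_int: "integrable lborel (g i j)" and g_neg: "t < 0 \<Longrightarrow> g i j t = 0"
begin

text \<open>\<open>WH\<close> is the Wiener--Hopf operator. The integral over the half line is a convolution over the line because
both functions vanish on the negative half line; for the adjoint \<open>WHadj\<close> the kernel is anticausal, and the result
has to be cut off.\<close>

definition WH :: "(nat \<Rightarrow> real \<Rightarrow> complex) \<Rightarrow> nat \<Rightarrow> real \<Rightarrow> complex" where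
  "WH v i t = (\<Sum>j<p. D i j * v j t + conv (g i j) (v j) t)"

definition WHadj :: "(nat \<Rightarrow> real \<Rightarrow> complex) \<Rightarrow> nat \<Rightarrow> real \<Rightarrow> complex" where
  "WHadj u j t = (if t < 0 then 0 else \<Sum>i<m. cnj (D i j) * u i t + conv (reflect (g i j)) (u i) t)"

definition WH_const where "WH_const = (\<Sum>i<m. \<Sum>j<p. cmod (D i j) + l1n (g i j))"

lemma rg_sqint: "sqint (reflect (g i j))" and rg_int: "integrable lborel (reflect (g i j))"
  and rg_l1n: "l1n (reflect (g i j)) = l1n (g i j)" and rg_l2n: "l2n (reflect (g i j)) = l2n (g i j)"
  using sqint_reflect[OF g_sqint] integrable_reflect[OF g_int] l2n_reflect[OF g_sqint] by auto

lemma WH_const_nonneg: "0 \<le> WH_const"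
  unfolding WH_const_def by (intro sum_nonneg add_nonneg_nonneg) auto

lemma WH_hl2: assumes "vhl2 p v" shows "hl2 (WH v i)"
proof -
  have "hl2 (\<lambda>t. D i j * v j t + conv (g i j) (v j) t)" if "j < p" for j
    using vhl2D[OF assms that]
    by (intro hl2_add hl2_cmult) (auto simp: hl2_def intro!: young g_int conv_causal g_neg)
  then show ?thesis unfolding WH_def[abs_def] by (intro hl2_sum) auto
qed

lemma WHadj_summand: 
  assumes "vhl2 m u" "i < m"
  shows "sqint (\<lambda>t. cnj (D i j) * u i t + conv (reflect (g i j)) (u i) t)"
    and "l2n (\<lambda>t. cnj (D i j) * u i t + conv (reflect (g i j)) (u i) t) \<le> (cmod (D i j) + l1n (g i j)) * l2n (u i)"
proof -
  have s: "sqint (\<lambda>t. cnj (D i j) * u i t)" "sqint (conv (reflect (g i j)) (u i))"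
    using vhl2D[OF assms] by (intro sqint_cmult young rg_int; simp)+
  show "sqint (\<lambda>t. cnj (D i j) * u i t + conv (reflect (g i j)) (u i) t)" by (rule sqint_add(1)[OF s])
  have "l2n (\<lambda>t. cnj (D i j) * u i t) + l2n (conv (reflect (g i j)) (u i)) \<le> cmod (D i j) * l2n (u i) + l1n (g i j) * l2n (u i)"
    using young(2)[OF rg_int, of "u i" i j] vhl2D[OF assms] by (simp add: l2n_cmult rg_l1n)
  then show "l2n (\<lambda>t. cnj (D i j) * u i t + conv (reflect (g i j)) (u i) t) \<le> (cmod (D i j) + l1n (g i j)) * l2n (u i)"
    using sqint_add(2)[OF s] by (simp add: algebra_simps)
qed

lemma WHadj_eq: "WHadj u j t = indicator {0..} t * (\<Sum>i<m. cnj (D i j) * u i t + conv (reflect (g i j)) (u i) t)"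
  by (auto simp: WHadj_def indicator_def)

lemma WHadj_bound_sum:
  assumes "vhl2 m u"
  shows "hl2 (WHadj u j)"
    and "l2n (WHadj u j) \<le> l2n (\<lambda>t. \<Sum>i<m. cnj (D i j) * u i t + conv (reflect (g i j)) (u i) t)"
proof -
  let ?h = "\<lambda>t. \<Sum>i<m. cnj (D i j) * u i t + conv (reflect (g i j)) (u i) t"
  have h: "sqint ?h" by (intro sqint_sum WHadj_summand assms) auto
  have [measurable]: "?h \<in> borel_measurable borel" using h by (simp add: sqint_def)
  have mTS: "WHadj u j \<in> borel_measurable borel" unfolding WHadj_eq[abs_def] by measurable
  have le: "cmod (WHadj u j t) \<le> 1 * cmod (?h t)" for t by (simp add: WHadj_def)
  have "sqint (WHadj u j)" by (rule sqint_mono(1)[OF h mTS le]) simp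
  then show "hl2 (WHadj u j)" by (simp add: hl2_def WHadj_def)
  have "l2n (WHadj u j) \<le> 1 * l2n ?h" by (rule sqint_mono(2)[OF h mTS le]) simp
  then show "l2n (WHadj u j) \<le> l2n ?h" by (simp only: mult_1)
qed

lemmas WHadj_hl2 = WHadj_bound_sum(1)

lemma WHadj_vhl2: "vhl2 m u \<Longrightarrow> vhl2 n (WHadj u)" and WH_vhl2: "vhl2 p v \<Longrightarrow> vhl2 n (WH v)"
  by (auto simp: vhl2_def[of n] WHadj_hl2 WH_hl2)

lemma WH_bound: assumes "vhl2 p v" shows "vnorm m (WH v) \<le> WH_const * vnorm p v"
proof -
  have "l2n (WH v i) \<le> (\<Sum>j<p. (cmod (D i j) + l1n (g i j)) * vnorm p v)" for i
  proof -
    have 1: "sqint (\<lambda>t. D i j * v j t + conv (g i j) (v j) t)"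
        "l2n (\<lambda>t. D i j * v j t + conv (g i j) (v j) t) \<le> (cmod (D i j) + l1n (g i j)) * vnorm p v" if "j < p" for j
    proof -
      have s: "sqint (\<lambda>t. D i j * v j t)" "sqint (conv (g i j) (v j))"
        using vhl2D[OF assms that] by (intro sqint_cmult young g_int; simp)+
      show "sqint (\<lambda>t. D i j * v j t + conv (g i j) (v j) t)" by (rule sqint_add(1)[OF s])
      have "l2n (\<lambda>t. D i j * v j t) + l2n (conv (g i j) (v j)) \<le> cmod (D i j) * l2n (v j) + l1n (g i j) * l2n (v j)"
        using young(2)[OF g_int, of "v j" i j] vhl2D[OF assms that] by (simp add: l2n_cmult)
      also have "\<dots> \<le> (cmod (D i j) + l1n (g i j)) * vnorm p v"
        unfolding distrib_right[symmetric] by (intro mult_left_mono l2n_le_vnorm that) auto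
      finally show "l2n (\<lambda>t. D i j * v j t + conv (g i j) (v j) t) \<le> (cmod (D i j) + l1n (g i j)) * vnorm p v"
        using sqint_add(2)[OF s] by linarith
    qed
    have "l2n (WH v i) \<le> (\<Sum>j<p. l2n (\<lambda>t. D i j * v j t + conv (g i j) (v j) t))"
      unfolding WH_def[abs_def] by (intro sqint_sum) (auto intro: 1)
    also have "\<dots> \<le> (\<Sum>j<p. (cmod (D i j) + l1n (g i j)) * vnorm p v)" by (intro sum_mono 1) auto
    finally show ?thesis .
  qed
  then have "vnorm m (WH v) \<le> (\<Sum>i<m. \<Sum>j<p. (cmod (D i j) + l1n (g i j)) * vnorm p v)"
    unfolding vnorm_def[of m] by (intro sum_mono)
  then show ?thesis by (simp only: WH_const_def sum_distrib_right)
qed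

lemma WHadj_bound: assumes "vhl2 m u" shows "vnorm p (WHadj u) \<le> WH_const * vnorm m u"
proof -
  have "l2n (WHadj u j) \<le> (\<Sum>i<m. (cmod (D i j) + l1n (g i j)) * vnorm m u)" for j
  proof -
    note WHadj_bound_sum(2)[OF assms, of j]
    also have "l2n (\<lambda>t. \<Sum>i<m. cnj (D i j) * u i t + conv (reflect (g i j)) (u i) t)
       \<le> (\<Sum>i<m. l2n (\<lambda>t. cnj (D i j) * u i t + conv (reflect (g i j)) (u i) t))"
      by (intro sqint_sum WHadj_summand assms) auto
    also have "\<dots> \<le> (\<Sum>i<m. (cmod (D i j) + l1n (g i j)) * l2n (u i))"
      by (intro sum_mono WHadj_summand assms) auto
    also have "\<dots> \<le> (\<Sum>i<m. (cmod (D i j) + l1n (g i j)) * vnorm m u)"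
      by (intro sum_mono mult_left_mono l2n_le_vnorm) auto
    finally show ?thesis .
  qed
  then have "vnorm p (WHadj u) \<le> (\<Sum>j<p. \<Sum>i<m. (cmod (D i j) + l1n (g i j)) * vnorm m u)"
    unfolding vnorm_def[of p] by (intro sum_mono)
  also have "\<dots> = WH_const * vnorm m u" unfolding WH_const_def sum_distrib_right by (rule sum.swap)
  finally show ?thesis .
qed

lemma WH_add: "vhl2 p v \<Longrightarrow> vhl2 p w \<Longrightarrow> WH (\<lambda>j t. v j t + w j t) i t = WH v i t + WH w i t"
  unfolding WH_def sum.distrib[symmetric]
  by (intro sum.cong refl) (simp add: conv_add_right[OF g_sqint vhl2D(2) vhl2D(2)] algebra_simps)

lemma WH_diff: "vhl2 p v \<Longrightarrow> vhl2 p w \<Longrightarrow> WH (\<lambda>j t. v j t - w j t) i t = WH v i t - WH w i t"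
  unfolding WH_def sum_subtractf[symmetric]
  by (intro sum.cong refl) (simp add: conv_diff_right[OF g_sqint vhl2D(2) vhl2D(2)] algebra_simps)

lemma WH_cmult: "WH (\<lambda>j t. c * v j t) i t = c * WH v i t"
  unfolding WH_def sum_distrib_left by (intro sum.cong refl) (auto simp: conv_cmult_right algebra_simps)

lemma WHadj_add: "vhl2 m v \<Longrightarrow> vhl2 m w \<Longrightarrow> WHadj (\<lambda>j t. v j t + w j t) i t = WHadj v i t + WHadj w i t"
  unfolding WHadj_eq distrib_left[symmetric] sum.distrib[symmetric]
  by (intro arg_cong2[where f="(*)"] sum.cong refl) (simp add: conv_add_right[OF rg_sqint vhl2D(2) vhl2D(2)] algebra_simps)

lemma WHadj_diff: "vhl2 m v \<Longrightarrow> vhl2 m w \<Longrightarrow> WHadj (\<lambda>j t. v j t - w j t) i t = WHadj v i t - WHadj w i t"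
  unfolding WHadj_eq right_diff_distrib[symmetric] sum_subtractf[symmetric]
  by (intro arg_cong2[where f="(*)"] sum.cong refl) (simp add: conv_diff_right[OF rg_sqint vhl2D(2) vhl2D(2)] algebra_simps)

lemma WHadj_cmult: "WHadj (\<lambda>j t. c * v j t) i t = c * WHadj v i t"
  unfolding WHadj_eq mult.left_commute[of c] sum_distrib_left[of c]
  by (intro arg_cong2[where f="(*)"] sum.cong refl) (auto simp: conv_cmult_right algebra_simps)

lemma adjoint:
  assumes v: "vhl2 p v" and u: "vhl2 m u"
  shows "(\<Sum>i<m. ip (WH v i) (u i)) = (\<Sum>j<p. ip (v j) (WHadj u j))"
proof -
  have "ip (WH v i) (u i) = (\<Sum>j<p. D i j * ip (v j) (u i) + ip (conv (g i j) (v j)) (u i))" if "i < m" for i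
  proof -
    have "ip (WH v i) (u i) = (\<Sum>j<p. ip (\<lambda>t. D i j * v j t + conv (g i j) (v j) t) (u i))"
      unfolding WH_def[abs_def] using v u that
      by (intro ip_sum_left sqint_add sqint_cmult young g_int) (auto dest: vhl2D)
    also have "\<dots> = (\<Sum>j<p. D i j * ip (v j) (u i) + ip (conv (g i j) (v j)) (u i))"
    proof (intro sum.cong refl)
      fix j assume "j \<in> {..<p}"
      then have "sqint (v j)" "sqint (u i)" "sqint (conv (g i j) (v j))"
        using v u that by (auto intro!: young g_int dest: vhl2D)
      then show "ip (\<lambda>t. D i j * v j t + conv (g i j) (v j) t) (u i) = D i j * ip (v j) (u i) + ip (conv (g i j) (v j)) (u i)"
        using ip_integrable unfolding ip_def by (simp add: distrib_right mult.assoc)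
    qed
    finally show ?thesis .
  qed
  moreover have "ip (v j) (WHadj u j) = (\<Sum>i<m. D i j * ip (v j) (u i) + ip (conv (g i j) (v j)) (u i))" if "j < p" for j
  proof -
    have vj: "sqint (v j)" "\<And>t. t < 0 \<Longrightarrow> v j t = 0" using v that by (auto simp: vhl2_def hl2_def)
    have "ip (v j) (WHadj u j) = ip (v j) (\<lambda>t. \<Sum>i<m. cnj (D i j) * u i t + conv (reflect (g i j)) (u i) t)"
      unfolding ip_def WHadj_eq by (intro Bochner_Integration.integral_cong refl) (auto simp: indicator_def vj)
    also have "\<dots> = cnj (\<Sum>i<m. ip (\<lambda>t. cnj (D i j) * u i t + conv (reflect (g i j)) (u i) t) (v j))"
      using vj by (subst ip_cnj[symmetric], subst ip_sum_left) (auto intro: WHadj_summand u)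
    also have "\<dots> = (\<Sum>i<m. ip (v j) (\<lambda>t. cnj (D i j) * u i t + conv (reflect (g i j)) (u i) t))"
      by (simp add: ip_cnj)
    also have "\<dots> = (\<Sum>i<m. D i j * ip (v j) (u i) + ip (conv (g i j) (v j)) (u i))"
    proof (intro sum.cong refl)
      fix i assume "i \<in> {..<m}"
      then have ui: "sqint (u i)" "sqint (conv (reflect (g i j)) (u i))"
        using u by (auto intro!: young rg_int dest: vhl2D)
      then have "ip (v j) (\<lambda>t. cnj (D i j) * u i t + conv (reflect (g i j)) (u i) t)
         = D i j * ip (v j) (u i) + (LINT t|lborel. v j t * cnj (conv (reflect (g i j)) (u i) t))"
        using ip_integrable[OF vj(1) ui(1)] ip_integrable[OF vj(1) ui(2)] unfolding ip_def
        by (simp add: distrib_left mult.left_commute)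
      then show "ip (v j) (\<lambda>t. cnj (D i j) * u i t + conv (reflect (g i j)) (u i) t)
         = D i j * ip (v j) (u i) + ip (conv (g i j) (v j)) (u i)"
        by (simp add: conv_adjoint[OF g_int g_sqint vj(1) ui(1), symmetric] ip_def)
    qed
    finally show ?thesis .
  qed
  ultimately have "(\<Sum>i<m. ip (WH v i) (u i)) = (\<Sum>i<m. \<Sum>j<p. D i j * ip (v j) (u i) + ip (conv (g i j) (v j)) (u i))"
    "(\<Sum>j<p. ip (v j) (WHadj u j)) = (\<Sum>j<p. \<Sum>i<m. D i j * ip (v j) (u i) + ip (conv (g i j) (v j)) (u i))"
    by auto
  then show ?thesis by (subst (asm) sum.swap) (simp only:)
qed

lemma adjoint':
  assumes "vhl2 p v" "vhl2 m u"
  shows "(\<Sum>i<m. ip (u i) (WH v i)) = (\<Sum>j<p. ip (WHadj u j) (v j))"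
proof -
  have "cnj (\<Sum>i<m. ip (WH v i) (u i)) = cnj (\<Sum>j<p. ip (v j) (WHadj u j))"
    by (rule arg_cong[OF adjoint[OF assms]])
  then show ?thesis by (simp only: cnj_sum ip_cnj)
qed

end

section \<open>Strict positivity in \<open>L\<^sup>2\<close>\<close>

text \<open>Strict positivity of \<open>T T\<^sup>*\<close>, with the quadratic form written as the square of the norm of \<open>T\<^sup>* h\<close>.\<close>

locale wh_positive = wh_symbol +
  fixes c :: real
  assumes c_pos: "0 < c"
    and positive: "vhl2 m h \<Longrightarrow> c * (\<Sum>i<m. (l2n (h i))\<^sup>2) \<le> (\<Sum>j<p. (l2n (WHadj h j))\<^sup>2)"
begin

definition WHgram :: "(nat \<Rightarrow> real \<Rightarrow> complex) \<Rightarrow> nat \<Rightarrow> real \<Rightarrow> complex" where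
  "WHgram u = WH (WHadj u)"

lemma WHgram_vhl2: "vhl2 m u \<Longrightarrow> vhl2 n (WHgram u)"
  unfolding WHgram_def by (intro WH_vhl2 WHadj_vhl2)

lemma WHgram_bound: "vhl2 m u \<Longrightarrow> vnorm m (WHgram u) \<le> WH_const\<^sup>2 * vnorm m u"
proof -
  assume u: "vhl2 m u"
  have "vnorm m (WHgram u) \<le> WH_const * vnorm p (WHadj u)" unfolding WHgram_def by (intro WH_bound WHadj_vhl2 u)
  also have "\<dots> \<le> WH_const * (WH_const * vnorm m u)" by (intro mult_left_mono WHadj_bound u WH_const_nonneg)
  finally show ?thesis by (simp add: power2_eq_square mult.assoc)
qed

lemma WHgram_inner:
  assumes "vhl2 m u" "vhl2 m w"
  shows "(\<Sum>i<m. ip (WHgram u i) (w i)) = (\<Sum>j<p. ip (WHadj u j) (WHadj w j))"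
  unfolding WHgram_def by (rule adjoint[OF WHadj_vhl2[OF assms(1)] assms(2)])

lemma WHgram_Re_inner:
  assumes "vhl2 m u"
  shows "(\<Sum>i<m. Re (ip (WHgram u i) (u i))) = (\<Sum>j<p. (l2n (WHadj u j))\<^sup>2)"
proof -
  have "(\<Sum>i<m. Re (ip (WHgram u i) (u i))) = Re (\<Sum>i<m. ip (WHgram u i) (u i))" by simp
  also have "\<dots> = Re (\<Sum>j<p. complex_of_real ((l2n (WHadj u j))\<^sup>2))"
    by (simp only: WHgram_inner[OF assms assms] ip_self)
  finally show ?thesis by (simp only: Re_sum Re_complex_of_real)
qed

lemma WHgram_lower:
  assumes u: "vhl2 m u"
  shows "c * vnorm m u \<le> real m * vnorm m (WHgram u)"
proof -
  have "c * (\<Sum>i<m. (l2n (u i))\<^sup>2) \<le> (\<Sum>i<m. Re (ip (WHgram u i) (u i)))"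
    using positive[OF u] WHgram_Re_inner[OF u] by simp
  also have "\<dots> \<le> (\<Sum>i<m. vnorm m (WHgram u) * l2n (u i))"
  proof (intro sum_mono)
    fix i assume i: "i \<in> {..<m}"
    then have "Re (ip (WHgram u i) (u i)) \<le> l2n (WHgram u i) * l2n (u i)"
      using ip_bound[of "WHgram u i" "u i"] complex_Re_le_cmod[of "ip (WHgram u i) (u i)"]
        vhl2D(2)[OF u] vhl2D(2)[OF WHgram_vhl2[OF u, of m]] by force
    also have "\<dots> \<le> vnorm m (WHgram u) * l2n (u i)"
      using i by (intro mult_right_mono l2n_le_vnorm) auto
    finally show "Re (ip (WHgram u i) (u i)) \<le> vnorm m (WHgram u) * l2n (u i)" .
  qed
  also have "\<dots> = vnorm m (WHgram u) * vnorm m u" by (simp add: vnorm_def sum_distrib_left)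
  finally have 1: "c * (\<Sum>i<m. (l2n (u i))\<^sup>2) \<le> vnorm m (WHgram u) * vnorm m u" .
  have "c * (vnorm m u)\<^sup>2 \<le> c * (real m * (\<Sum>i<m. (l2n (u i))\<^sup>2))"
    using c_pos by (intro mult_left_mono vnorm_sq_le) auto
  also have "\<dots> \<le> real m * (vnorm m (WHgram u) * vnorm m u)"
    using mult_left_mono[OF 1, of "real m"] by (simp add: mult_ac)
  finally have 2: "(c * vnorm m u) * vnorm m u \<le> (real m * vnorm m (WHgram u)) * vnorm m u"
    by (simp add: power2_eq_square mult_ac)
  show ?thesis
  proof (cases "vnorm m u = 0")
    case False
    then have "0 < vnorm m u" using vnorm_nonneg[of m u] by linarith
    then show ?thesis using 2 by (simp add: mult_le_cancel_right)
  qed simp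
qed

text \<open>The system \<open>T v = f\<close>, \<open>T\<^sup>* u = v\<close> is equivalent to \<open>T T\<^sup>* u = f\<close> and inherits its lower bound. It has
the advantage that only single convolutions occur in it, for which commutators with weights are easy to estimate.\<close>

lemma system_lower:
  obtains C where "0 < C" and "\<And>u v. vhl2 m u \<Longrightarrow> vhl2 p v \<Longrightarrow>
     vnorm m u + vnorm p v \<le> C * (vnorm m (WH v) + vnorm p (\<lambda>j t. WHadj u j t - v j t))"
proof
  let ?a = "real m / c * (1 + WH_const)"
  show "0 < 1 + ?a * (1 + WH_const)" using c_pos WH_const_nonneg by (intro add_pos_nonneg mult_nonneg_nonneg divide_nonneg_pos) auto
  fix u v assume u: "vhl2 m u" and v: "vhl2 p v"
  define e where "e = (\<lambda>j t. WHadj u j t - v j t)"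
  have e: "vhl2 p e" unfolding e_def by (intro vhl2_diff WHadj_vhl2 u v)
  have Ts: "WHadj u = (\<lambda>j t. v j t + e j t)" by (simp add: e_def)
  have "WHgram u i t = WH v i t + WH e i t" for i t
    unfolding WHgram_def Ts by (rule WH_add[OF v e])
  then have AAeq: "WHgram u = (\<lambda>i t. WH v i t + WH e i t)" by (intro ext)
  have "vnorm m (WHgram u) \<le> vnorm m (WH v) + vnorm m (WH e)"
    unfolding AAeq by (intro vnorm_add WH_vhl2 v e)
  also have "\<dots> \<le> vnorm m (WH v) + WH_const * vnorm p e" using WH_bound[OF e] by simp
  also have "\<dots> \<le> (1 + WH_const) * (vnorm m (WH v) + vnorm p e)"
    using WH_const_nonneg mult_nonneg_nonneg[OF WH_const_nonneg vnorm_nonneg, of m "WH v"] vnorm_nonneg[of p e]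
    unfolding distrib_left distrib_right by linarith
  finally have 1: "vnorm m (WHgram u) \<le> (1 + WH_const) * (vnorm m (WH v) + vnorm p e)" .
  have "vnorm m u \<le> real m / c * vnorm m (WHgram u)"
    using WHgram_lower[OF u] c_pos by (simp add: field_simps)
  also have "\<dots> \<le> real m / c * ((1 + WH_const) * (vnorm m (WH v) + vnorm p e))"
    using c_pos by (intro mult_left_mono 1) auto
  finally have 2: "vnorm m u \<le> ?a * (vnorm m (WH v) + vnorm p e)" by (simp only: mult.assoc)
  have "v = (\<lambda>j t. WHadj u j t + (-1) * e j t)" by (simp add: e_def)
  then have "vnorm p v \<le> vnorm p (WHadj u) + vnorm p (\<lambda>j t. (-1) * e j t)"
    using vnorm_add[OF WHadj_vhl2[OF u] vhl2_cmult[OF e, of "-1"]] by simp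
  also have "vnorm p (\<lambda>j t. (-1) * e j t) = vnorm p e"
    unfolding vnorm_def l2n_cmult by simp
  finally have "vnorm p v \<le> WH_const * vnorm m u + vnorm p e" using WHadj_bound[OF u] by linarith
  then have "vnorm m u + vnorm p v \<le> (1 + WH_const) * vnorm m u + (vnorm m (WH v) + vnorm p e)"
    using vnorm_nonneg[of m "WH v"] unfolding distrib_right by linarith
  also have "\<dots> \<le> (1 + WH_const) * (?a * (vnorm m (WH v) + vnorm p e)) + (vnorm m (WH v) + vnorm p e)"
    using WH_const_nonneg by (intro add_right_mono mult_left_mono 2) auto
  also have "\<dots> = (1 + ?a * (1 + WH_const)) * (vnorm m (WH v) + vnorm p e)"
  proof -
    have "\<And>a b z :: real. b * (a * z) + z = (1 + a * b) * z" by (simp add: algebra_simps)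
    then show ?thesis .
  qed
  finally show "vnorm m u + vnorm p v \<le> (1 + ?a * (1 + WH_const)) * (vnorm m (WH v) + vnorm p (\<lambda>j t. WHadj u j t - v j t))"
    by (simp only: e_def)
qed

subsection \<open>Solvability\<close>

lemma WHgram_add: "vhl2 m u \<Longrightarrow> vhl2 m w \<Longrightarrow> WHgram (\<lambda>i t. u i t + w i t) i t = WHgram u i t + WHgram w i t"
proof -
  assume u: "vhl2 m u" and w: "vhl2 m w"
  have "WHadj (\<lambda>i t. u i t + w i t) = (\<lambda>j t. WHadj u j t + WHadj w j t)" by (intro ext WHadj_add u w)
  then show ?thesis unfolding WHgram_def by (simp add: WH_add WHadj_vhl2 u w)
qed

lemma WHgram_diff: "vhl2 m u \<Longrightarrow> vhl2 m w \<Longrightarrow> WHgram (\<lambda>i t. u i t - w i t) i t = WHgram u i t - WHgram w i t"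
proof -
  assume u: "vhl2 m u" and w: "vhl2 m w"
  have "WHadj (\<lambda>i t. u i t - w i t) = (\<lambda>j t. WHadj u j t - WHadj w j t)" by (intro ext WHadj_diff u w)
  then show ?thesis unfolding WHgram_def by (simp add: WH_diff WHadj_vhl2 u w)
qed

lemma WHgram_cmult: "WHgram (\<lambda>i t. k * u i t) i t = k * WHgram u i t"
proof -
  have "WHadj (\<lambda>i t. k * u i t) = (\<lambda>j t. k * WHadj u j t)" by (intro ext WHadj_cmult)
  then show ?thesis unfolding WHgram_def by (simp add: WH_cmult)
qed

text \<open>A step \<open>r - k A r\<close> contracts for small \<open>k > 0\<close>: in the square of its norm the linear term is at most
\<open>- 2 k c\<close> and the quadratic term is of order \<open>k\<^sup>2\<close>.\<close>

lemma richardson_contraction: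
  obtains k q where "0 < q" "q < 1" and "\<And>r. vhl2 m r \<Longrightarrow>
    (\<Sum>i<m. (l2n (\<lambda>t. r i t - complex_of_real k * WHgram r i t))\<^sup>2) \<le> q\<^sup>2 * (\<Sum>i<m. (l2n (r i))\<^sup>2)"
proof
  \<comment> \<open>\<open>M\<close> bounds the square of the norm of \<open>A\<close>; the summand \<open>2 c\<^sup>2\<close> keeps \<open>1 - c\<^sup>2 / M\<close>, the square of \<open>q\<close>, positive.
    The step size is \<open>c / M\<close>.\<close>
  define M where "M = (WH_const\<^sup>2)\<^sup>2 * real m + 2 * c\<^sup>2"
  have M: "0 < M" "2 * c\<^sup>2 \<le> M" using c_pos by (auto simp: M_def intro: add_nonneg_pos)
  have cM: "0 < c\<^sup>2 / M" "c\<^sup>2 / M < 1" using M c_pos by (auto simp: field_simps)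
  show "0 < sqrt (1 - c\<^sup>2 / M)" "sqrt (1 - c\<^sup>2 / M) < 1" using cM by auto
  fix r assume r: "vhl2 m r"
  let ?Q = "\<Sum>i<m. (l2n (r i))\<^sup>2"
  have Q0: "0 \<le> ?Q" by (intro sum_nonneg) auto
  have "(\<Sum>i<m. (l2n (WHgram r i))\<^sup>2) \<le> (vnorm m (WHgram r))\<^sup>2" by (rule sq_le_vnorm)
  also have "\<dots> \<le> (WH_const\<^sup>2 * vnorm m r)\<^sup>2" by (intro power_mono WHgram_bound r) auto
  also have "\<dots> \<le> (WH_const\<^sup>2)\<^sup>2 * (real m * ?Q)"
    unfolding power_mult_distrib by (intro mult_left_mono vnorm_sq_le) auto
  also have "\<dots> \<le> M * ?Q"
    unfolding M_def distrib_right using Q0 c_pos by (simp add: mult.assoc)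
  finally have 1: "(\<Sum>i<m. (l2n (WHgram r i))\<^sup>2) \<le> M * ?Q" .
  have "(\<Sum>i<m. (l2n (\<lambda>t. r i t - complex_of_real (c / M) * WHgram r i t))\<^sup>2)
    = (\<Sum>i<m. (l2n (r i))\<^sup>2 - 2 * (c / M) * Re (ip (WHgram r i) (r i)) + (c / M)\<^sup>2 * (l2n (WHgram r i))\<^sup>2)"
    by (intro sum.cong refl l2n_diff_scaled vhl2D(2)[OF r] vhl2D(2)[OF WHgram_vhl2[OF r, of m]]) auto
  also have "\<dots> = ?Q - 2 * (c / M) * (\<Sum>i<m. Re (ip (WHgram r i) (r i))) + (c / M)\<^sup>2 * (\<Sum>i<m. (l2n (WHgram r i))\<^sup>2)"
    by (simp add: sum.distrib sum_subtractf sum_distrib_left)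
  also have "\<dots> \<le> ?Q - 2 * (c / M) * (c * ?Q) + (c / M)\<^sup>2 * (M * ?Q)"
    using 1 positive[OF r] WHgram_Re_inner[OF r] M c_pos
    by (intro add_mono diff_mono mult_left_mono order_refl) auto
  also have "\<dots> = (1 - c\<^sup>2 / M) * ?Q" using M(1) by (simp add: field_simps power2_eq_square)
  also have "\<dots> = (sqrt (1 - c\<^sup>2 / M))\<^sup>2 * ?Q" using cM by simp
  finally show "(\<Sum>i<m. (l2n (\<lambda>t. r i t - complex_of_real (c / M) * WHgram r i t))\<^sup>2) \<le> (sqrt (1 - c\<^sup>2 / M))\<^sup>2 * ?Q" .
qed

text \<open>The residuals of Richardson's iteration decay geometrically, so the corrections \<open>k r\<^sub>n\<close> sum to a
solution.\<close>

lemma solvable: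
  assumes f: "vhl2 m f"
  obtains w where "vhl2 m w" "\<And>i. i < m \<Longrightarrow> AE t in lborel. WHgram w i t = f i t"
proof -
  obtain k q where q: "0 < q" "q < 1" and contr: "\<And>r. vhl2 m r \<Longrightarrow>
    (\<Sum>i<m. (l2n (\<lambda>t. r i t - complex_of_real k * WHgram r i t))\<^sup>2) \<le> q\<^sup>2 * (\<Sum>i<m. (l2n (r i))\<^sup>2)"
    by (rule richardson_contraction, rule that)
  define r where "r = rec_nat f (\<lambda>_ s i t. s i t - complex_of_real k * WHgram s i t)"
  have r0: "r 0 = f" and rS: "r (Suc n) = (\<lambda>i t. r n i t - complex_of_real k * WHgram (r n) i t)" for n
    by (simp_all add: r_def)
  have r: "vhl2 m (r n)" for n
  proof (induction n)
    case (Suc n)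
    then show ?case unfolding rS by (intro vhl2_diff vhl2_cmult WHgram_vhl2)
  qed (simp add: r0 f)
  let ?Q = "\<lambda>n. \<Sum>i<m. (l2n (r n i))\<^sup>2"
  have Q: "?Q n \<le> (q ^ n)\<^sup>2 * ?Q 0" for n
  proof (induction n)
    case (Suc n)
    have "?Q (Suc n) \<le> q\<^sup>2 * ?Q n" unfolding rS using contr[OF r[of n]] .
    also have "\<dots> \<le> q\<^sup>2 * ((q ^ n)\<^sup>2 * ?Q 0)" by (intro mult_left_mono Suc) auto
    finally show ?case by (simp add: power_mult_distrib mult.assoc)
  qed simp
  have rb: "l2n (r n i) \<le> q ^ n * sqrt (?Q 0)" if "i < m" for n i
  proof -
    have "(l2n (r n i))\<^sup>2 \<le> ?Q n" using that by (intro member_le_sum) auto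
    also have "\<dots> \<le> (q ^ n * sqrt (?Q 0))\<^sup>2" using Q[of n] by (simp add: power_mult_distrib sum_nonneg)
    finally show ?thesis by (rule power2_le_imp_le) (use q in \<open>auto intro!: mult_nonneg_nonneg sum_nonneg\<close>)
  qed
  define d where "d = (\<lambda>n i t. complex_of_real k * r n i t)"
  have d: "vhl2 m (d n)" for n unfolding d_def by (intro vhl2_cmult r)
  have "\<exists>w. hl2 w \<and> (\<lambda>N. l2n (\<lambda>t. w t - (\<Sum>n<N. d n i t))) \<longlonglongrightarrow> 0" if i: "i < m" for i
  proof -
    have s: "summable (\<lambda>n. l2n (d n i))"
    proof (rule summable_comparison_test')
      show "summable (\<lambda>n. q ^ n * (\<bar>k\<bar> * sqrt (?Q 0)))"
        using q by (intro summable_mult2 summable_geometric) auto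
      show "norm (l2n (d n i)) \<le> q ^ n * (\<bar>k\<bar> * sqrt (?Q 0))" if "0 \<le> n" for n
        using mult_left_mono[OF rb[OF i, of n], of "\<bar>k\<bar>"] by (simp add: d_def l2n_cmult mult_ac)
    qed
    obtain w where "sqint w" "\<And>t. t < 0 \<Longrightarrow> w t = 0" "(\<lambda>N. l2n (\<lambda>t. w t - (\<Sum>n<N. d n i t))) \<longlonglongrightarrow> 0"
      by (rule riesz_fischer[of "\<lambda>n. d n i", OF vhl2D(2)[OF d i] s hl2_neg[OF vhl2D(1)[OF d i]]], assumption, rule that)
    then show ?thesis by (auto simp: hl2_def)
  qed
  then obtain w where w: "\<And>i. i < m \<Longrightarrow> hl2 (w i)"
    and lim: "\<And>i. i < m \<Longrightarrow> (\<lambda>N. l2n (\<lambda>t. w i t - (\<Sum>n<N. d n i t))) \<longlonglongrightarrow> 0"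
    by metis
  have vw: "vhl2 m w" using w by (simp add: vhl2_def)
  define S where "S = (\<lambda>N i t. \<Sum>n<N. d n i t)"
  have S: "vhl2 m (S N)" for N using d unfolding S_def vhl2_def by (auto intro!: hl2_sum)
  have AS: "WHgram (S N) i t = f i t - r N i t" if "i < m" for N i t
  proof (induction N)
    case 0
    have "WHgram (\<lambda>i t. 0 * f i t) i t = 0 * WHgram f i t" by (rule WHgram_cmult)
    then show ?case by (simp add: S_def r0)
  next
    case (Suc N)
    have "S (Suc N) = (\<lambda>i t. S N i t + d N i t)" by (simp add: S_def)
    then have "WHgram (S (Suc N)) i t = WHgram (S N) i t + WHgram (d N) i t" using WHgram_add[OF S d] by simp
    also have "WHgram (d N) i t = complex_of_real k * WHgram (r N) i t" unfolding d_def by (rule WHgram_cmult)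
    finally show ?case using Suc by (simp add: rS)
  qed
  have "AE t in lborel. WHgram w i t = f i t" if i: "i < m" for i
  proof -
    have sA: "sqint (WHgram w i)" "sqint (f i)" "sqint (r N i)" "sqint (WHgram (\<lambda>i t. w i t - S N i t) i)" for N
      using vhl2D(2)[OF WHgram_vhl2[OF vw, of m] i] vhl2D(2)[OF f i] vhl2D(2)[OF r i]
        vhl2D(2)[OF WHgram_vhl2[OF vhl2_diff[OF vw S], of m] i] by auto
    have le: "l2n (\<lambda>t. WHgram w i t - f i t) \<le> WH_const\<^sup>2 * vnorm m (\<lambda>i t. w i t - S N i t) + q ^ N * sqrt (?Q 0)" for N
    proof -
      have "WHgram w i t - f i t = WHgram (\<lambda>i t. w i t - S N i t) i t - r N i t" for t
        using WHgram_diff[OF vw S] AS[OF i] by simp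
      then have "l2n (\<lambda>t. WHgram w i t - f i t) \<le> l2n (WHgram (\<lambda>i t. w i t - S N i t) i) + l2n (r N i)"
        using sqint_diff(2)[OF sA(4,3)] by simp
      also have "l2n (WHgram (\<lambda>i t. w i t - S N i t) i) \<le> vnorm m (WHgram (\<lambda>i t. w i t - S N i t))"
        by (rule l2n_le_vnorm[OF i])
      also have "\<dots> \<le> WH_const\<^sup>2 * vnorm m (\<lambda>i t. w i t - S N i t)" by (intro WHgram_bound vhl2_diff vw S)
      finally show ?thesis using rb[OF i, of N] by linarith
    qed
    have "(\<lambda>N. WH_const\<^sup>2 * vnorm m (\<lambda>i t. w i t - S N i t) + q ^ N * sqrt (?Q 0)) \<longlonglongrightarrow> WH_const\<^sup>2 * (\<Sum>i<m. 0) + 0 * sqrt (?Q 0)"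
      unfolding vnorm_def S_def using q
      by (intro tendsto_add tendsto_mult tendsto_const tendsto_sum lim LIMSEQ_power_zero) auto
    then have "l2n (\<lambda>t. WHgram w i t - f i t) \<le> WH_const\<^sup>2 * (\<Sum>i<m. 0) + 0 * sqrt (?Q 0)"
      by (rule LIMSEQ_le_const) (use le in blast)
    then have "l2n (\<lambda>t. WHgram w i t - f i t) = 0" using l2n_nonneg[of "\<lambda>t. WHgram w i t - f i t"] by simp
    then have "AE t in lborel. WHgram w i t - f i t = 0" by (intro l2n_zero_AE sqint_diff sA)
    then show ?thesis by simp
  qed
  then show ?thesis using that vw by blast
qed

subsection \<open>The value at infinity\<close>

text \<open>Positivity is tested on \<open>h = x 1\<^bsub>[0,d]\<^esub>\<close>. Convolution with an \<open>L\<^sup>2\<close>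
kernel sends it to a function of norm \<open>O(d)\<close>, negligible against the norm \<open>|x| \<surd>d\<close> of \<open>h\<close> as \<open>d\<close> tends
to 0, so only \<open>D\<^sup>* x\<close> remains.\<close>

lemma D_positive: "c * (\<Sum>i<m. (cmod (x i))\<^sup>2) \<le> (\<Sum>j<p. (cmod (\<Sum>i<m. cnj (D i j) * x i))\<^sup>2)"
proof -
  let ?a = "\<lambda>j. cmod (\<Sum>i<m. cnj (D i j) * x i)"
  let ?b = "\<lambda>j. \<Sum>i<m. cmod (x i) * l2n (g i j)"
  have main: "c * (\<Sum>i<m. (cmod (x i))\<^sup>2) \<le> (\<Sum>j<p. (?a j + ?b j * sqrt d)\<^sup>2)" if d: "0 < d" for d
  proof -
    define e where "e = (\<lambda>t. indicator {0..d} t :: complex)"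
    have e2: "(cmod (e t))\<^sup>2 = indicator {0..d} t" "cmod (e t) = indicator {0..d} t" for t
      by (auto simp: e_def indicator_def)
    have [measurable]: "e \<in> borel_measurable borel" by (simp add: e_def)
    have ie: "integrable lborel (\<lambda>t. indicator {0..d} t :: real)" by (rule integrable_real_indicator) (auto simp: emeasure_lborel_Icc_eq)
    have se: "sqint e" using ie unfolding sqint_def e2(1) by simp
    have ie': "integrable lborel e"
      by (rule Bochner_Integration.integrable_bound[OF ie]) (simp_all add: e2(2))
    have ne: "l2n e = sqrt d" unfolding l2n_def e2(1) using d by simp
    have ne': "l1n e = d" unfolding l1n_def e2(2) using d by simp
    define h where "h = (\<lambda>i t. x i * e t)"
    have h: "vhl2 m h" by (auto simp: vhl2_def hl2_def h_def sqint_cmult[OF se]) (simp add: e_def)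
    have nh: "(l2n (h i))\<^sup>2 = (cmod (x i))\<^sup>2 * d" for i
      using d by (simp add: h_def l2n_cmult ne power_mult_distrib)
    have WHadj: "l2n (WHadj h j) \<le> ?a j * sqrt d + ?b j * d" for j
    proof -
      have sc: "sqint (\<lambda>t. (\<Sum>i<m. cnj (D i j) * x i) * e t)" by (rule sqint_cmult[OF se])
      have sd: "sqint (\<lambda>t. x i * conv e (reflect (g i j)) t)" for i by (intro sqint_cmult young ie' rg_sqint)
      have "(\<lambda>t. \<Sum>i<m. cnj (D i j) * h i t + conv (reflect (g i j)) (h i) t)
        = (\<lambda>t. (\<Sum>i<m. cnj (D i j) * x i) * e t + (\<Sum>i<m. x i * conv e (reflect (g i j)) t))"
        by (simp add: h_def conv_cmult_right conv_commute[of e] sum.distrib sum_distrib_right mult.assoc)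
      then have "l2n (WHadj h j) \<le> l2n (\<lambda>t. (\<Sum>i<m. cnj (D i j) * x i) * e t + (\<Sum>i<m. x i * conv e (reflect (g i j)) t))"
        using WHadj_bound_sum(2)[OF h, of j] by simp
      also have "\<dots> \<le> l2n (\<lambda>t. (\<Sum>i<m. cnj (D i j) * x i) * e t) + l2n (\<lambda>t. \<Sum>i<m. x i * conv e (reflect (g i j)) t)"
        by (intro sqint_add sc sqint_sum sd)
      also have "l2n (\<lambda>t. \<Sum>i<m. x i * conv e (reflect (g i j)) t) \<le> (\<Sum>i<m. l2n (\<lambda>t. x i * conv e (reflect (g i j)) t))"
        by (intro sqint_sum sd)
      also have "\<dots> \<le> (\<Sum>i<m. cmod (x i) * l2n (g i j) * d)"
        unfolding l2n_cmult mult.assoc using young(2)[OF ie' rg_sqint]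
        by (intro sum_mono mult_left_mono) (simp_all add: ne' rg_l2n mult.commute[of _ d])
      finally show ?thesis by (simp only: l2n_cmult ne sum_distrib_right[symmetric])
    qed
    have "c * (\<Sum>i<m. (cmod (x i))\<^sup>2) * d = c * (\<Sum>i<m. (l2n (h i))\<^sup>2)"
      by (simp add: nh sum_distrib_right mult.assoc)
    also have "\<dots> \<le> (\<Sum>j<p. (l2n (WHadj h j))\<^sup>2)" by (rule positive[OF h])
    also have "\<dots> \<le> (\<Sum>j<p. (?a j * sqrt d + ?b j * d)\<^sup>2)" by (intro sum_mono power_mono WHadj) auto
    also have "\<dots> = (\<Sum>j<p. (?a j + ?b j * sqrt d)\<^sup>2) * d"
    proof -
      have "(?a j * sqrt d + ?b j * d)\<^sup>2 = (?a j + ?b j * sqrt d)\<^sup>2 * d" for j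
      proof -
        have "?a j * sqrt d + ?b j * d = (?a j + ?b j * sqrt d) * sqrt d"
          using d by (simp add: distrib_right mult.assoc)
        then show ?thesis using d by (simp only: power_mult_distrib) simp
      qed
      then show ?thesis by (simp only: sum_distrib_right[symmetric])
    qed
    finally show ?thesis using d by simp
  qed
  have "(\<lambda>n. \<Sum>j<p. (?a j + ?b j * sqrt (1 / real (Suc n)))\<^sup>2) \<longlonglongrightarrow> (\<Sum>j<p. (?a j + ?b j * sqrt 0)\<^sup>2)"
    by (intro tendsto_sum tendsto_power tendsto_add tendsto_mult tendsto_const tendsto_real_sqrt
        LIMSEQ_Suc[OF lim_1_over_n])
  then have "c * (\<Sum>i<m. (cmod (x i))\<^sup>2) \<le> (\<Sum>j<p. (?a j + ?b j * sqrt 0)\<^sup>2)"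
    by (rule LIMSEQ_le_const) (auto intro!: main)
  then show ?thesis by simp
qed

lemma D_recover:
  "(\<Sum>i<m. cmod (x i)) \<le> real m / c * (\<Sum>k<m. cmod (\<Sum>j<p. D k j * (\<Sum>i<m. cnj (D i j) * x i)))"
proof -
  define X where "X = (\<lambda>j. \<Sum>i<m. cnj (D i j) * x i)"
  define R where "R = (\<Sum>k<m. cmod (\<Sum>j<p. D k j * X j))"
  define s where "s = (\<Sum>i<m. cmod (x i))"
  have s0: "0 \<le> s" by (simp add: s_def sum_nonneg)
  have "complex_of_real (\<Sum>j<p. (cmod (X j))\<^sup>2) = (\<Sum>j<p. X j * cnj (X j))"
    unfolding of_real_sum by (intro sum.cong refl) (rule complex_norm_square)
  also have "\<dots> = (\<Sum>j<p. \<Sum>k<m. cnj (x k) * (D k j * X j))"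
    by (simp add: X_def sum_distrib_left mult_ac)
  also have "\<dots> = (\<Sum>k<m. cnj (x k) * (\<Sum>j<p. D k j * X j))"
    by (subst sum.swap) (simp add: sum_distrib_left)
  finally have "cmod (complex_of_real (\<Sum>j<p. (cmod (X j))\<^sup>2)) = cmod (\<Sum>k<m. cnj (x k) * (\<Sum>j<p. D k j * X j))"
    by simp
  then have "(\<Sum>j<p. (cmod (X j))\<^sup>2) = cmod (\<Sum>k<m. cnj (x k) * (\<Sum>j<p. D k j * X j))"
    by (simp only: norm_of_real) (simp add: sum_nonneg)
  also have "\<dots> \<le> (\<Sum>k<m. cmod (x k) * cmod (\<Sum>j<p. D k j * X j))"
    by (rule order_trans[OF norm_sum]) (simp add: norm_mult)
  also have "\<dots> \<le> (\<Sum>k<m. s * cmod (\<Sum>j<p. D k j * X j))"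
    unfolding s_def by (intro sum_mono mult_right_mono member_le_sum) auto
  also have "\<dots> = s * R" by (simp add: R_def sum_distrib_left)
  finally have 1: "c * (\<Sum>i<m. (cmod (x i))\<^sup>2) \<le> s * R" using D_positive[of x] by (simp add: X_def)
  have "s\<^sup>2 \<le> real m * (\<Sum>i<m. (cmod (x i))\<^sup>2)"
    unfolding s_def using sum_squared_le_sum_of_squares[of "\<lambda>i. cmod (x i)" "{..<m}"] by (simp add: mult.commute)
  then have "c * s\<^sup>2 \<le> real m * (c * (\<Sum>i<m. (cmod (x i))\<^sup>2))"
    using mult_left_mono[of "s\<^sup>2" _ c] c_pos by (simp add: mult_ac)
  also have "\<dots> \<le> real m * (s * R)" by (intro mult_left_mono 1) auto
  finally have 2: "(c * s) * s \<le> (real m * R) * s" by (simp add: power2_eq_square mult_ac)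
  have "c * s \<le> real m * R"
  proof (cases "s = 0")
    case True
    then show ?thesis by (simp add: R_def sum_nonneg)
  qed (use 2 s0 in \<open>simp add: mult_le_cancel_right\<close>)
  then show ?thesis using c_pos unfolding s_def R_def X_def by (simp add: field_simps)
qed

end

section \<open>The inverse acts on bounded and on integrable functions\<close>

lemma sqint_wt:
  assumes \<eta>: "0 < \<eta>"
  shows "sqint (wt \<eta> c)" and "l2n (wt \<eta> c) = l2n (wt \<eta> 0)"
proof -
  have half: "integrable lborel (\<lambda>t. indicator {0..} t * exp (- (2 * \<eta> * t)) :: real)"
  proof (rule integrableI_nonneg)
    have "(\<integral>\<^sup>+t. ennreal (exp (- (2 * \<eta> * t))) * indicator {0..} t \<partial>lborel) = ennreal (0 - (- exp (- (2 * \<eta> * 0)) / (2 * \<eta>)))"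
    proof (rule nn_integral_FTC_atLeast)
      fix t :: real
      show "((\<lambda>t. - exp (- (2 * \<eta> * t)) / (2 * \<eta>)) has_real_derivative exp (- (2 * \<eta> * t))) (at t)"
        using \<eta> by (auto intro!: derivative_eq_intros)
    next
      have "filterlim (\<lambda>t. - (2 * \<eta> * t)) at_bot at_top"
        unfolding filterlim_uminus_at_bot
        using \<eta> by (simp add: filterlim_tendsto_pos_mult_at_top[OF tendsto_const] filterlim_ident)
      then have "((\<lambda>t. exp (- (2 * \<eta> * t))) \<longlongrightarrow> 0) at_top"
        by (rule filterlim_compose[OF exp_at_bot])
      then have "((\<lambda>t. - exp (- (2 * \<eta> * t)) / (2 * \<eta>)) \<longlongrightarrow> - 0 / (2 * \<eta>)) at_top"
        using \<eta> by (intro tendsto_intros) auto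
      then show "((\<lambda>t. - exp (- (2 * \<eta> * t)) / (2 * \<eta>)) \<longlongrightarrow> 0) at_top" by simp
    qed auto
    then show "(\<integral>\<^sup>+t. ennreal (indicator {0..} t * exp (- (2 * \<eta> * t))) \<partial>lborel) < \<infinity>"
      by (simp add: ennreal_mult mult.commute ennreal_indicator)
  qed auto
  have other: "integrable lborel (\<lambda>t. indicator {0..} (- t) * exp (2 * \<eta> * t) :: real)"
    using lborel_integrable_real_affine[OF half, of "-1" 0] by simp
  have bd: "(cmod (wt \<eta> 0 t))\<^sup>2 \<le> indicator {0..} t * exp (- (2 * \<eta> * t)) + indicator {0..} (- t) * exp (2 * \<eta> * t)" for t
    by (cases "0 \<le> t") (auto simp: cmod_wt power2_eq_square exp_add[symmetric] indicator_def)
  have "integrable lborel (\<lambda>t. (cmod (wt \<eta> 0 t))\<^sup>2)"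
    by (rule Bochner_Integration.integrable_bound[OF Bochner_Integration.integrable_add[OF half other]])
       (use bd in \<open>auto intro: order_trans[OF _ abs_ge_self]\<close>)
  then have s0: "sqint (wt \<eta> 0)" by (simp add: sqint_def)
  have "wt \<eta> c = (\<lambda>t. wt \<eta> 0 (- c + 1 * t))" by (auto simp: wt_def)
  then show "sqint (wt \<eta> c)" "l2n (wt \<eta> c) = l2n (wt \<eta> 0)" using sqint_shift[OF s0, of 1 "- c"] by auto
qed

lemma conv_sup_bound:
  assumes a: "integrable lborel a" and b: "b \<in> borel_measurable borel" and M: "AE t in lborel. cmod (b t) \<le> M"
  shows "cmod (conv a b t) \<le> l1n a * M"
proof -
  have [measurable]: "a \<in> borel_measurable borel" "b \<in> borel_measurable borel"
    using assms borel_measurable_integrable by auto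
  have M': "AE s in lborel. cmod (b (t - s)) \<le> M"
    using AE_borel_affine[of "-1" "\<lambda>s. cmod (b s) \<le> M" t] M by simp
  have le: "AE s in lborel. cmod (a s * b (t - s)) \<le> cmod (a s) * M"
    using M' by eventually_elim (simp add: norm_mult mult_left_mono)
  have i: "integrable lborel (\<lambda>s. cmod (a s) * M)" using a by simp
  have "integrable lborel (\<lambda>s. a s * b (t - s))"
    by (rule Bochner_Integration.integrable_bound[OF i]) (use le in \<open>auto elim: eventually_mono order_trans[OF _ abs_ge_self]\<close>)
  then have "cmod (conv a b t) \<le> (LINT s|lborel. cmod (a s) * M)"
    unfolding conv_flip by (intro order_trans[OF integral_norm_bound] integral_mono_AE i le integrable_norm)
  then show ?thesis by (simp add: l1n_def)
qed

context wh_positive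
begin

lemma wt_vhl2: "0 < \<eta> \<Longrightarrow> vhl2 n u \<Longrightarrow> vhl2 n (\<lambda>i t. wt \<eta> a t * u i t)"
  by (auto simp: vhl2_def hl2_def intro: sqint_wt_mult)

lemma wt_vnorm_le: "0 < \<eta> \<Longrightarrow> vhl2 n u \<Longrightarrow> vnorm n (\<lambda>i t. wt \<eta> a t * u i t) \<le> vnorm n u"
  unfolding vnorm_def by (intro sum_mono sqint_wt_mult vhl2D(2)) auto

definition comm_sum where
  "comm_sum \<eta> = (\<Sum>i<m. \<Sum>j<p. comm_const \<eta> (g i j) + comm_const \<eta> (reflect (g i j)))"

lemma comm_sum_tendsto: "(\<lambda>n. comm_sum (1 / real (Suc n))) \<longlonglongrightarrow> 0"
proof -
  have "(\<lambda>n. comm_sum (1 / real (Suc n))) \<longlonglongrightarrow> (\<Sum>i<m. \<Sum>j<p. 0 + 0)"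
    unfolding comm_sum_def by (intro tendsto_sum tendsto_add comm_const_tendsto g_int rg_int)
  then show ?thesis by simp
qed

text \<open>\<open>T\<close> applied to the weighted function differs from the weighted image by the commutators of its convolutions.\<close>

lemma WH_weighted:
  assumes v: "vhl2 p v" and \<eta>: "0 < \<eta>" and S: "\<And>j c. j < p \<Longrightarrow> l2n (\<lambda>t. wt \<eta> c t * v j t) \<le> S"
  shows "vnorm m (WH (\<lambda>j t. wt \<eta> a t * v j t)) \<le> vnorm m (\<lambda>i t. wt \<eta> a t * WH v i t)
      + (\<Sum>i<m. \<Sum>j<p. comm_const \<eta> (g i j)) * (2 * S)"
proof -
  let ?E = "\<lambda>i j t. conv (g i j) (\<lambda>s. wt \<eta> a s * v j s) t - wt \<eta> a t * conv (g i j) (v j) t"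
  have E: "sqint (?E i j)" "l2n (?E i j) \<le> comm_const \<eta> (g i j) * (2 * S)" if "j < p" for i j
    by (rule conv_commutator[OF g_int g_sqint vhl2D(2)[OF v that] \<eta> S[OF that]])+
  have "l2n (WH (\<lambda>j t. wt \<eta> a t * v j t) i) \<le> l2n (\<lambda>t. wt \<eta> a t * WH v i t) + (\<Sum>j<p. comm_const \<eta> (g i j) * (2 * S))" for i
  proof -
    have "WH (\<lambda>j t. wt \<eta> a t * v j t) i = (\<lambda>t. wt \<eta> a t * WH v i t + (\<Sum>j<p. ?E i j t))"
      unfolding WH_def sum_distrib_left sum.distrib[symmetric] by (intro ext sum.cong refl) (simp add: algebra_simps)
    moreover have "sqint (\<lambda>t. wt \<eta> a t * WH v i t)"
      by (intro sqint_wt_mult \<eta> hl2_sqint WH_hl2 v)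
    ultimately have "l2n (WH (\<lambda>j t. wt \<eta> a t * v j t) i) \<le> l2n (\<lambda>t. wt \<eta> a t * WH v i t) + l2n (\<lambda>t. \<Sum>j<p. ?E i j t)"
      using sqint_add(2) sqint_sum(1)[of "{..<p}" "?E i"] E(1) by simp
    also have "l2n (\<lambda>t. \<Sum>j<p. ?E i j t) \<le> (\<Sum>j<p. l2n (?E i j))"
      using E(1) by (intro sqint_sum(2)) auto
    also have "\<dots> \<le> (\<Sum>j<p. comm_const \<eta> (g i j) * (2 * S))" by (intro sum_mono E) auto
    finally show ?thesis by simp
  qed
  then have "vnorm m (WH (\<lambda>j t. wt \<eta> a t * v j t)) \<le>
     (\<Sum>i<m. l2n (\<lambda>t. wt \<eta> a t * WH v i t) + (\<Sum>j<p. comm_const \<eta> (g i j) * (2 * S)))"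
    unfolding vnorm_def by (intro sum_mono)
  then show ?thesis by (simp only: sum.distrib vnorm_def sum_distrib_right[symmetric])
qed

lemma WHadj_weighted:
  assumes u: "vhl2 m u" and \<eta>: "0 < \<eta>" and S: "\<And>i c. i < m \<Longrightarrow> l2n (\<lambda>t. wt \<eta> c t * u i t) \<le> S"
  shows "vnorm p (\<lambda>j t. WHadj (\<lambda>i t. wt \<eta> a t * u i t) j t - wt \<eta> a t * WHadj u j t)
      \<le> (\<Sum>i<m. \<Sum>j<p. comm_const \<eta> (reflect (g i j))) * (2 * S)"
proof -
  let ?E = "\<lambda>i j t. conv (reflect (g i j)) (\<lambda>s. wt \<eta> a s * u i s) t - wt \<eta> a t * conv (reflect (g i j)) (u i) t"
  have E: "sqint (?E i j)" "l2n (?E i j) \<le> comm_const \<eta> (reflect (g i j)) * (2 * S)" if "i < m" for i j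
    by (rule conv_commutator[OF rg_int rg_sqint vhl2D(2)[OF u that] \<eta> S[OF that]])+
  have "l2n (\<lambda>t. WHadj (\<lambda>i t. wt \<eta> a t * u i t) j t - wt \<eta> a t * WHadj u j t) \<le> (\<Sum>i<m. comm_const \<eta> (reflect (g i j)) * (2 * S))" for j
  proof -
    let ?h = "\<lambda>t. \<Sum>i<m. ?E i j t"
    have eq: "WHadj (\<lambda>i t. wt \<eta> a t * u i t) j t - wt \<eta> a t * WHadj u j t = indicator {0..} t * ?h t" for t
    proof -
      have "(\<Sum>i<m. cnj (D i j) * (wt \<eta> a t * u i t) + conv (reflect (g i j)) (\<lambda>s. wt \<eta> a s * u i s) t)
        = wt \<eta> a t * (\<Sum>i<m. cnj (D i j) * u i t + conv (reflect (g i j)) (u i) t) + ?h t"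
        unfolding sum_distrib_left sum.distrib[symmetric] by (intro sum.cong refl) (simp add: algebra_simps)
      then show ?thesis unfolding WHadj_eq by (simp only:) (simp add: algebra_simps)
    qed
    have h: "sqint ?h" using E(1) by (intro sqint_sum) auto
    then have [measurable]: "?h \<in> borel_measurable borel" by (simp add: sqint_def)
    have m: "(\<lambda>t. indicator {0..} t * ?h t) \<in> borel_measurable borel" by measurable
    have "l2n (\<lambda>t. indicator {0..} t * ?h t) \<le> 1 * l2n ?h"
      by (rule sqint_mono(2)[OF h m]) (simp_all add: indicator_def)
    also have "l2n ?h \<le> (\<Sum>i<m. l2n (?E i j))" using E(1) by (intro sqint_sum(2)) auto
    also have "\<dots> \<le> (\<Sum>i<m. comm_const \<eta> (reflect (g i j)) * (2 * S))" by (intro sum_mono E) auto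
    finally show ?thesis unfolding eq by simp
  qed
  then have "vnorm p (\<lambda>j t. WHadj (\<lambda>i t. wt \<eta> a t * u i t) j t - wt \<eta> a t * WHadj u j t)
     \<le> (\<Sum>j<p. \<Sum>i<m. comm_const \<eta> (reflect (g i j)) * (2 * S))"
    unfolding vnorm_def by (intro sum_mono)
  also have "\<dots> = (\<Sum>i<m. \<Sum>j<p. comm_const \<eta> (reflect (g i j)) * (2 * S))" by (rule sum.swap)
  finally show ?thesis by (simp only: sum_distrib_right)
qed

definition solves where
  "solves u f \<longleftrightarrow> vhl2 m u \<and> vhl2 m f \<and> (\<forall>i<m. AE t in lborel. WHgram u i t = f i t)"

text \<open>The lower bound of the system is applied to the weighted functions. The commutators contribute at most half of the
supremum of the weighted norms, which is finite because \<open>u\<close> and \<open>v\<close> are in \<open>L\<^sup>2\<close>, and can be subtracted. The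
constant does not depend on the centre \<open>a\<close>, since the norm of the weight does not.\<close>

lemma weighted_bound:
  obtains C \<eta> where "0 \<le> C" "0 < \<eta>"
    and "\<And>u f B a. solves u f \<Longrightarrow> \<forall>i<m. \<forall>t. cmod (f i t) \<le> B \<Longrightarrow> 0 \<le> B \<Longrightarrow>
      vnorm m (\<lambda>i t. wt \<eta> a t * u i t) + vnorm p (\<lambda>j t. wt \<eta> a t * WHadj u j t) \<le> C * B"
proof -
  obtain C0 where C0: "0 < C0" and lower: "\<And>u v. vhl2 m u \<Longrightarrow> vhl2 p v \<Longrightarrow>
     vnorm m u + vnorm p v \<le> C0 * (vnorm m (WH v) + vnorm p (\<lambda>j t. WHadj u j t - v j t))"
    by (rule system_lower, rule that)
  \<comment> \<open>With this \<open>\<eta>\<close> the commutators, of norm at most \<open>2 S comm_sum \<eta>\<close>, cost at most \<open>S / 2\<close> after multiplication by \<open>C0\<close>.\<close>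
  have "\<forall>\<^sub>F n in sequentially. comm_sum (1 / real (Suc n)) < 1 / (4 * C0)"
    using C0 by (intro order_tendstoD(2)[OF comm_sum_tendsto]) auto
  then obtain n0 where n0: "comm_sum (1 / real (Suc n0)) < 1 / (4 * C0)"
    unfolding eventually_sequentially by blast
  define \<eta> where "\<eta> = 1 / real (Suc n0)"
  have \<eta>: "0 < \<eta>" by (simp add: \<eta>_def)
  define W where "W = l2n (wt \<eta> 0)"
  define C where "C = 2 * C0 * (real m * W)"
  have C: "0 \<le> C" using C0 by (simp add: C_def W_def)
  show thesis
  proof (rule that[OF C \<eta>])
    fix u f B a
    assume sol: "solves u f" and fB: "\<forall>i<m. \<forall>t. cmod (f i t) \<le> B" and B0: "0 \<le> B"
    have B: "\<And>i t. i < m \<Longrightarrow> cmod (f i t) \<le> B" using fB by blast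
    have u: "vhl2 m u" and f: "vhl2 m f" and ae: "\<And>i. i < m \<Longrightarrow> AE t in lborel. WHgram u i t = f i t"
      using sol by (auto simp: solves_def)
    define v where "v = WHadj u"
    have v: "vhl2 p v" unfolding v_def by (rule WHadj_vhl2[OF u])
    define s where "s = (\<lambda>a. vnorm m (\<lambda>i t. wt \<eta> a t * u i t) + vnorm p (\<lambda>j t. wt \<eta> a t * v j t))"
    define S where "S = (SUP a. s a)"
    have bdd: "bdd_above (range s)"
      by (rule bdd_aboveI[of _ "vnorm m u + vnorm p v"]) (auto simp: s_def intro!: add_mono wt_vnorm_le \<eta> u v)
    have sS: "s a \<le> S" for a unfolding S_def by (rule cSUP_upper[OF _ bdd]) simp
    have S0: "0 \<le> S" using sS[of 0] unfolding s_def by (meson add_nonneg_nonneg order_trans vnorm_nonneg)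
    have uS: "l2n (\<lambda>t. wt \<eta> a t * u i t) \<le> S" if "i < m" for i a
      using l2n_le_vnorm[OF that, of "\<lambda>i t. wt \<eta> a t * u i t"] sS[of a] vnorm_nonneg[of p "\<lambda>j t. wt \<eta> a t * v j t"]
      unfolding s_def by linarith
    have vS: "l2n (\<lambda>t. wt \<eta> a t * v j t) \<le> S" if "j < p" for j a
      using l2n_le_vnorm[OF that, of "\<lambda>i t. wt \<eta> a t * v i t"] sS[of a] vnorm_nonneg[of m "\<lambda>j t. wt \<eta> a t * u j t"]
      unfolding s_def by linarith
    have key: "s a \<le> C / 2 * B + 1 / 2 * S" for a
    proof -
      have fW: "l2n (\<lambda>t. wt \<eta> a t * WH v i t) \<le> B * W" if i: "i < m" for i
      proof -
        have "l2n (\<lambda>t. wt \<eta> a t * WH v i t) = l2n (\<lambda>t. wt \<eta> a t * f i t)"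
        proof (rule l2n_cong_AE(1))
          have [measurable]: "WH v i \<in> borel_measurable borel" "f i \<in> borel_measurable borel"
            using hl2_measurable[OF WH_hl2[OF v]] hl2_measurable[OF vhl2D(1)[OF f i]] by auto
          show "(\<lambda>t. wt \<eta> a t * WH v i t) \<in> borel_measurable borel" "(\<lambda>t. wt \<eta> a t * f i t) \<in> borel_measurable borel"
            by measurable
          show "AE t in lborel. wt \<eta> a t * WH v i t = wt \<eta> a t * f i t"
            using ae[OF i] unfolding WHgram_def v_def by eventually_elim simp
        qed
        also have "\<dots> \<le> B * l2n (wt \<eta> a)"
        proof (rule sqint_mono(2)[OF sqint_wt(1)[OF \<eta>]])
          have [measurable]: "f i \<in> borel_measurable borel" by (rule hl2_measurable[OF vhl2D(1)[OF f i]])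
          show "(\<lambda>t. wt \<eta> a t * f i t) \<in> borel_measurable borel" by measurable
          show "cmod (wt \<eta> a t * f i t) \<le> B * cmod (wt \<eta> a t)" for t
            using mult_left_mono[OF B[OF i], of "cmod (wt \<eta> a t)" t] by (simp add: norm_mult mult.commute)
        qed (rule B0)
        finally show ?thesis by (simp add: W_def sqint_wt(2)[OF \<eta>, of a])
      qed
      have "vnorm m (\<lambda>i t. wt \<eta> a t * WH v i t) \<le> (\<Sum>i<m. B * W)"
        unfolding vnorm_def by (intro sum_mono fW) auto
      then have 1: "vnorm m (WH (\<lambda>j t. wt \<eta> a t * v j t)) \<le> real m * (B * W) + (\<Sum>i<m. \<Sum>j<p. comm_const \<eta> (g i j)) * (2 * S)"
        using WH_weighted[OF v \<eta> vS, of a] by simp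
      have 2: "vnorm p (\<lambda>j t. WHadj (\<lambda>i t. wt \<eta> a t * u i t) j t - wt \<eta> a t * v j t)
        \<le> (\<Sum>i<m. \<Sum>j<p. comm_const \<eta> (reflect (g i j))) * (2 * S)"
        unfolding v_def by (rule WHadj_weighted[OF u \<eta> uS])
      have "s a \<le> C0 * (vnorm m (WH (\<lambda>j t. wt \<eta> a t * v j t)) + vnorm p (\<lambda>j t. WHadj (\<lambda>i t. wt \<eta> a t * u i t) j t - wt \<eta> a t * v j t))"
        unfolding s_def by (intro lower wt_vhl2 \<eta> u v)
      also have "\<dots> \<le> C0 * (real m * (B * W) + comm_sum \<eta> * (2 * S))"
        using 1 2 C0 by (intro mult_left_mono) (simp_all add: comm_sum_def sum.distrib distrib_right)
      also have "\<dots> = C / 2 * B + (C0 * comm_sum \<eta> * 2) * S" by (simp add: C_def algebra_simps)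
      also have "\<dots> \<le> C / 2 * B + 1 / 2 * S"
        using n0 C0 S0 by (intro add_left_mono mult_right_mono) (auto simp: \<eta>_def field_simps)
      finally show ?thesis .
    qed
    have "S \<le> C / 2 * B + 1 / 2 * S" unfolding S_def by (rule cSUP_least) (use key in \<open>auto simp: S_def\<close>)
    then have "S \<le> C * B" by simp
    then show "vnorm m (\<lambda>i t. wt \<eta> a t * u i t) + vnorm p (\<lambda>j t. wt \<eta> a t * WHadj u j t) \<le> C * B"
      using sS[of a] by (simp add: s_def v_def)
  qed
qed

definition D_const where "D_const = (\<Sum>k<m. \<Sum>j<p. cmod (D k j))"

lemma member_le_double_sum:
  fixes f :: "nat \<Rightarrow> nat \<Rightarrow> real"
  assumes "\<And>i j. 0 \<le> f i j" "i < a" "j < b" shows "f i j \<le> (\<Sum>i<a. \<Sum>j<b. f i j)"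
proof -
  have "f i j \<le> (\<Sum>j<b. f i j)" using assms by (intro member_le_sum) auto
  also have "\<dots> \<le> (\<Sum>i<a. \<Sum>j<b. f i j)"
    using assms by (intro member_le_sum[of i "{..<a}" "\<lambda>i. \<Sum>j<b. f i j"] sum_nonneg) auto
  finally show ?thesis .
qed

text \<open>At a point \<open>t\<close> where the equation holds, \<open>D D\<^sup>* u(t)\<close> is \<open>f(t)\<close> minus convolution terms, and \<open>u(t)\<close> is recovered from it by
\<open>D D\<^sup>* \<ge> c\<close>.\<close>

lemma pointwise_bound:
  assumes eq: "\<And>k. k < m \<Longrightarrow> WHgram u k t = f k t" and t: "0 \<le> t"
    and f: "\<And>k. k < m \<Longrightarrow> cmod (f k t) \<le> B"
    and \<alpha>: "\<And>k j. k < m \<Longrightarrow> j < p \<Longrightarrow> cmod (conv (g k j) (WHadj u j) t) \<le> \<alpha>"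
    and \<beta>: "\<And>i j. i < m \<Longrightarrow> j < p \<Longrightarrow> cmod (conv (reflect (g i j)) (u i) t) \<le> \<beta>"
    and i: "i < m"
  shows "cmod (u i t) \<le> real m / c * (real m * (B + real p * \<alpha> + real p * (D_const * (real m * \<beta>))))"
proof -
  let ?X = "\<lambda>j. \<Sum>i<m. cnj (D i j) * u i t"
  let ?Y = "\<lambda>j. \<Sum>i<m. conv (reflect (g i j)) (u i) t"
  have Y: "cmod (?Y j) \<le> real m * \<beta>" if "j < p" for j
    using sum_norm_bound[of "{..<m}" "\<lambda>i. conv (reflect (g i j)) (u i) t" \<beta>] \<beta>[OF _ that] by simp
  have "cmod (\<Sum>j<p. D k j * ?X j) \<le> B + real p * \<alpha> + real p * (D_const * (real m * \<beta>))" if k: "k < m" for k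
  proof -
    have WHadj: "WHadj u j t = ?X j + ?Y j" for j using t by (simp add: WHadj_def sum.distrib)
    have "f k t = (\<Sum>j<p. D k j * WHadj u j t + conv (g k j) (WHadj u j) t)"
      using eq[OF k] by (simp add: WHgram_def WH_def)
    also have "\<dots> = (\<Sum>j<p. D k j * ?X j) + (\<Sum>j<p. D k j * ?Y j) + (\<Sum>j<p. conv (g k j) (WHadj u j) t)"
      by (simp add: WHadj distrib_left sum.distrib)
    finally have "(\<Sum>j<p. D k j * ?X j) = f k t - (\<Sum>j<p. conv (g k j) (WHadj u j) t) - (\<Sum>j<p. D k j * ?Y j)"
      by (simp add: algebra_simps)
    then have "cmod (\<Sum>j<p. D k j * ?X j) \<le> cmod (f k t) + cmod (\<Sum>j<p. conv (g k j) (WHadj u j) t) + cmod (\<Sum>j<p. D k j * ?Y j)"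
    proof -
      have tri: "cmod (a - b - d) \<le> cmod a + cmod b + cmod d" for a b d
        using norm_triangle_ineq4[of "a - b" d] norm_triangle_ineq4[of a b] by linarith
      assume eqn: "(\<Sum>j<p. D k j * ?X j) = f k t - (\<Sum>j<p. conv (g k j) (WHadj u j) t) - (\<Sum>j<p. D k j * ?Y j)"
      show ?thesis unfolding eqn by (rule tri)
    qed
    also have "cmod (f k t) \<le> B" by (rule f[OF k])
    also have "cmod (\<Sum>j<p. conv (g k j) (WHadj u j) t) \<le> real p * \<alpha>"
      using sum_norm_bound[of "{..<p}" "\<lambda>j. conv (g k j) (WHadj u j) t" \<alpha>] \<alpha>[OF k] by simp
    also have "cmod (\<Sum>j<p. D k j * ?Y j) \<le> real p * (D_const * (real m * \<beta>))"
    proof -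
      have "cmod (D k j * ?Y j) \<le> D_const * (real m * \<beta>)" if "j < p" for j
        unfolding norm_mult using Y[OF that] member_le_double_sum[of "\<lambda>k j. cmod (D k j)" k m j p] k that
        by (intro mult_mono) (auto simp: D_const_def intro!: sum_nonneg)
      then show ?thesis using sum_norm_bound[of "{..<p}" "\<lambda>j. D k j * ?Y j" "D_const * (real m * \<beta>)"] by simp
    qed
    finally show ?thesis by simp
  qed
  then have "(\<Sum>k<m. cmod (\<Sum>j<p. D k j * ?X j)) \<le> real m * (B + real p * \<alpha> + real p * (D_const * (real m * \<beta>)))"
    using sum_bounded_above[of "{..<m}" "\<lambda>k. cmod (\<Sum>j<p. D k j * ?X j)"] by simp
  then have "real m / c * (\<Sum>k<m. cmod (\<Sum>j<p. D k j * ?X j)) \<le> real m / c * (real m * (B + real p * \<alpha> + real p * (D_const * (real m * \<beta>))))"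
    using c_pos by (intro mult_left_mono) auto
  moreover have "cmod (u i t) \<le> (\<Sum>i<m. cmod (u i t))" using i by (intro member_le_sum) auto
  ultimately show ?thesis using D_recover[of "\<lambda>i. u i t"] by linarith
qed

definition tail where "tail N = (\<Sum>i<m. \<Sum>j<p. (LINT s|lborel. indicator {s. real N < \<bar>s\<bar>} s * cmod (g i j s))
   + (LINT s|lborel. indicator {s. real N < \<bar>s\<bar>} s * cmod (reflect (g i j) s)))"

lemma tail_sum_tendsto: "tail \<longlonglongrightarrow> 0"
proof -
  have "(\<lambda>N. tail N) \<longlonglongrightarrow> (\<Sum>i<m. \<Sum>j<p. 0 + 0)"
    unfolding tail_def by (intro tendsto_sum tendsto_add tail_tendsto g_int rg_int)
  then show ?thesis by simp
qed

lemma tail_ge: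
  assumes "i < m" "j < p"
  shows "(LINT s|lborel. indicator {s. real N < \<bar>s\<bar>} s * cmod (g i j s)) \<le> tail N"
    "(LINT s|lborel. indicator {s. real N < \<bar>s\<bar>} s * cmod (reflect (g i j) s)) \<le> tail N"
proof -
  let ?f = "\<lambda>i j. (LINT s|lborel. indicator {s. real N < \<bar>s\<bar>} s * cmod (g i j s))"
  let ?h = "\<lambda>i j. (LINT s|lborel. indicator {s. real N < \<bar>s\<bar>} s * cmod (reflect (g i j) s))"
  have nn: "0 \<le> ?f i j" "0 \<le> ?h i j" for i j by (auto intro!: Bochner_Integration.integral_nonneg)
  have "?f i j + ?h i j \<le> tail N"
    unfolding tail_def by (rule member_le_double_sum[OF _ assms]) (intro add_nonneg_nonneg nn)
  then show "?f i j \<le> tail N" "?h i j \<le> tail N" using nn[of i j] by linarith+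
qed

lemma WHadj_sup_bound:
  assumes u: "vhl2 m u" and M: "\<And>i. i < m \<Longrightarrow> AE t in lborel. cmod (u i t) \<le> M" and M0: "0 \<le> M" and j: "j < p"
  shows "AE t in lborel. cmod (WHadj u j t) \<le> WH_const * M"
proof -
  have "AE t in lborel. \<forall>i\<in>{..<m}. cmod (u i t) \<le> M" using M by (intro AE_finite_allI) auto
  then show ?thesis
  proof eventually_elim
    case (elim t)
    have "cmod (WHadj u j t) \<le> cmod (\<Sum>i<m. cnj (D i j) * u i t + conv (reflect (g i j)) (u i) t)"
      by (simp add: WHadj_def)
    also have "\<dots> \<le> (\<Sum>i<m. (cmod (D i j) + l1n (g i j)) * M)"
    proof (rule order_trans[OF norm_sum], rule sum_mono)
      fix i assume i: "i \<in> {..<m}"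
      have "cmod (conv (reflect (g i j)) (u i) t) \<le> l1n (g i j) * M"
        using conv_sup_bound[OF rg_int[of i j] hl2_measurable[OF vhl2D(1)[OF u, of i]] M[of i], of t] i by (simp add: rg_l1n)
      moreover have "cmod (cnj (D i j) * u i t) \<le> cmod (D i j) * M"
        using elim i by (auto simp: norm_mult intro: mult_left_mono)
      ultimately show "cmod (cnj (D i j) * u i t + conv (reflect (g i j)) (u i) t) \<le> (cmod (D i j) + l1n (g i j)) * M"
        unfolding distrib_right by (intro order_trans[OF norm_triangle_ineq] add_mono)
    qed
    also have "\<dots> = (\<Sum>i<m. cmod (D i j) + l1n (g i j)) * M" by (rule sum_distrib_right[symmetric])
    also have "(\<Sum>i<m. cmod (D i j) + l1n (g i j)) \<le> WH_const"
      unfolding WH_const_def using j by (intro sum_mono member_le_sum) auto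
    finally show ?case using M0 by (simp add: mult_right_mono)
  qed
qed

text \<open>A first bound \<open>M0\<close> of \<open>u\<close> depends on \<open>u\<close>; it exists because \<open>g\<close> is in \<open>L\<^sup>2\<close>, which makes every
convolution term bounded. Splitting \<open>g\<close> turns a bound \<open>M\<close> into the bound \<open>C B + M / 2\<close>, and iterating this
removes the dependence on \<open>M0\<close>.\<close>

lemma sup_bound:
  obtains C where "0 \<le> C"
    and "\<And>u f B i. solves u f \<Longrightarrow> \<forall>i<m. \<forall>t. cmod (f i t) \<le> B \<Longrightarrow> 0 \<le> B \<Longrightarrow> i < m \<Longrightarrow>
      AE t in lborel. cmod (u i t) \<le> C * B"
proof -
  obtain C1 \<eta> where C1: "0 \<le> C1" and \<eta>: "0 < \<eta>"
    and wb: "\<And>u f B a. solves u f \<Longrightarrow> \<forall>i<m. \<forall>t. cmod (f i t) \<le> B \<Longrightarrow> 0 \<le> B \<Longrightarrow>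
      vnorm m (\<lambda>i t. wt \<eta> a t * u i t) + vnorm p (\<lambda>j t. wt \<eta> a t * WHadj u j t) \<le> C1 * B"
    by (rule weighted_bound, rule that)
  define L where "L = (\<Sum>k<m. \<Sum>j<p. l2n (g k j))"
  have L: "l2n (g k j) \<le> L" if "k < m" "j < p" for k j
    unfolding L_def by (rule member_le_double_sum[OF _ that]) simp
  have L0: "0 \<le> L" unfolding L_def by (intro sum_nonneg) auto
  have D_const0: "0 \<le> D_const" unfolding D_const_def by (intro sum_nonneg) auto
  \<comment> \<open>\<open>A\<close> is the factor with which the tail of \<open>g\<close> enters in \<open>pointwise_bound\<close>, when \<open>M\<close> bounds \<open>u\<close> and
    \<open>WH_const M\<close> bounds \<open>v\<close>.\<close>
  define A where "A = real m / c * (real m * (real p * WH_const + real p * (D_const * real m)))"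
  have A0: "0 \<le> A" using c_pos WH_const_nonneg D_const0 unfolding A_def by simp
  have "\<forall>\<^sub>F N in sequentially. tail N < 1 / (2 * (A + 1))"
    using A0 by (intro order_tendstoD(2)[OF tail_sum_tendsto]) auto
  then obtain N where N: "tail N < 1 / (2 * (A + 1))"
    unfolding eventually_sequentially by blast
  have tail0: "0 \<le> tail N" unfolding tail_def by (intro sum_nonneg add_nonneg_nonneg Bochner_Integration.integral_nonneg) auto
  have AN: "A * tail N \<le> 1 / 2"
  proof -
    have "A * tail N \<le> (A + 1) * (1 / (2 * (A + 1)))"
      using A0 N tail0 by (intro mult_mono) auto
    also have "\<dots> = 1 / 2" using A0 by (simp add: field_simps)
    finally show ?thesis .
  qed
  define E where "E = exp (\<eta> * real N) * C1"
  have E0: "0 \<le> E" using C1 by (simp add: E_def)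
  define C where "C = real m / c * (real m * (1 + real p * (L * E) + real p * (D_const * (real m * (L * E)))))"
  have C0: "0 \<le> C" using c_pos L0 D_const0 E0 unfolding C_def by simp
  show thesis
  proof (rule that[of "2 * C"])
    show "0 \<le> 2 * C" using C0 by simp
    fix u f B i
    assume sol: "solves u f" and fB: "\<forall>i<m. \<forall>t. cmod (f i t) \<le> B" and B: "0 \<le> B" and i: "i < m"
    have u: "vhl2 m u" and ae: "\<And>i. i < m \<Longrightarrow> AE t in lborel. WHgram u i t = f i t"
      using sol by (auto simp: solves_def)
    have v: "vhl2 p (WHadj u)" by (rule WHadj_vhl2[OF u])
    have ae': "AE t in lborel. \<forall>k\<in>{..<m}. WHgram u k t = f k t" using ae by (intro AE_finite_allI) auto
    have neg: "u k t = 0" if "k < m" "t < 0" for k t using hl2_neg[OF vhl2D(1)[OF u]] that by auto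
    define M0 where "M0 = real m / c * (real m * (B + real p * (L * vnorm p (WHadj u)) + real p * (D_const * (real m * (L * vnorm m u)))))"
    have M0: "0 \<le> M0" unfolding M0_def using c_pos B L0 D_const0 by simp
    have start: "AE t in lborel. \<forall>k\<in>{..<m}. cmod (u k t) \<le> M0"
      using ae'
    proof eventually_elim
      case (elim t)
      show ?case
      proof
        fix k assume k: "k \<in> {..<m}"
        show "cmod (u k t) \<le> M0"
        proof (cases "t < 0")
          case False
          show ?thesis unfolding M0_def
          proof (rule pointwise_bound[where f=f])
            show "cmod (conv (g k j) (WHadj u j) t) \<le> L * vnorm p (WHadj u)" if "k < m" "j < p" for k j
              using that L0 by (intro order_trans[OF conv_bound[OF g_sqint vhl2D(2)[OF v]]] mult_mono L l2n_le_vnorm) auto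
            show "cmod (conv (reflect (g k j)) (u k) t) \<le> L * vnorm m u" if "k < m" "j < p" for k j
              using that L0 L[OF that] by (intro order_trans[OF conv_bound[OF rg_sqint vhl2D(2)[OF u]]] mult_mono l2n_le_vnorm) (auto simp: rg_l2n)
          qed (use elim False fB k in auto)
        qed (use neg k M0 in auto)
      qed
    qed
    have step: "AE t in lborel. \<forall>k\<in>{..<m}. cmod (u k t) \<le> C * B + M / 2"
      if M: "0 \<le> M" "AE t in lborel. \<forall>k\<in>{..<m}. cmod (u k t) \<le> M" for M
    proof -
      have uM: "AE t in lborel. cmod (u k t) \<le> M" if "k < m" for k using M(2) that by auto
      have vM: "AE t in lborel. cmod (WHadj u j t) \<le> WH_const * M" if "j < p" for j
        by (rule WHadj_sup_bound[OF u uM M(1) that])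
      have KM: "0 \<le> WH_const * M" using WH_const_nonneg M by simp
      show ?thesis using ae'
      proof eventually_elim
        case (elim t)
        show ?case
        proof
          fix k assume k: "k \<in> {..<m}"
          show "cmod (u k t) \<le> C * B + M / 2"
          proof (cases "t < 0")
            case False
            have wu: "exp (\<eta> * real N) * l2n (\<lambda>s. wt \<eta> t s * u i s) \<le> E * B" if "i < m" for i
              using l2n_le_vnorm[OF that, of "\<lambda>i s. wt \<eta> t s * u i s"] wb[OF sol fB B, of t]
                vnorm_nonneg[of p "\<lambda>i s. wt \<eta> t s * WHadj u i s"] unfolding E_def mult.assoc by (intro mult_left_mono exp_ge_zero) linarith
            have wv: "exp (\<eta> * real N) * l2n (\<lambda>s. wt \<eta> t s * WHadj u j s) \<le> E * B" if "j < p" for j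
              using l2n_le_vnorm[OF that, of "\<lambda>i s. wt \<eta> t s * WHadj u i s"] wb[OF sol fB B, of t]
                vnorm_nonneg[of m "\<lambda>i s. wt \<eta> t s * u i s"] unfolding E_def mult.assoc by (intro mult_left_mono exp_ge_zero) linarith
            have "cmod (u k t) \<le> real m / c * (real m * (B + real p * (L * (E * B) + tail N * (WH_const * M))
               + real p * (D_const * (real m * (L * (E * B) + tail N * M)))))"
            proof (rule pointwise_bound[where f=f])
              show "cmod (conv (g k j) (WHadj u j) t) \<le> L * (E * B) + tail N * (WH_const * M)" if "k < m" "j < p" for k j
                by (rule order_trans[OF conv_local_bound[OF g_int g_sqint vhl2D(2)[OF v that(2)] \<eta> vM[OF that(2)] KM, where N="real N"]])
                  (intro add_mono mult_mono L wv tail_ge that order_refl; use L0 KM tail0 in simp)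
              show "cmod (conv (reflect (g k j)) (u k) t) \<le> L * (E * B) + tail N * M" if "k < m" "j < p" for k j
                by (rule order_trans[OF conv_local_bound[OF rg_int rg_sqint vhl2D(2)[OF u that(1)] \<eta> uM[OF that(1)] M(1), where N="real N"]], unfold rg_l2n)
                  (intro add_mono mult_mono L wu tail_ge that order_refl; use L0 M tail0 in simp)
            qed (use elim False fB k in auto)
            also have "\<dots> = C * B + (A * tail N) * M" by (simp add: C_def A_def algebra_simps)
            also have "\<dots> \<le> C * B + 1 / 2 * M" using M(1) by (intro add_left_mono mult_right_mono AN)
            finally show ?thesis by simp
          qed (use neg k M C0 B in auto)
        qed
      qed
    qed
    \<comment> \<open>\<open>2 C B\<close> is the fixed point of \<open>M \<mapsto> C B + M / 2\<close>.\<close>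
    have it: "AE t in lborel. \<forall>k\<in>{..<m}. cmod (u k t) \<le> 2 * C * B + M0 * (1 / 2) ^ n" for n
    proof (induction n)
      case 0
      show ?case using start by eventually_elim (use C0 B in \<open>auto intro: order_trans\<close>)
    next
      case (Suc n)
      have "0 \<le> 2 * C * B + M0 * (1 / 2) ^ n" using C0 B M0 by simp
      from step[OF this Suc] show ?case by (simp add: field_simps)
    qed
    then have "AE t in lborel. \<forall>n. \<forall>k\<in>{..<m}. cmod (u k t) \<le> 2 * C * B + M0 * (1 / 2) ^ n"
      by (subst AE_all_countable) blast
    then show "AE t in lborel. cmod (u i t) \<le> 2 * C * B"
    proof eventually_elim
      case (elim t)
      have "(\<lambda>n. 2 * C * B + M0 * (1 / 2) ^ n) \<longlonglongrightarrow> 2 * C * B + M0 * 0"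
        by (intro tendsto_intros LIMSEQ_power_zero) auto
      then have "cmod (u i t) \<le> 2 * C * B + M0 * 0"
        by (rule LIMSEQ_le_const) (use elim i in auto)
      then show ?case by simp
    qed
  qed
qed

text \<open>Duality: let \<open>\<phi>\<close> be the phase of the component \<open>w i0\<close>, cut off at \<open>R\<close>, and let \<open>A u = \<phi>\<close>. Then
\<open>\<integral> |w i0|\<close> over \<open>[0,R]\<close> is the inner product of \<open>w\<close> with \<open>A u\<close>, hence that of \<open>f\<close> with \<open>u\<close>, which is at most
the \<open>L\<^sup>1\<close> norm of \<open>f\<close> times a bound of \<open>u\<close>. By \<open>sup_bound\<close> the latter does not depend on \<open>R\<close>.\<close>

lemma solution_integrable:
  assumes sol: "solves w f" and f: "\<And>i. i < m \<Longrightarrow> integrable lborel (f i)" and i0: "i0 < m"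
  shows "integrable lborel (w i0)"
proof -
  obtain C where C: "0 \<le> C"
    and sb: "\<And>u f B i. solves u f \<Longrightarrow> \<forall>i<m. \<forall>t. cmod (f i t) \<le> B \<Longrightarrow> 0 \<le> B \<Longrightarrow> i < m \<Longrightarrow>
      AE t in lborel. cmod (u i t) \<le> C * B"
    by (rule sup_bound, rule that)
  have w: "vhl2 m w" and vf: "vhl2 m f" and aew: "\<And>i. i < m \<Longrightarrow> AE t in lborel. WHgram w i t = f i t"
    using sol by (auto simp: solves_def)
  have [measurable]: "w i0 \<in> borel_measurable borel" by (rule hl2_measurable[OF vhl2D(1)[OF w i0]])
  define Q where "Q = (\<Sum>k<m. l1n (f k) * C)"
  have Q0: "0 \<le> Q" using C by (auto simp: Q_def intro!: sum_nonneg)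
  have main: "(\<integral>\<^sup>+t. ennreal (indicator {0..real R} t * cmod (w i0 t)) \<partial>lborel) \<le> ennreal Q" for R :: nat
  proof -
    define \<phi> where "\<phi> = (\<lambda>k t. if k = i0 then indicator {0..real R} t * sgn (w i0 t) else 0)"
    have \<phi>1: "cmod (\<phi> k t) \<le> 1" for k t by (simp add: \<phi>_def norm_mult norm_sgn indicator_def)
    have [measurable]: "\<phi> k \<in> borel_measurable borel" for k
      unfolding \<phi>_def sgn_div_norm by (cases "k = i0") auto
    have \<phi>: "vhl2 m \<phi>"
    proof -
      have ie: "integrable lborel (\<lambda>t. indicator {0..real R} t :: real)"
        by (rule integrable_real_indicator) (auto simp: emeasure_lborel_Icc_eq)
      have "integrable lborel (\<lambda>t. (cmod (\<phi> k t))\<^sup>2)" for k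
        by (rule Bochner_Integration.integrable_bound[OF ie])
           (auto simp: \<phi>_def norm_mult norm_sgn indicator_def)
      then show ?thesis by (auto simp: vhl2_def hl2_def sqint_def) (simp add: \<phi>_def)
    qed
    obtain u where u: "vhl2 m u" and aeu: "\<And>i. i < m \<Longrightarrow> AE t in lborel. WHgram u i t = \<phi> i t"
      by (rule solvable[OF \<phi>], rule that)
    have sol': "solves u \<phi>" using u \<phi> aeu by (simp add: solves_def)
    have uC: "AE t in lborel. cmod (u i t) \<le> C" if "i < m" for i
      using sb[OF sol' _ _ that, of 1] \<phi>1 by simp
    note meas = hl2_measurable[OF vhl2D(1)[OF w]] hl2_measurable[OF vhl2D(1)[OF u]]
      hl2_measurable[OF vhl2D(1)[OF vf]] hl2_measurable[OF vhl2D(1)[OF WHgram_vhl2[OF u, of m]]]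
      hl2_measurable[OF vhl2D(1)[OF WHgram_vhl2[OF w, of m]]]
    have "ip (w i0) (\<phi> i0) = (\<Sum>k<m. ip (w k) (\<phi> k))"
    proof -
      have "ip (w k) (\<phi> k) = 0" if "k \<noteq> i0" for k using that by (simp add: ip_def \<phi>_def)
      then show ?thesis using i0 by (subst sum.remove[of _ i0]) (auto intro!: sum.neutral)
    qed
    also have "\<dots> = (\<Sum>k<m. ip (w k) (WHgram u k))"
      using aeu meas by (intro sum.cong refl ip_cong_AE(2)) (auto simp: eq_commute[of "\<phi> _ _"])
    also have "\<dots> = cnj (\<Sum>k<m. ip (WHgram u k) (w k))" by (simp add: ip_cnj)
    also have "\<dots> = cnj (\<Sum>j<p. ip (WHadj u j) (WHadj w j))" by (simp only: WHgram_inner[OF u w])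
    also have "\<dots> = (\<Sum>j<p. ip (WHadj w j) (WHadj u j))" by (simp add: ip_cnj)
    also have "\<dots> = (\<Sum>k<m. ip (WHgram w k) (u k))" by (rule WHgram_inner[OF w u, symmetric])
    also have "\<dots> = (\<Sum>k<m. ip (f k) (u k))"
      using aew meas by (intro sum.cong refl ip_cong_AE(1)) auto
    finally have eq: "ip (w i0) (\<phi> i0) = (\<Sum>k<m. ip (f k) (u k))" .
    have "cmod (ip (f k) (u k)) \<le> l1n (f k) * C" if k: "k < m" for k
    proof -
      have "cmod (ip (f k) (u k)) \<le> (LINT t|lborel. cmod (f k t * cnj (u k t)))"
        unfolding ip_def by (rule integral_norm_bound)
      also have "\<dots> \<le> (LINT t|lborel. cmod (f k t) * C)"
      proof (rule integral_mono_AE)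
        show "integrable lborel (\<lambda>t. cmod (f k t * cnj (u k t)))"
          by (intro integrable_norm ip_integrable vhl2D(2)[OF vf k] vhl2D(2)[OF u k])
        show "integrable lborel (\<lambda>t. cmod (f k t) * C)" using f[OF k] by simp
        show "AE t in lborel. cmod (f k t * cnj (u k t)) \<le> cmod (f k t) * C"
          using uC[OF k] by eventually_elim (simp add: norm_mult mult_left_mono)
      qed
      finally show ?thesis by (simp add: l1n_def)
    qed
    then have "cmod (ip (w i0) (\<phi> i0)) \<le> Q"
      unfolding eq Q_def by (intro order_trans[OF norm_sum] sum_mono) auto
    moreover have "ip (w i0) (\<phi> i0) = complex_of_real (LINT t|lborel. indicator {0..real R} t * cmod (w i0 t))"
    proof -
      have "w i0 t * cnj (\<phi> i0 t) = complex_of_real (indicator {0..real R} t * cmod (w i0 t))" for t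
      proof -
        have "w i0 t * cnj (w i0 t) / complex_of_real (cmod (w i0 t)) = complex_of_real (cmod (w i0 t))"
          by (cases "w i0 t = 0") (simp_all add: complex_norm_square[symmetric] power2_eq_square)
        then show ?thesis by (auto simp: \<phi>_def indicator_def sgn_div_norm scaleR_conv_of_real divide_inverse mult_ac)
      qed
      then show ?thesis unfolding ip_def by (simp only: integral_complex_of_real)
    qed
    ultimately have le: "(LINT t|lborel. indicator {0..real R} t * cmod (w i0 t)) \<le> Q"
      by (simp only: norm_of_real)
    have "integrable lborel (\<lambda>t. w i0 t * cnj (\<phi> i0 t))"
      by (intro ip_integrable vhl2D(2)[OF w i0] vhl2D(2)[OF \<phi> i0])
    then have "integrable lborel (\<lambda>t. cmod (w i0 t * cnj (\<phi> i0 t)))" by simp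
    moreover have "cmod (w i0 t * cnj (\<phi> i0 t)) = indicator {0..real R} t * cmod (w i0 t)" for t
      by (simp add: \<phi>_def norm_mult norm_sgn indicator_def)
    ultimately have "integrable lborel (\<lambda>t. indicator {0..real R} t * cmod (w i0 t))" by simp
    then show ?thesis using le by (subst nn_integral_eq_integral) (auto intro: ennreal_leI)
  qed
  have "(\<integral>\<^sup>+t. ennreal (cmod (w i0 t)) \<partial>lborel)
      = (\<integral>\<^sup>+t. (SUP R::nat. ennreal (indicator {0..real R} t * cmod (w i0 t))) \<partial>lborel)"
  proof (intro nn_integral_cong)
    fix t
    show "ennreal (cmod (w i0 t)) = (SUP R::nat. ennreal (indicator {0..real R} t * cmod (w i0 t)))"
    proof (rule antisym)
      show "(SUP R::nat. ennreal (indicator {0..real R} t * cmod (w i0 t))) \<le> ennreal (cmod (w i0 t))"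
        by (intro SUP_least ennreal_leI) (simp add: indicator_def)
      obtain R :: nat where R: "t \<le> real R" using real_arch_simple by blast
      have "ennreal (cmod (w i0 t)) \<le> ennreal (indicator {0..real R} t * cmod (w i0 t))"
        using R hl2_neg[OF vhl2D(1)[OF w i0], of t] by (cases "t < 0") (auto simp: indicator_def)
      also have "\<dots> \<le> (SUP R::nat. ennreal (indicator {0..real R} t * cmod (w i0 t)))"
        by (rule SUP_upper) simp
      finally show "ennreal (cmod (w i0 t)) \<le> (SUP R::nat. ennreal (indicator {0..real R} t * cmod (w i0 t)))" .
    qed
  qed
  also have "\<dots> = (SUP R::nat. \<integral>\<^sup>+t. ennreal (indicator {0..real R} t * cmod (w i0 t)) \<partial>lborel)"
    by (rule nn_integral_monotone_convergence_SUP)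
       (auto simp: incseq_def le_fun_def indicator_def intro!: ennreal_leI)
  also have "\<dots> \<le> ennreal Q" by (intro SUP_least main)
  finally have "(\<integral>\<^sup>+t. ennreal (cmod (w i0 t)) \<partial>lborel) < \<infinity>" by (rule le_less_trans) simp
  then show ?thesis by (intro integrableI_bounded) auto
qed

lemma WHadj_integrable:
  assumes u: "vhl2 m u" and i: "\<And>i. i < m \<Longrightarrow> integrable lborel (u i)"
  shows "integrable lborel (WHadj u j)"
proof -
  have h: "integrable lborel (\<lambda>t. \<Sum>i<m. cnj (D i j) * u i t + conv (reflect (g i j)) (u i) t)"
    by (intro Bochner_Integration.integrable_sum Bochner_Integration.integrable_add integrable_mult_right conv_L1 rg_int i) auto
  show ?thesis
    by (rule Bochner_Integration.integrable_bound[OF h])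
       (use hl2_measurable[OF WHadj_hl2[OF u]] in \<open>auto simp: WHadj_def\<close>)
qed

end

section \<open>The resolvent of y\<close>

definition lshift :: "real \<Rightarrow> (real \<Rightarrow> complex) \<Rightarrow> real \<Rightarrow> complex" where
  "lshift \<tau> f t = (if t < 0 then 0 else f (t + \<tau>))"

lemma lshift_hl2: assumes "hl2 f" shows "hl2 (lshift \<tau> f)"
proof -
  have s: "sqint (\<lambda>t. f (\<tau> + 1 * t))" by (rule sqint_shift(1)[OF hl2_sqint[OF assms]]) simp
  have [measurable]: "f \<in> borel_measurable borel" by (rule hl2_measurable[OF assms])
  have m: "lshift \<tau> f \<in> borel_measurable borel" unfolding lshift_def by measurable
  have "sqint (lshift \<tau> f)"
    by (rule sqint_mono(1)[OF s m, of 1]) (auto simp: lshift_def add.commute)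
  then show ?thesis by (simp add: hl2_def lshift_def)
qed

text \<open>Associativity of the three-fold product, with the integration over \<open>w\<close> carried out last. It is derived from the
adjoint relation, which already contains the change of the order of integration.\<close>

lemma conv_correlation:
  assumes a: "integrable lborel a" "sqint a" and w: "sqint w" and b: "sqint b"
  shows "conv (conv a (reflect w)) b \<tau> = (LINT s|lborel. cnj (w s) * conv a b (s + \<tau>))"
proof -
  define c where "c = (\<lambda>s. cnj (b (\<tau> - s)))"
  have c: "sqint c" unfolding c_def by (intro sqint_cnj sqint_flip b)
  have "conv (conv a (reflect w)) b \<tau> = (LINT s|lborel. conv a (reflect w) s * cnj (c s))"
    by (simp add: conv_flip[of "conv a (reflect w)"] c_def)
  also have "\<dots> = (LINT s|lborel. reflect w s * cnj (conv (reflect a) c s))"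
    by (rule conv_adjoint[OF a sqint_reflect[OF w] c])
  also have "\<dots> = (LINT s|lborel. reflect w (0 - s) * cnj (conv (reflect a) c (0 - s)))"
    by (rule lborel_integral_flip[symmetric])
  also have "\<dots> = (LINT s|lborel. cnj (w s) * conv a b (s + \<tau>))"
  proof (rule Bochner_Integration.integral_cong[OF refl])
    fix s
    have "conv (reflect a) c (0 - s) = (LINT x|lborel. cnj (a (s + x) * b (\<tau> - x)))"
      unfolding conv_def reflect_def c_def by (simp add: add.commute)
    then have "cnj (conv (reflect a) c (0 - s)) = (LINT x|lborel. a (s + x) * b (\<tau> - x))"
      by (simp only: Bochner_Integration.integral_cnj complex_cnj_cnj)
    also have "\<dots> = (LINT x|lborel. a (s + (\<tau> - x)) * b (\<tau> - (\<tau> - x)))"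
      by (rule lborel_integral_flip[symmetric])
    also have "\<dots> = conv a b (s + \<tau>)" by (simp add: conv_def algebra_simps)
    finally show "reflect w (0 - s) * cnj (conv (reflect a) c (0 - s)) = cnj (w s) * conv a b (s + \<tau>)"
      by (simp add: reflect_def)
  qed
  finally show ?thesis .
qed

lemma conv_sum_left:
  assumes "\<And>i. i \<in> I \<Longrightarrow> sqint (a i)" "sqint b"
  shows "conv (\<lambda>t. \<Sum>i\<in>I. a i t) b t = (\<Sum>i\<in>I. conv (a i) b t)"
  unfolding conv_def sum_distrib_right using assms by (intro Bochner_Integration.integral_sum conv_integrable)

lemma conv_cmult_left: "conv (\<lambda>s. k * a s) b t = k * conv a b t"
  by (simp add: conv_def mult.assoc)

lemma lap_cong_AE:
  assumes [measurable]: "f \<in> borel_measurable borel" "h \<in> borel_measurable borel" and "AE t in lborel. f t = h t"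
  shows "lap s f = lap s h"
  unfolding lap_def by (intro integral_cong_AE) (use assms(3) in auto)

context wh_positive
begin

lemma g_vhl2: "vhl2 n (\<lambda>i. g i l)"
  by (simp add: vhl2_def hl2_def g_sqint g_neg)

text \<open>The row \<open>q(t) = \<integral> w(s)\<^sup>* g(s + t) ds\<close>. On the imaginary axis it is the causal part of \<open>W\<^sup>* G\<close>,
where \<open>W\<close> is the transform of \<open>w\<close>. The value 0 at \<open>t = 0\<close> makes \<open>q * y\<close> at \<open>\<tau>\<close> depend on \<open>y\<close> before
\<open>\<tau>\<close> only, so that the rest of \<open>y\<close> is exactly a left shift.\<close>

definition causal_part :: "(nat \<Rightarrow> real \<Rightarrow> complex) \<Rightarrow> nat \<Rightarrow> real \<Rightarrow> complex" where
  "causal_part w l t = (if t \<le> 0 then 0 else \<Sum>i<m. conv (g i l) (reflect (w i)) t)"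

lemma causal_part_props:
  assumes w: "vhl2 m w" and i: "\<And>i. i < m \<Longrightarrow> integrable lborel (w i)"
  shows "hl2 (causal_part w l)" "integrable lborel (causal_part w l)"
proof -
  let ?h = "\<lambda>t. \<Sum>i<m. conv (g i l) (reflect (w i)) t"
  have s: "sqint ?h" using vhl2D(2)[OF w] by (intro sqint_sum young g_int sqint_reflect) auto
  have ih: "integrable lborel ?h" using i
    by (intro Bochner_Integration.integrable_sum conv_L1 g_int integrable_reflect) auto
  have [measurable]: "?h \<in> borel_measurable borel" using s by (simp add: sqint_def)
  have m: "causal_part w l \<in> borel_measurable borel" unfolding causal_part_def by measurable
  have "sqint (causal_part w l)" by (rule sqint_mono(1)[OF s m, of 1]) (auto simp: causal_part_def)
  then show "hl2 (causal_part w l)" by (simp add: hl2_def causal_part_def)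
  show "integrable lborel (causal_part w l)"
    by (rule Bochner_Integration.integrable_bound[OF ih]) (use m in \<open>auto simp: causal_part_def\<close>)
qed

text \<open>The kernel of \<open>T\<^sup>*\<close> looks to the right only, hence \<open>T\<^sup>*\<close> commutes with left shifts.\<close>

lemma WHadj_lshift:
  assumes u: "vhl2 m u" and \<tau>: "0 \<le> \<tau>"
  shows "lshift \<tau> (WHadj u j) = WHadj (\<lambda>i. lshift \<tau> (u i)) j"
proof
  fix t
  show "lshift \<tau> (WHadj u j) t = WHadj (\<lambda>i. lshift \<tau> (u i)) j t"
  proof (cases "t < 0")
    case False
    have "conv (reflect (g i j)) (u i) (t + \<tau>) = conv (reflect (g i j)) (lshift \<tau> (u i)) t" for i
    proof -
      have "conv (reflect (g i j)) (u i) (t + \<tau>) = (LINT s|lborel. reflect (g i j) (t + \<tau> - (\<tau> + s)) * u i (\<tau> + s))"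
        unfolding conv_def using lborel_integral_real_affine[of 1 "\<lambda>s. reflect (g i j) (t + \<tau> - s) * u i s" \<tau>] by simp
      also have "\<dots> = conv (reflect (g i j)) (lshift \<tau> (u i)) t"
        unfolding conv_def
      proof (rule Bochner_Integration.integral_cong[OF refl])
        fix s
        show "reflect (g i j) (t + \<tau> - (\<tau> + s)) * u i (\<tau> + s) = reflect (g i j) (t - s) * lshift \<tau> (u i) s"
          using False g_neg[of "s - t" i j] by (cases "s < 0") (auto simp: lshift_def reflect_def add.commute)
      qed
      finally show ?thesis .
    qed
    then show ?thesis using False \<tau> by (simp add: lshift_def WHadj_def)
  qed (simp add: lshift_def WHadj_def)
qed

text \<open>Let \<open>T T\<^sup>* w = g\<^sub>k\<close>, \<open>T T\<^sup>* x = g\<^sub>l\<close>, \<open>y = T\<^sup>* x\<close>, and let \<open>S\<close> be the left shift by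
\<open>\<tau>\<close>. Splitting \<open>y\<close> at \<open>\<tau>\<close> in \<open>T y = g\<^sub>l\<close> gives
\<open>(q * y)(\<tau>) = q(\<tau>) - \<langle>T S y, w\<rangle>\<close>. Here
\<open>\<langle>T S y, w\<rangle> = \<langle>S y, T\<^sup>* w\<rangle> = \<langle>T\<^sup>* S x, T\<^sup>* w\<rangle> = \<langle>S x, T T\<^sup>* w\<rangle> = \<langle>S x, g\<^sub>k\<rangle>\<close>,
and the last inner product is the integral part of \<open>(T\<^sup>* x)(\<tau>)\<close>.\<close>

lemma causal_part_identity:
  assumes w: "vhl2 m w" "\<And>i. i < m \<Longrightarrow> integrable lborel (w i)"
    and solk: "solves w (\<lambda>i. g i k)" and soll: "solves x (\<lambda>i. g i l)" and \<tau>: "0 < \<tau>"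
  shows "(\<Sum>r<p. conv (causal_part w r) (WHadj x r) \<tau>) = causal_part w l \<tau> - (WHadj x k \<tau> - (\<Sum>i<m. cnj (D i k) * x i \<tau>))"
proof -
  have x: "vhl2 m x" and aex: "\<And>i. i < m \<Longrightarrow> AE t in lborel. WHgram x i t = g i l t"
    using soll by (auto simp: solves_def)
  have aew: "\<And>i. i < m \<Longrightarrow> AE t in lborel. WHgram w i t = g i k t"
    using solk by (auto simp: solves_def)
  define y where "y = WHadj x"
  have y: "vhl2 p y" unfolding y_def by (rule WHadj_vhl2[OF x])
  have ys: "sqint (y r)" for r unfolding y_def by (rule hl2_sqint[OF WHadj_hl2[OF x]])
  have yneg: "y r t = 0" if "t < 0" for r t using that by (simp add: y_def WHadj_def)
  \<comment> \<open>the part of \<open>y\<close> before \<open>\<tau>\<close>, which is all that enters in \<open>(q * y)(\<tau>)\<close>\<close>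
  define yc where "yc = (\<lambda>r s. if s < \<tau> then y r s else 0)"
  have yc: "sqint (yc r)" for r
  proof (rule sqint_mono(1)[where B=1 and g="y r", OF ys])
    have [measurable]: "y r \<in> borel_measurable borel" using ys by (simp add: sqint_def)
    show "yc r \<in> borel_measurable borel" unfolding yc_def by measurable
  qed (auto simp: yc_def)
  have shy: "hl2 (lshift \<tau> (y r))" for r unfolding y_def by (intro lshift_hl2 WHadj_hl2 x)
  have shyv: "vhl2 p (\<lambda>r. lshift \<tau> (y r))" using shy by (simp add: vhl2_def)
  have wi: "sqint (w i)" if "i < m" for i by (rule vhl2D(2)[OF w(1) that])
  have split: "conv (g i r) (yc r) (s + \<tau>) = conv (g i r) (y r) (s + \<tau>) - conv (g i r) (lshift \<tau> (y r)) s" for i r s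
  proof -
    have "conv (g i r) (lshift \<tau> (y r)) s = (LINT t|lborel. g i r (s - t) * lshift \<tau> (y r) t)"
      by (simp add: conv_def)
    also have "\<dots> = (LINT t|lborel. g i r (s - (- \<tau> + t)) * lshift \<tau> (y r) (- \<tau> + t))"
      using lborel_integral_real_affine[of 1 "\<lambda>t. g i r (s - t) * lshift \<tau> (y r) t" "- \<tau>"] by simp
    also have "\<dots> = conv (g i r) (\<lambda>t. y r t - yc r t) (s + \<tau>)"
      unfolding conv_def
      by (rule Bochner_Integration.integral_cong[OF refl]) (auto simp: lshift_def yc_def algebra_simps)
    finally show ?thesis using conv_diff_right[OF g_sqint[of i r] ys[of r] yc[of r], of "s + \<tau>"] by simp
  qed
  have TTsplit: "AE s in lborel. 0 \<le> s \<longrightarrow> (\<Sum>r<p. conv (g i r) (yc r) (s + \<tau>)) = g i l (s + \<tau>) - WH (\<lambda>r. lshift \<tau> (y r)) i s"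
    if i: "i < m" for i
  proof -
    have [measurable]: "WHgram x i \<in> borel_measurable borel" "g i l \<in> borel_measurable borel"
      using hl2_measurable[OF vhl2D(1)[OF WHgram_vhl2[OF x] i]] g_sqint by (auto simp: sqint_def)
    have "AE s in lborel. WHgram x i (\<tau> + 1 * s) = g i l (\<tau> + 1 * s)"
      by (rule AE_borel_affine[OF _ _ aex[OF i]]) auto
    then show ?thesis
    proof eventually_elim
      case (elim s)
      show ?case
      proof
        assume s: "0 \<le> s"
        have "(\<Sum>r<p. conv (g i r) (yc r) (s + \<tau>)) = WH y i (s + \<tau>) - WH (\<lambda>r. lshift \<tau> (y r)) i s"
          using s by (simp add: WH_def split sum.distrib sum_subtractf lshift_def)
        then show "(\<Sum>r<p. conv (g i r) (yc r) (s + \<tau>)) = g i l (s + \<tau>) - WH (\<lambda>r. lshift \<tau> (y r)) i s"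
          using elim by (simp add: WHgram_def y_def add.commute)
      qed
    qed
  qed
  have corr: "conv (causal_part w r) (y r) \<tau> = (\<Sum>i<m. LINT s|lborel. cnj (w i s) * conv (g i r) (yc r) (s + \<tau>))" for r
  proof -
    have "conv (causal_part w r) (y r) \<tau> = conv (\<lambda>t. \<Sum>i<m. conv (g i r) (reflect (w i)) t) (yc r) \<tau>"
      unfolding conv_def[of "causal_part w r"] conv_def[of "\<lambda>t. \<Sum>i<m. conv (g i r) (reflect (w i)) t"]
      by (rule Bochner_Integration.integral_cong[OF refl]) (auto simp: causal_part_def yc_def)
    also have "\<dots> = (\<Sum>i<m. conv (conv (g i r) (reflect (w i))) (yc r) \<tau>)"
      using wi by (intro conv_sum_left young g_int sqint_reflect yc) auto
    also have "\<dots> = (\<Sum>i<m. LINT s|lborel. cnj (w i s) * conv (g i r) (yc r) (s + \<tau>))"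
      using wi by (intro sum.cong refl conv_correlation g_int g_sqint yc) auto
    finally show ?thesis .
  qed
  have ci: "integrable lborel (\<lambda>s. cnj (w i s) * conv (g i r) (yc r) (s + \<tau>))" if "i < m" for i r
    using sqint_shift(1)[OF young(1)[OF g_int[of i r] yc[of r]], of 1 \<tau>]
    by (intro sqint_prod_integrable sqint_cnj wi that) (simp_all add: add.commute)
  have "(\<Sum>r<p. conv (causal_part w r) (y r) \<tau>) = (\<Sum>i<m. \<Sum>r<p. LINT s|lborel. cnj (w i s) * conv (g i r) (yc r) (s + \<tau>))"
    unfolding corr by (rule sum.swap)
  also have "\<dots> = (\<Sum>i<m. LINT s|lborel. cnj (w i s) * (\<Sum>r<p. conv (g i r) (yc r) (s + \<tau>)))"
    unfolding sum_distrib_left using ci by (intro sum.cong refl Bochner_Integration.integral_sum[symmetric]) auto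
  also have "\<dots> = (\<Sum>i<m. (LINT s|lborel. cnj (w i s) * g i l (s + \<tau>)) - ip (WH (\<lambda>r. lshift \<tau> (y r)) i) (w i))"
  proof (intro sum.cong refl)
    fix i assume "i \<in> {..<m}"
    then have i: "i < m" by simp
    have [measurable]: "w i \<in> borel_measurable borel" using wi[OF i] by (simp add: sqint_def)
    have [measurable]: "g i l \<in> borel_measurable borel" "\<And>r. g i r \<in> borel_measurable borel" "\<And>r. yc r \<in> borel_measurable borel"
      using g_sqint yc by (auto simp: sqint_def)
    have TTs: "sqint (WH (\<lambda>r. lshift \<tau> (y r)) i)" by (rule hl2_sqint[OF WH_hl2[OF shyv]])
    then have [measurable]: "WH (\<lambda>r. lshift \<tau> (y r)) i \<in> borel_measurable borel" by (simp add: sqint_def)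
    have i1: "integrable lborel (\<lambda>s. cnj (w i s) * g i l (s + \<tau>))"
      using sqint_shift(1)[OF g_sqint[of i l], of 1 \<tau>]
      by (intro sqint_prod_integrable sqint_cnj wi i) (simp_all add: add.commute)
    have i2: "integrable lborel (\<lambda>s. cnj (w i s) * WH (\<lambda>r. lshift \<tau> (y r)) i s)"
      by (intro sqint_prod_integrable sqint_cnj wi i TTs)
    have "(LINT s|lborel. cnj (w i s) * (\<Sum>r<p. conv (g i r) (yc r) (s + \<tau>)))
       = (LINT s|lborel. cnj (w i s) * g i l (s + \<tau>) - cnj (w i s) * WH (\<lambda>r. lshift \<tau> (y r)) i s)"
    proof (rule integral_cong_AE)
      show "AE s in lborel. cnj (w i s) * (\<Sum>r<p. conv (g i r) (yc r) (s + \<tau>))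
         = cnj (w i s) * g i l (s + \<tau>) - cnj (w i s) * WH (\<lambda>r. lshift \<tau> (y r)) i s"
        using TTsplit[OF i]
      proof eventually_elim
        case (elim s)
        show ?case
          using elim hl2_neg[OF vhl2D(1)[OF w(1) i], of s] by (cases "s < 0") (auto simp: right_diff_distrib)
      qed
    qed measurable
    also have "\<dots> = (LINT s|lborel. cnj (w i s) * g i l (s + \<tau>)) - ip (WH (\<lambda>r. lshift \<tau> (y r)) i) (w i)"
      using i1 i2 by (simp add: ip_def mult.commute)
    finally show "(LINT s|lborel. cnj (w i s) * (\<Sum>r<p. conv (g i r) (yc r) (s + \<tau>)))
      = (LINT s|lborel. cnj (w i s) * g i l (s + \<tau>)) - ip (WH (\<lambda>r. lshift \<tau> (y r)) i) (w i)" .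
  qed
  also have "\<dots> = (\<Sum>i<m. LINT s|lborel. cnj (w i s) * g i l (s + \<tau>)) - (\<Sum>r<p. ip (lshift \<tau> (y r)) (WHadj w r))"
    by (simp add: sum_subtractf adjoint[OF shyv w(1)])
  also have "(\<Sum>i<m. LINT s|lborel. cnj (w i s) * g i l (s + \<tau>)) = causal_part w l \<tau>"
  proof -
    have "(LINT s|lborel. cnj (w i s) * g i l (s + \<tau>)) = conv (g i l) (reflect (w i)) \<tau>" for i
      unfolding conv_def using lborel_integral_flip[of "\<lambda>s. g i l (\<tau> - s) * reflect (w i) s" 0]
      by (simp add: reflect_def mult.commute add.commute)
    then show ?thesis using \<tau> by (simp add: causal_part_def)
  qed
  also have "(\<Sum>r<p. ip (lshift \<tau> (y r)) (WHadj w r)) = WHadj x k \<tau> - (\<Sum>i<m. cnj (D i k) * x i \<tau>)"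
  proof -
    have shx: "vhl2 m (\<lambda>i. lshift \<tau> (x i))" using x by (auto simp: vhl2_def intro: lshift_hl2)
    have "(\<Sum>r<p. ip (lshift \<tau> (y r)) (WHadj w r)) = (\<Sum>r<p. ip (WHadj (\<lambda>i. lshift \<tau> (x i)) r) (WHadj w r))"
      unfolding y_def using WHadj_lshift[OF x] \<tau> by simp
    also have "\<dots> = (\<Sum>i<m. ip (lshift \<tau> (x i)) (WHgram w i))"
      unfolding WHgram_def by (rule adjoint'[OF WHadj_vhl2[OF w(1)] shx, symmetric])
    also have "\<dots> = (\<Sum>i<m. ip (lshift \<tau> (x i)) (g i k))"
      using aew hl2_measurable[OF vhl2D(1)[OF shx]] hl2_measurable[OF vhl2D(1)[OF WHgram_vhl2[OF w(1), of m]]] g_sqint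
      by (intro sum.cong refl ip_cong_AE(2)) (auto simp: sqint_def)
    also have "\<dots> = (\<Sum>i<m. conv (reflect (g i k)) (x i) \<tau>)"
    proof (intro sum.cong refl)
      fix i
      have "conv (reflect (g i k)) (x i) \<tau> = (LINT s|lborel. reflect (g i k) (\<tau> - (\<tau> + s)) * x i (\<tau> + s))"
        unfolding conv_def using lborel_integral_real_affine[of 1 "\<lambda>s. reflect (g i k) (\<tau> - s) * x i s" \<tau>] by simp
      also have "\<dots> = ip (lshift \<tau> (x i)) (g i k)"
        unfolding ip_def
      proof (rule Bochner_Integration.integral_cong[OF refl])
        fix s
        show "reflect (g i k) (\<tau> - (\<tau> + s)) * x i (\<tau> + s) = lshift \<tau> (x i) s * cnj (g i k s)"
          using g_neg[of s i k] by (auto simp: reflect_def lshift_def add.commute)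
      qed
      finally show "ip (lshift \<tau> (x i)) (g i k) = conv (reflect (g i k)) (x i) \<tau>" by simp
    qed
    also have "\<dots> = WHadj x k \<tau> - (\<Sum>i<m. cnj (D i k) * x i \<tau>)" using \<tau> by (simp add: WHadj_def sum.distrib)
    finally show ?thesis .
  qed
  finally show ?thesis by (simp add: y_def)
qed

lemma lap_G:
  assumes sol: "solves x (\<lambda>i. g i l)" and z: "0 \<le> Re z" and i: "i < m"
  shows "lap z (g i l) = (\<Sum>r<p. (D i r + lap z (g i r)) * lap z (WHadj x r))"
proof -
  have x: "vhl2 m x" using sol by (auto simp: solves_def)
  have xi: "integrable lborel (x i)" if "i < m" for i
    by (rule solution_integrable[OF sol g_int that])
  have yi: "integrable lborel (WHadj x r)" for r by (rule WHadj_integrable[OF x xi])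
  have yneg: "WHadj x r t = 0" if "t < 0" for r t using that by (simp add: WHadj_def)
  have ci: "integrable lborel (conv (g i r) (WHadj x r))" for r by (intro conv_L1 g_int yi)
  have cneg: "conv (g i r) (WHadj x r) t = 0" if "t < 0" for r t using that by (intro conv_causal g_neg yneg)
  have "lap z (g i l) = lap z (WHgram x i)"
    using sol i g_sqint hl2_measurable[OF vhl2D(1)[OF WHgram_vhl2[OF x] i]]
    by (intro lap_cong_AE) (auto simp: sqint_def solves_def eq_commute)
  also have "\<dots> = (\<Sum>r<p. LINT t|lborel. exp (- (z * complex_of_real t)) * (D i r * WHadj x r t + conv (g i r) (WHadj x r) t))"
    unfolding lap_def WHgram_def WH_def sum_distrib_left
  proof (rule Bochner_Integration.integral_sum)
    fix r
    have "integrable lborel (\<lambda>t. D i r * (exp (- (z * complex_of_real t)) * WHadj x r t) + exp (- (z * complex_of_real t)) * conv (g i r) (WHadj x r) t)"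
      by (intro Bochner_Integration.integrable_add integrable_mult_right lap_integrable yi yneg ci cneg z)
    then show "integrable lborel (\<lambda>t. exp (- (z * complex_of_real t)) * (D i r * WHadj x r t + conv (g i r) (WHadj x r) t))"
      by (simp add: distrib_left mult.left_commute)
  qed
  also have "\<dots> = (\<Sum>r<p. (D i r + lap z (g i r)) * lap z (WHadj x r))"
  proof (intro sum.cong refl)
    fix r
    have "(LINT t|lborel. exp (- (z * complex_of_real t)) * (D i r * WHadj x r t + conv (g i r) (WHadj x r) t))
      = (LINT t|lborel. D i r * (exp (- (z * complex_of_real t)) * WHadj x r t) + exp (- (z * complex_of_real t)) * conv (g i r) (WHadj x r) t)"
      by (simp add: distrib_left mult.left_commute)
    also have "\<dots> = D i r * lap z (WHadj x r) + lap z (conv (g i r) (WHadj x r))"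
      using lap_integrable[OF yi[of r] yneg[of _ r] z] lap_integrable[OF ci[of r] cneg[of _ r] z] by (simp add: lap_def)
    finally show "(LINT t|lborel. exp (- (z * complex_of_real t)) * (D i r * WHadj x r t + conv (g i r) (WHadj x r) t))
       = (D i r + lap z (g i r)) * lap z (WHadj x r)"
      by (simp add: lap_conv[OF g_int g_neg yi yneg z] distrib_right)
  qed
  finally show ?thesis .
qed

text \<open>\<open>Dp\<close> stands for \<open>D\<^sup>+\<close> and \<open>P\<close> for \<open>I - D\<^sup>+ D\<close>. In \<open>z * y = D\<^sup>+ (g * y) + P (q * y)\<close> the first product is
\<open>g - D y\<close>, the second is \<open>q - y + D\<^sup>* w\<close>, and \<open>P D\<^sup>* = 0\<close>; the terms in \<open>y\<close> add up to \<open>- y\<close>.\<close>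

lemma resolvent_exists:
  assumes sol: "\<And>l. l < p \<Longrightarrow> solves (\<lambda>i. w i l) (\<lambda>i. g i l)"
    and DP: "\<And>j r. j < p \<Longrightarrow> r < p \<Longrightarrow> (\<Sum>i<m. Dp j i * D i r) + P j r = (if j = r then 1 else 0)"
    and PD: "\<And>j i. j < p \<Longrightarrow> i < m \<Longrightarrow> (\<Sum>k<p. P j k * cnj (D i k)) = 0"
  obtains z where "\<And>j l. j < p \<Longrightarrow> l < p \<Longrightarrow> integrable lborel (z j l)" "\<And>j l t. t < 0 \<Longrightarrow> z j l t = 0"
    "\<And>s j l. 0 \<le> Re s \<Longrightarrow> j < p \<Longrightarrow> l < p \<Longrightarrow>
      lap s (z j l) = lap s (WHadj (\<lambda>i. w i l) j) + (\<Sum>r<p. lap s (z j r) * lap s (WHadj (\<lambda>i. w i l) r))"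
proof -
  define y where "y = (\<lambda>j l. WHadj (\<lambda>i. w i l) j)"
  define q where "q = (\<lambda>k l. causal_part (\<lambda>i. w i k) l)"
  define z where "z = (\<lambda>j l t. (\<Sum>i<m. Dp j i * g i l t) + (\<Sum>k<p. P j k * q k l t))"
  have w: "vhl2 m (\<lambda>i. w i l)" if "l < p" for l using sol[OF that] by (simp add: solves_def)
  have wi: "integrable lborel (w i l)" if "i < m" "l < p" for i l
    using solution_integrable[OF sol[OF that(2)] g_int that(1)] .
  have y: "hl2 (y j l)" "integrable lborel (y j l)" if "l < p" for j l
    unfolding y_def using wi that by (auto intro!: WHadj_hl2 WHadj_integrable w)
  have q: "hl2 (q k l)" "integrable lborel (q k l)" if "k < p" for k l
    unfolding q_def using wi that by (auto intro!: causal_part_props w)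
  have zi: "integrable lborel (z j l)" for j l
    unfolding z_def using q by (intro Bochner_Integration.integrable_add Bochner_Integration.integrable_sum integrable_mult_right g_int) auto
  have zh: "hl2 (z j l)" for j l
    unfolding z_def using q g_vhl2 by (intro hl2_add hl2_sum hl2_cmult) (auto simp: vhl2_def)
  have gs: "hl2 (g i l)" for i l by (simp add: hl2_def g_sqint g_neg)
  have key: "AE t in lborel. z j l t = y j l t + (\<Sum>r<p. conv (z j r) (y r l) t)" if j: "j < p" and l: "l < p" for j l
  proof -
    have "AE t in lborel. \<forall>i\<in>{..<m}. WHgram (\<lambda>i. w i l) i t = g i l t"
      using sol[OF l] by (intro AE_finite_allI) (auto simp: solves_def)
    moreover have "AE t in lborel. t \<noteq> (0::real)" by (rule AE_lborel_singleton)
    ultimately show ?thesis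
    proof eventually_elim
      case (elim t)
      show ?case
      proof (cases "t < 0")
        case True
        then show ?thesis
          using hl2_neg[OF zh] hl2_neg[OF y(1)[OF l]] by (simp add: conv_causal)
      next
        case False
        then have t: "0 < t" using elim by simp
        have yl: "sqint (y r l)" for r by (rule hl2_sqint[OF y(1)[OF l]])
        have "conv (z j r) (y r l) t = (\<Sum>i<m. Dp j i * conv (g i r) (y r l) t) + (\<Sum>k<p. P j k * conv (q k r) (y r l) t)" for r
        proof -
          have "conv (z j r) (y r l) t = conv (y r l) (\<lambda>t. (\<Sum>i<m. Dp j i * g i r t) + (\<Sum>k<p. P j k * q k r t)) t"
            unfolding z_def by (rule conv_commute)
          also have "\<dots> = conv (y r l) (\<lambda>t. \<Sum>i<m. Dp j i * g i r t) t + conv (y r l) (\<lambda>t. \<Sum>k<p. P j k * q k r t) t"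
            using q(1) by (intro conv_add_right yl sqint_sum sqint_cmult g_sqint) (auto dest: hl2_sqint)
          also have "\<dots> = (\<Sum>i<m. conv (\<lambda>t. Dp j i * g i r t) (y r l) t) + (\<Sum>k<p. conv (\<lambda>t. P j k * q k r t) (y r l) t)"
            unfolding conv_commute[of "y r l"] using q(1)
            by (intro arg_cong2[where f="(+)"] conv_sum_left yl sqint_cmult g_sqint) (auto dest: hl2_sqint)
          finally show ?thesis by (simp add: conv_cmult_left)
        qed
        then have "(\<Sum>r<p. conv (z j r) (y r l) t)
           = (\<Sum>r<p. \<Sum>i<m. Dp j i * conv (g i r) (y r l) t) + (\<Sum>r<p. \<Sum>k<p. P j k * conv (q k r) (y r l) t)"
          by (simp add: sum.distrib)
        also have "(\<Sum>r<p. \<Sum>i<m. Dp j i * conv (g i r) (y r l) t) = (\<Sum>i<m. Dp j i * (\<Sum>r<p. conv (g i r) (y r l) t))"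
          by (subst sum.swap) (simp add: sum_distrib_left)
        also have "\<dots> = (\<Sum>i<m. Dp j i * g i l t) - (\<Sum>i<m. Dp j i * (\<Sum>r<p. D i r * y r l t))"
        proof -
          have "(\<Sum>r<p. conv (g i r) (y r l) t) = g i l t - (\<Sum>r<p. D i r * y r l t)" if "i < m" for i
            using elim that by (auto simp: WHgram_def WH_def y_def sum.distrib algebra_simps)
          then show ?thesis by (simp add: right_diff_distrib sum_subtractf)
        qed
        also have "(\<Sum>i<m. Dp j i * (\<Sum>r<p. D i r * y r l t)) = (\<Sum>r<p. (\<Sum>i<m. Dp j i * D i r) * y r l t)"
          unfolding sum_distrib_left sum_distrib_right by (subst sum.swap) (simp add: mult.assoc)
        also have "(\<Sum>r<p. \<Sum>k<p. P j k * conv (q k r) (y r l) t) = (\<Sum>k<p. P j k * (\<Sum>r<p. conv (q k r) (y r l) t))"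
          by (subst sum.swap) (simp add: sum_distrib_left)
        also have "\<dots> = (\<Sum>k<p. P j k * (q k l t - (y k l t - (\<Sum>i<m. cnj (D i k) * w i l t))))"
        proof (intro sum.cong refl)
          fix k assume "k \<in> {..<p}"
          then have k: "k < p" by simp
          have "(\<Sum>r<p. conv (q k r) (y r l) t) = q k l t - (y k l t - (\<Sum>i<m. cnj (D i k) * w i l t))"
            unfolding q_def y_def by (rule causal_part_identity[OF w[OF k] wi[OF _ k] sol[OF k] sol[OF l] t])
          then show "P j k * (\<Sum>r<p. conv (q k r) (y r l) t) = P j k * (q k l t - (y k l t - (\<Sum>i<m. cnj (D i k) * w i l t)))" by simp
        qed
        also have "\<dots> = (\<Sum>k<p. P j k * q k l t) - (\<Sum>k<p. P j k * y k l t) + (\<Sum>k<p. P j k * (\<Sum>i<m. cnj (D i k) * w i l t))"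
          by (simp add: algebra_simps sum.distrib sum_subtractf)
        also have "(\<Sum>k<p. P j k * (\<Sum>i<m. cnj (D i k) * w i l t)) = (\<Sum>i<m. (\<Sum>k<p. P j k * cnj (D i k)) * w i l t)"
          unfolding sum_distrib_left sum_distrib_right by (subst sum.swap) (simp add: mult.assoc)
        also have "\<dots> = 0" using PD[OF j] by simp
        finally have "(\<Sum>r<p. conv (z j r) (y r l) t) = z j l t - ((\<Sum>r<p. (\<Sum>i<m. Dp j i * D i r) * y r l t) + (\<Sum>r<p. P j r * y r l t))"
          by (simp add: z_def algebra_simps)
        also have "(\<Sum>r<p. (\<Sum>i<m. Dp j i * D i r) * y r l t) + (\<Sum>r<p. P j r * y r l t)
           = (\<Sum>r<p. ((\<Sum>i<m. Dp j i * D i r) + P j r) * y r l t)"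
          by (simp add: distrib_right sum.distrib)
        also have "\<dots> = (\<Sum>r<p. (if j = r then 1 else 0) * y r l t)"
          using DP[OF j] by (intro sum.cong refl) simp
        also have "\<dots> = y j l t" using j by (simp add: sum.delta if_distrib[of "\<lambda>x. x * _"] cong: if_cong)
        finally show ?thesis by simp
      qed
    qed
  qed
  have "lap s (z j l) = lap s (y j l) + (\<Sum>r<p. lap s (z j r) * lap s (y r l))"
    if s: "0 \<le> Re s" and j: "j < p" and l: "l < p" for s j l
  proof -
    have ci: "integrable lborel (conv (z j r) (y r l))" for r by (intro conv_L1 zi y l)
    have zneg: "t < 0 \<Longrightarrow> z j r t = 0" for r t by (rule hl2_neg[OF zh])
    have yneg: "t < 0 \<Longrightarrow> y r l t = 0" for r t by (rule hl2_neg[OF y(1)[OF l]])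
    have cneg: "t < 0 \<Longrightarrow> conv (z j r) (y r l) t = 0" for r t by (intro conv_causal zneg yneg)
    have [measurable]: "y r l \<in> borel_measurable borel" "z j r \<in> borel_measurable borel" for r
      using hl2_measurable[OF zh] hl2_measurable[OF y(1)[OF l]] by auto
    have "lap s (z j l) = lap s (\<lambda>t. y j l t + (\<Sum>r<p. conv (z j r) (y r l) t))"
      by (intro lap_cong_AE key j l) measurable
    also have "\<dots> = (LINT t|lborel. exp (- (s * complex_of_real t)) * y j l t + (\<Sum>r<p. exp (- (s * complex_of_real t)) * conv (z j r) (y r l) t))"
      by (simp add: lap_def distrib_left sum_distrib_left)
    also have "\<dots> = lap s (y j l) + (\<Sum>r<p. lap s (conv (z j r) (y r l)))"
      unfolding lap_def
      by (subst Bochner_Integration.integral_add, intro lap_integrable y l yneg s, assumption,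
          intro Bochner_Integration.integrable_sum lap_integrable ci cneg s, assumption,
          subst Bochner_Integration.integral_sum, intro lap_integrable ci cneg s, assumption, rule refl)
    also have "(\<Sum>r<p. lap s (conv (z j r) (y r l))) = (\<Sum>r<p. lap s (z j r) * lap s (y r l))"
      by (intro sum.cong refl lap_conv zi zneg y l yneg s)
    finally show ?thesis .
  qed
  then show ?thesis using that[of z] zi hl2_neg[OF zh] unfolding y_def by blast
qed

end

section \<open>Borel representatives on the half line\<close>

text \<open>Elements of \<open>L\<^sup>q\<close> on the half line are only Lebesgue measurable, while convolutions are handled by Tonelli's theorem
for Borel product measures. This relation connects the two.\<close>

definition borel_rep :: "(real \<Rightarrow> complex) \<Rightarrow> (real \<Rightarrow> complex) \<Rightarrow> bool" where
  "borel_rep f f' \<longleftrightarrow> f' \<in> borel_measurable borel \<and> (\<forall>t<0. f' t = 0) \<and> (AE t in lborel. 0 \<le> t \<longrightarrow> f t = f' t)"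

lemma AE_half_line: "(AE t in half_line. P t) \<longleftrightarrow> (AE t in lborel. 0 \<le> t \<longrightarrow> P t)"
  by (simp add: AE_restrict_space_iff AE_completion_iff)

lemma borel_rep_ext_AE:
  assumes "borel_rep f f'"
  shows "AE t in lebesgue. (if t \<in> {0..} then f t else 0) = f' t"
  using assms unfolding borel_rep_def AE_completion_iff
  by (auto elim!: eventually_mono)

lemma borel_rep_measurable:
  assumes "borel_rep f f'"
  shows "f \<in> borel_measurable half_line" and "(\<lambda>t. if t \<in> {0..} then f t else 0) \<in> borel_measurable lebesgue"
proof -
  have m: "f' \<in> borel_measurable lebesgue" using assms by (auto simp: borel_rep_def intro: measurable_completion)
  show *: "(\<lambda>t. if t \<in> {0..} then f t else 0) \<in> borel_measurable lebesgue"
    by (rule borel_measurable_AE[OF m eventually_mono[OF borel_rep_ext_AE[OF assms] sym]])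
  then show "f \<in> borel_measurable half_line" by (rule borel_measurable_if_D)
qed

lemma borel_rep_integral:
  assumes "borel_rep f f'"
  shows "(LINT t|half_line. f t) = (LINT t|lborel. f' t)"
    and "integrable half_line f \<longleftrightarrow> integrable lborel f'"
proof -
  have b: "f' \<in> borel_measurable borel" using assms by (simp add: borel_rep_def)
  then have m: "f' \<in> borel_measurable lebesgue" by (auto intro: measurable_completion)
  have eq: "(\<lambda>t. scaleR (indicator {0..} t) (f t)) = (\<lambda>t. if t \<in> {0..} then f t else 0)"
    by (auto simp: indicator_def)
  have "(LINT t|half_line. f t) = (LINT t|lebesgue. (if t \<in> {0..} then f t else 0))"
    unfolding eq[symmetric] by (rule integral_restrict_space) simp
  also have "\<dots> = (LINT t|lebesgue. f' t)"
    by (rule integral_cong_AE[OF borel_rep_measurable(2)[OF assms] m borel_rep_ext_AE[OF assms]])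
  also have "\<dots> = (LINT t|lborel. f' t)" by (rule integral_completion) (use b in simp)
  finally show "(LINT t|half_line. f t) = (LINT t|lborel. f' t)" .
  have "integrable half_line f \<longleftrightarrow> integrable lebesgue (\<lambda>t. if t \<in> {0..} then f t else 0)"
    unfolding eq[symmetric] by (rule integrable_restrict_space) simp
  also have "\<dots> \<longleftrightarrow> integrable lebesgue f'"
    by (rule integrable_cong_AE[OF borel_rep_measurable(2)[OF assms] m borel_rep_ext_AE[OF assms]])
  also have "\<dots> \<longleftrightarrow> integrable lborel f'" by (rule integrable_completion) (use b in simp)
  finally show "integrable half_line f \<longleftrightarrow> integrable lborel f'" .
qed

lemma borel_rep_exists:
  assumes "f \<in> borel_measurable half_line"
  obtains f' where "borel_rep f f'"
proof -
  let ?F = "\<lambda>t. if t \<in> {0..} then f t else 0"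
  have F: "?F \<in> borel_measurable lebesgue" by (rule borel_measurable_if_I[OF assms]) simp
  have "(\<lambda>t. Re (?F t)) \<in> borel_measurable lebesgue" "(\<lambda>t. Im (?F t)) \<in> borel_measurable lebesgue"
    by (rule measurable_compose[OF F]; measurable)+
  from this[THEN completion_ex_borel_measurable_real]
  obtain R I where [measurable]: "R \<in> borel_measurable borel" "I \<in> borel_measurable borel"
    and ae: "AE t in lborel. Re (?F t) = R t" "AE t in lborel. Im (?F t) = I t" by auto
  define f' where "f' = (\<lambda>t. indicator {0..} t * (complex_of_real (R t) + \<i> * complex_of_real (I t)))"
  have "f' \<in> borel_measurable borel" unfolding f'_def by measurable
  moreover have "AE t in lborel. 0 \<le> t \<longrightarrow> f t = f' t"
    using ae by eventually_elim (auto simp: f'_def complex_eq_iff)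
  ultimately have "borel_rep f f'" by (simp add: borel_rep_def f'_def)
  then show ?thesis using that by blast
qed

lemma borel_rep_mult: "borel_rep f f' \<Longrightarrow> borel_rep h h' \<Longrightarrow> borel_rep (\<lambda>t. f t * h t) (\<lambda>t. f' t * h' t)"
  by (auto simp: borel_rep_def elim: eventually_elim2)

lemma borel_rep_mult_borel:
  assumes "e \<in> borel_measurable borel" "borel_rep f f'"
  shows "borel_rep (\<lambda>t. e t * f t) (\<lambda>t. e t * f' t)"
  using assms by (auto simp: borel_rep_def elim: eventually_mono)

lemma borel_rep_cnj: "borel_rep f f' \<Longrightarrow> borel_rep (\<lambda>t. cnj (f t)) (\<lambda>t. cnj (f' t))"
  by (auto simp: borel_rep_def elim: eventually_mono)

lemma borel_rep_cong: "borel_rep f f' \<Longrightarrow> (\<And>t. 0 \<le> t \<Longrightarrow> h t = f t) \<Longrightarrow> borel_rep h f'"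
  by (auto simp: borel_rep_def elim: eventually_mono)

lemma borel_rep_trans:
  "borel_rep f f' \<Longrightarrow> h \<in> borel_measurable borel \<Longrightarrow> (\<And>t. t < 0 \<Longrightarrow> h t = 0) \<Longrightarrow> AE t in lborel. f' t = h t \<Longrightarrow> borel_rep f h"
  by (auto simp: borel_rep_def elim: eventually_elim2)

lemma borel_rep_sum:
  assumes "finite I" "\<And>i. i \<in> I \<Longrightarrow> borel_rep (f i) (f' i)"
  shows "borel_rep (\<lambda>t. \<Sum>i\<in>I. f i t) (\<lambda>t. \<Sum>i\<in>I. f' i t)"
proof -
  have "AE t in lborel. \<forall>i\<in>I. 0 \<le> t \<longrightarrow> f i t = f' i t"
    using assms by (intro AE_finite_allI) (auto simp: borel_rep_def)
  then show ?thesis using assms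
    by (auto simp: borel_rep_def intro!: borel_measurable_sum sum.neutral elim!: eventually_mono)
qed

lemma borel_rep_L2_scalar:
  assumes "borel_rep f f'"
  shows "f \<in> L2_scalar \<longleftrightarrow> hl2 f'"
proof -
  have r: "borel_rep (\<lambda>t. complex_of_real ((cmod (f t))\<^sup>2)) (\<lambda>t. complex_of_real ((cmod (f' t))\<^sup>2))"
    using assms by (auto simp: borel_rep_def elim: eventually_mono)
  have "integrable half_line (\<lambda>t. (cmod (f t))\<^sup>2) \<longleftrightarrow> integrable lborel (\<lambda>t. (cmod (f' t))\<^sup>2)"
    using borel_rep_integral(2)[OF r] by (simp only: complex_of_real_integrable_eq)
  then show ?thesis using borel_rep_measurable(1)[OF assms] assms
    by (auto simp: L2_scalar_def hl2_def sqint_def borel_rep_def)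
qed

lemma hl2_is_rep: "hl2 f \<Longrightarrow> borel_rep f f"
  by (simp add: borel_rep_def hl2_def sqint_def)

text \<open>The set where \<open>P\<close> fails need not be a Borel set; it is replaced by a Borel null set that contains it.\<close>

lemma AE_flip:
  assumes "AE s in lborel. P (s :: real)" shows "AE s in lborel. P (t - s)"
proof -
  obtain N where N: "{s \<in> space lborel. \<not> P s} \<subseteq> N" "emeasure lborel N = 0" "N \<in> sets lborel"
    by (rule AE_E[OF assms])
  have "AE s in lborel. s \<notin> N" using N by (intro AE_not_in) (auto simp: null_sets_def)
  then have "AE s in lborel. t + (-1) * s \<notin> N"
    using N(3) by (intro AE_borel_affine) (auto simp: pred_def)
  then show ?thesis by eventually_elim (use N(1) in auto)
qed

subsection \<open>Vector valued functions\<close>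

definition borel_reps :: "nat \<Rightarrow> (real \<Rightarrow> complex vec) \<Rightarrow> (nat \<Rightarrow> real \<Rightarrow> complex) \<Rightarrow> bool" where
  "borel_reps k h h' \<longleftrightarrow> (\<forall>t\<ge>0. h t \<in> carrier_vec k) \<and> (\<forall>i<k. borel_rep (\<lambda>t. h t $ i) (h' i))"

lemma borel_reps_exists:
  assumes "h \<in> L2_vec k"
  obtains h' where "borel_reps k h h'" "vhl2 k h'"
proof -
  have "\<exists>f'. borel_rep (\<lambda>t. h t $ i) f' \<and> hl2 f'" if "i < k" for i
  proof -
    have m: "(\<lambda>t. h t $ i) \<in> L2_scalar" using assms that by (simp add: L2_vec_def)
    then obtain f' where "borel_rep (\<lambda>t. h t $ i) f'" using borel_rep_exists by (auto simp: L2_scalar_def)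
    then show ?thesis using m borel_rep_L2_scalar by blast
  qed
  then obtain h' where "\<And>i. i < k \<Longrightarrow> borel_rep (\<lambda>t. h t $ i) (h' i) \<and> hl2 (h' i)" by metis
  then have "borel_reps k h h'" "vhl2 k h'" using assms by (auto simp: borel_reps_def vhl2_def L2_vec_def)
  then show ?thesis by (rule that)
qed

lemma borel_reps_L2: "borel_reps k h h' \<Longrightarrow> vhl2 k h' \<Longrightarrow> h \<in> L2_vec k"
  using borel_rep_L2_scalar by (auto simp: borel_reps_def vhl2_def L2_vec_def)

lemma borel_reps_vec: "vhl2 k h' \<Longrightarrow> borel_reps k (\<lambda>t. vec k (\<lambda>i. h' i t)) h'"
  by (auto simp: borel_reps_def vhl2_def intro!: borel_rep_cong[OF hl2_is_rep])

lemma L2_inner_rep: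
  assumes f: "borel_reps k f f'" "vhl2 k f'" and h: "borel_reps k h h'" "vhl2 k h'"
  shows "L2_inner f h = (\<Sum>i<k. ip (f' i) (h' i))"
proof -
  have r: "borel_rep (\<lambda>t. \<Sum>i<k. f t $ i * cnj (h t $ i)) (\<lambda>t. \<Sum>i<k. f' i t * cnj (h' i t))"
    using f h by (intro borel_rep_sum borel_rep_mult borel_rep_cnj) (auto simp: borel_reps_def)
  have eq: "f t \<bullet>c h t = (\<Sum>i<k. f t $ i * cnj (h t $ i))" if "0 \<le> t" for t
  proof -
    have "h t \<in> carrier_vec k" using h that by (simp add: borel_reps_def)
    then show ?thesis by (simp add: scalar_prod_def atLeast0LessThan)
  qed
  have "L2_inner f h = (LINT t|lborel. (\<Sum>i<k. f' i t * cnj (h' i t)))"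
    unfolding L2_inner_def by (rule borel_rep_integral(1)[OF borel_rep_cong[OF r eq]])
  also have "\<dots> = (\<Sum>i<k. ip (f' i) (h' i))"
    unfolding ip_def using f h by (intro Bochner_Integration.integral_sum ip_integrable) (auto dest: vhl2D)
  finally show ?thesis .
qed

locale wh_transfer = wh_symbol m p "\<lambda>i j. Dm $$ (i, j)" gr
  for m p :: nat and Dm :: "complex mat" and gr :: "nat \<Rightarrow> nat \<Rightarrow> real \<Rightarrow> complex" +
  fixes gm :: "real \<Rightarrow> complex mat"
  assumes Dm: "Dm \<in> carrier_mat m p" and gm: "\<And>t. 0 \<le> t \<Longrightarrow> gm t \<in> carrier_mat m p"
    and gr: "i < m \<Longrightarrow> j < p \<Longrightarrow> borel_rep (\<lambda>t. gm t $$ (i, j)) (gr i j)"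
begin

abbreviation "Top \<equiv> wiener_hopf Dm gm"
abbreviation "Tad \<equiv> L2_adjoint p Top"

text \<open>The integral equals the convolution of the representatives at every \<open>t\<close>, because reflections preserve null sets; the
exceptional null set comes from the term \<open>D h(t)\<close> alone.\<close>

lemma Top_rep:
  assumes h: "borel_reps p h h'" "vhl2 p h'"
  shows "borel_reps m (Top h) (WH h')"
proof -
  have dims: "dim_row Dm = m" "dim_col Dm = p" using Dm by auto
  have car: "Top h t \<in> carrier_vec m" for t by (simp add: wiener_hopf_def dims carrier_vecI)
  have "borel_rep (\<lambda>t. Top h t $ i) (WH h' i)" if i: "i < m" for i
  proof -
    have z: "AE s in lborel. \<forall>j\<in>{..<p}. zero_extension m p gm s $$ (i, j) = gr i j s"
    proof (intro AE_finite_allI)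
      fix j assume "j \<in> {..<p}"
      then have j: "j < p" by simp
      have "AE s in lborel. 0 \<le> s \<longrightarrow> gm s $$ (i, j) = gr i j s" using gr[OF i j] by (simp add: borel_rep_def)
      then show "AE s in lborel. zero_extension m p gm s $$ (i, j) = gr i j s"
      proof eventually_elim
        case (elim s)
        then show ?case using i j g_neg by (cases "0 \<le> s") (auto simp: zero_extension_def)
      qed
    qed simp
    have H: "AE s in lborel. \<forall>j\<in>{..<p}. 0 \<le> s \<longrightarrow> h s $ j = h' j s"
      using h by (intro AE_finite_allI) (auto simp: borel_reps_def borel_rep_def)
    have zc: "zero_extension m p gm s \<in> carrier_mat m p" for s
      using gm by (auto simp: zero_extension_def)
    have int: "(LINT s|half_line. (zero_extension m p gm (t - s) *\<^sub>v h s) $ i) = (\<Sum>j<p. conv (gr i j) (h' j) t)" for t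
    proof -
      have "borel_rep (\<lambda>s. (zero_extension m p gm (t - s) *\<^sub>v h s) $ i) (\<lambda>s. \<Sum>j<p. gr i j (t - s) * h' j s)"
        unfolding borel_rep_def
      proof (intro conjI allI impI)
        have [measurable]: "gr i j \<in> borel_measurable borel" for j using g_sqint by (auto simp: sqint_def)
        have m: "h' j \<in> borel_measurable borel" if "j < p" for j using hl2_measurable[OF vhl2D(1)[OF h(2) that]] .
        show "(\<lambda>s. \<Sum>j<p. gr i j (t - s) * h' j s) \<in> borel_measurable borel"
          using m by (intro borel_measurable_sum borel_measurable_times) auto
        show "(\<Sum>j<p. gr i j (t - s) * h' j s) = 0" if "s < 0" for s
          using hl2_neg[OF vhl2D(1)[OF h(2)] that] by (intro sum.neutral) auto
        show "AE s in lborel. 0 \<le> s \<longrightarrow> (zero_extension m p gm (t - s) *\<^sub>v h s) $ i = (\<Sum>j<p. gr i j (t - s) * h' j s)"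
          using AE_flip[OF z, of t] H
        proof eventually_elim
          case (elim s)
          show ?case
          proof
            assume s: "0 \<le> s"
            have hs: "h s \<in> carrier_vec p" using h s by (simp add: borel_reps_def)
            have dz: "dim_row (zero_extension m p gm (t - s)) = m" "dim_col (zero_extension m p gm (t - s)) = p"
              using zc[of "t - s"] by auto
            have "(zero_extension m p gm (t - s) *\<^sub>v h s) $ i = (\<Sum>j<p. zero_extension m p gm (t - s) $$ (i, j) * h s $ j)"
              using i hs dz by (simp add: scalar_prod_def atLeast0LessThan)
            also have "\<dots> = (\<Sum>j<p. gr i j (t - s) * h' j s)"
              using elim s by (intro sum.cong refl) auto
            finally show "(zero_extension m p gm (t - s) *\<^sub>v h s) $ i = (\<Sum>j<p. gr i j (t - s) * h' j s)" .
          qed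
        qed
      qed
      from borel_rep_integral(1)[OF this]
      have "(LINT s|half_line. (zero_extension m p gm (t - s) *\<^sub>v h s) $ i) = (LINT s|lborel. (\<Sum>j<p. gr i j (t - s) * h' j s))" .
      also have "\<dots> = (\<Sum>j<p. conv (gr i j) (h' j) t)"
        unfolding conv_def using h by (intro Bochner_Integration.integral_sum conv_integrable g_sqint) (auto dest: vhl2D)
      finally show ?thesis .
    qed
    show ?thesis unfolding borel_rep_def
    proof (intro conjI allI impI)
      show "WH h' i \<in> borel_measurable borel" by (rule hl2_measurable[OF WH_hl2[OF h(2)]])
      show "WH h' i t = 0" if "t < 0" for t by (rule hl2_neg[OF WH_hl2[OF h(2)] that])
      show "AE t in lborel. 0 \<le> t \<longrightarrow> Top h t $ i = WH h' i t"
        using H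
      proof eventually_elim
        case (elim t)
        show ?case
        proof
          assume t: "0 \<le> t"
          have ht: "h t \<in> carrier_vec p" using h t by (simp add: borel_reps_def)
          have "(Dm *\<^sub>v h t) $ i = (\<Sum>j<p. Dm $$ (i, j) * h t $ j)"
            using i ht dims by (simp add: scalar_prod_def atLeast0LessThan)
          also have "\<dots> = (\<Sum>j<p. Dm $$ (i, j) * h' j t)" using elim t by (intro sum.cong refl) auto
          finally show "Top h t $ i = WH h' i t"
            using i by (simp add: wiener_hopf_def dims int WH_def sum.distrib)
        qed
      qed
    qed
  qed
  then show ?thesis using car by (simp add: borel_reps_def)
qed

text \<open>The explicit formula defines an adjoint. The one chosen by \<open>L2_adjoint\<close> agrees with it almost everywhere, as
follows by testing both on their difference.\<close>

lemma Tad_rep: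
  assumes h: "borel_reps m h h'" "vhl2 m h'"
  shows "Tad h \<in> L2_vec p" and "borel_reps p (Tad h) (WHadj h')"
proof -
  let ?Q = "\<lambda>u. u \<in> L2_vec p \<and> (\<forall>f \<in> L2_vec p. L2_inner (Top f) h = L2_inner f u)"
  let ?u0 = "\<lambda>t. vec p (\<lambda>j. WHadj h' j t)"
  have v0: "vhl2 p (WHadj h')" by (rule WHadj_vhl2[OF h(2)])
  have r0: "borel_reps p ?u0 (WHadj h')" by (rule borel_reps_vec[OF v0])
  have "?Q ?u0"
  proof (intro conjI ballI)
    show "?u0 \<in> L2_vec p" by (rule borel_reps_L2[OF r0 v0])
    fix f assume "f \<in> L2_vec p"
    then obtain f' where f: "borel_reps p f f'" "vhl2 p f'" by (rule borel_reps_exists)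
    have "L2_inner (Top f) h = (\<Sum>i<m. ip (WH f' i) (h' i))"
      by (rule L2_inner_rep[OF Top_rep[OF f] WH_vhl2[OF f(2)] h])
    also have "\<dots> = (\<Sum>j<p. ip (f' j) (WHadj h' j))" by (rule adjoint[OF f(2) h(2)])
    also have "\<dots> = L2_inner f ?u0" by (rule L2_inner_rep[OF f r0 v0, symmetric])
    finally show "L2_inner (Top f) h = L2_inner f ?u0" .
  qed
  then have Q: "?Q (Tad h)" unfolding L2_adjoint_def by (rule someI[of ?Q])
  then show "Tad h \<in> L2_vec p" by blast
  then obtain u' where u: "borel_reps p (Tad h) u'" "vhl2 p u'" by (rule borel_reps_exists)
  define e where "e = (\<lambda>j t. u' j t - WHadj h' j t)"
  have e: "vhl2 p e" unfolding e_def by (intro vhl2_diff u v0)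
  have re: "borel_reps p (\<lambda>t. vec p (\<lambda>j. e j t)) e" by (rule borel_reps_vec[OF e])
  have "L2_inner (Top (\<lambda>t. vec p (\<lambda>j. e j t))) h = L2_inner (\<lambda>t. vec p (\<lambda>j. e j t)) (Tad h)"
    using Q borel_reps_L2[OF re e] by blast
  then have "(\<Sum>i<m. ip (WH e i) (h' i)) = (\<Sum>j<p. ip (e j) (u' j))"
    using L2_inner_rep[OF Top_rep[OF re e] WH_vhl2[OF e] h] L2_inner_rep[OF re e u] by simp
  then have "(\<Sum>j<p. ip (e j) (u' j) - ip (e j) (WHadj h' j)) = 0"
    by (simp add: adjoint[OF e h(2)] sum_subtractf)
  moreover have "ip (e j) (u' j) - ip (e j) (WHadj h' j) = complex_of_real ((l2n (e j))\<^sup>2)" if "j < p" for j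
  proof -
    have "ip (e j) (u' j) - ip (e j) (WHadj h' j) = ip (e j) (e j)"
      using ip_integrable[OF vhl2D(2)[OF e that] vhl2D(2)[OF u(2) that]]
        ip_integrable[OF vhl2D(2)[OF e that] vhl2D(2)[OF v0 that]]
      unfolding ip_def by (subst Bochner_Integration.integral_diff[symmetric]) (simp_all add: e_def right_diff_distrib)
    then show ?thesis by (simp only: ip_self)
  qed
  ultimately have "complex_of_real (\<Sum>j<p. (l2n (e j))\<^sup>2) = 0" by simp
  then have "(\<Sum>j<p. (l2n (e j))\<^sup>2) = 0" by (simp only: of_real_eq_0_iff)
  then have "l2n (e j) = 0" if "j < p" for j using that by (simp add: sum_nonneg_eq_0_iff)
  then have ae: "AE t in lborel. u' j t = WHadj h' j t" if "j < p" for j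
    using l2n_zero_AE[OF vhl2D(2)[OF e that]] that by (simp add: e_def)
  have "borel_rep (\<lambda>t. Tad h t $ j) (WHadj h' j)" if j: "j < p" for j
    by (rule borel_rep_trans[OF _ _ _ ae[OF j]])
       (use u j hl2_measurable[OF vhl2D(1)[OF v0 j]] hl2_neg[OF vhl2D(1)[OF v0 j]] in \<open>auto simp: borel_reps_def\<close>)
  then show "borel_reps p (Tad h) (WHadj h')" using u by (simp add: borel_reps_def)
qed

lemma Top_Tad_rep:
  assumes h: "borel_reps m h h'" "vhl2 m h'"
  shows "borel_reps m ((Top \<circ> Tad) h) (WH (WHadj h'))"
  using Top_rep[OF Tad_rep(2)[OF h] WHadj_vhl2[OF h(2)]] by simp

lemma positive_transfer:
  assumes "strictly_positive m (Top \<circ> Tad)"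
  obtains c where "0 < c" "\<And>h. vhl2 m h \<Longrightarrow> c * (\<Sum>i<m. (l2n (h i))\<^sup>2) \<le> (\<Sum>j<p. (l2n (WHadj h j))\<^sup>2)"
proof -
  obtain c where c: "0 < c" and pos: "\<And>h. h \<in> L2_vec m \<Longrightarrow>
      complex_of_real c * L2_inner h h \<le> L2_inner ((Top \<circ> Tad) h) h"
    using assms unfolding strictly_positive_def by blast
  show thesis
  proof (rule that[OF c])
    fix h' assume h': "vhl2 m h'"
    let ?h = "\<lambda>t. vec m (\<lambda>i. h' i t)"
    have r: "borel_reps m ?h h'" by (rule borel_reps_vec[OF h'])
    have v: "vhl2 m (WH (WHadj h'))" by (intro WH_vhl2 WHadj_vhl2 h')
    have "Re (complex_of_real c * L2_inner ?h ?h) \<le> Re (L2_inner ((Top \<circ> Tad) ?h) ?h)"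
      using pos[OF borel_reps_L2[OF r h']] by (simp add: less_eq_complex_def)
    also have "L2_inner ((Top \<circ> Tad) ?h) ?h = (\<Sum>i<m. ip (WH (WHadj h') i) (h' i))"
      by (rule L2_inner_rep[OF Top_Tad_rep[OF r h'] v r h'])
    also have "\<dots> = (\<Sum>j<p. ip (WHadj h' j) (WHadj h' j))" by (rule adjoint[OF WHadj_vhl2[OF h'] h'])
    also have "\<dots> = complex_of_real (\<Sum>j<p. (l2n (WHadj h' j))\<^sup>2)" by (simp only: ip_self of_real_sum)
    also have "L2_inner ?h ?h = (\<Sum>i<m. ip (h' i) (h' i))" by (rule L2_inner_rep[OF r h' r h'])
    also have "\<dots> = complex_of_real (\<Sum>i<m. (l2n (h' i))\<^sup>2)" by (simp only: ip_self of_real_sum)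
    finally show "c * (\<Sum>i<m. (l2n (h' i))\<^sup>2) \<le> (\<Sum>j<p. (l2n (WHadj h' j))\<^sup>2)"
      by (simp only: of_real_mult[symmetric] Re_complex_of_real)
  qed
qed

end

locale wh_transfer_positive = wh_transfer m p Dm gr gm + wh_positive m p "\<lambda>i j. Dm $$ (i, j)" gr c
  for m p Dm gr gm c
begin

text \<open>The preimage chosen by \<open>L2_inverse\<close> solves the equation because one exists, by \<open>solvable\<close>.\<close>

lemma inverse_rep:
  assumes v: "borel_reps m v v'" "vhl2 m v'"
  obtains w' where "borel_reps m (L2_inverse m (Top \<circ> Tad) v) w'" "solves w' v'"
proof -
  let ?Q = "\<lambda>w. w \<in> L2_vec m \<and> (AE t in half_line. (Top \<circ> Tad) w t = v t)"
  have iff: "(AE t in half_line. (Top \<circ> Tad) w t = v t) \<longleftrightarrow> (\<forall>i<m. AE t in lborel. WHgram w' i t = v' i t)"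
    if w: "borel_reps m w w'" "vhl2 m w'" for w w'
  proof -
    have r: "borel_reps m ((Top \<circ> Tad) w) (WHgram w')" unfolding WHgram_def by (rule Top_Tad_rep[OF w])
    have eqv: "(Top \<circ> Tad) w t = v t \<longleftrightarrow> (\<forall>i\<in>{..<m}. (Top \<circ> Tad) w t $ i = v t $ i)" if "0 \<le> t" for t
      using r v that unfolding borel_reps_def by (auto intro!: eq_vecI)
    have "AE t in lborel. \<forall>i\<in>{..<m}. 0 \<le> t \<longrightarrow> (Top \<circ> Tad) w t $ i = WHgram w' i t"
      using r by (intro AE_finite_allI) (auto simp: borel_reps_def borel_rep_def)
    moreover have "AE t in lborel. \<forall>i\<in>{..<m}. 0 \<le> t \<longrightarrow> v t $ i = v' i t"
      using v by (intro AE_finite_allI) (auto simp: borel_reps_def borel_rep_def)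
    ultimately have ae: "AE t in lborel. (0 \<le> t \<longrightarrow> (Top \<circ> Tad) w t = v t) \<longleftrightarrow> (\<forall>i\<in>{..<m}. WHgram w' i t = v' i t)"
    proof eventually_elim
      case (elim t)
      show ?case
      proof (cases "0 \<le> t")
        case True
        then show ?thesis using elim eqv[OF True] by auto
      next
        case False
        then show ?thesis
          using hl2_neg[OF vhl2D(1)[OF v(2)]] hl2_neg[OF vhl2D(1)[OF WHgram_vhl2[OF w(2), of m]]] by auto
      qed
    qed
    have "(AE t in half_line. (Top \<circ> Tad) w t = v t) \<longleftrightarrow> (AE t in lborel. \<forall>i\<in>{..<m}. WHgram w' i t = v' i t)"
      unfolding AE_half_line by (rule eventually_subst[OF ae])
    also have "\<dots> \<longleftrightarrow> (\<forall>i<m. AE t in lborel. WHgram w' i t = v' i t)"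
      by (subst AE_finite_all) auto
    finally show ?thesis .
  qed
  obtain w0 where w0: "vhl2 m w0" "\<And>i. i < m \<Longrightarrow> AE t in lborel. WHgram w0 i t = v' i t"
    by (rule solvable[OF v(2)], rule that)
  have r0: "borel_reps m (\<lambda>t. vec m (\<lambda>i. w0 i t)) w0" by (rule borel_reps_vec[OF w0(1)])
  have "?Q (\<lambda>t. vec m (\<lambda>i. w0 i t))" using iff[OF r0 w0(1)] w0(2) borel_reps_L2[OF r0 w0(1)] by blast
  then have Q: "?Q (L2_inverse m (Top \<circ> Tad) v)" unfolding L2_inverse_def by (rule someI[of ?Q])
  then obtain w' where w': "borel_reps m (L2_inverse m (Top \<circ> Tad) v) w'" "vhl2 m w'"
    using borel_reps_exists by blast
  have "solves w' v'" using iff[OF w'] Q w'(2) v(2) unfolding solves_def by blast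
  then show ?thesis using that w'(1) by blast
qed

lemma y_rep:
  assumes y: "y = columnwise p p (Tad \<circ> L2_inverse m (Top \<circ> Tad)) gm"
  obtains w where "\<And>l. l < p \<Longrightarrow> solves (\<lambda>i. w i l) (\<lambda>i. gr i l)"
    "\<And>j l. j < p \<Longrightarrow> l < p \<Longrightarrow> borel_rep (\<lambda>t. y t $$ (j, l)) (WHadj (\<lambda>i. w i l) j)"
proof -
  have "\<exists>w'. solves w' (\<lambda>i. gr i l) \<and> borel_reps m (L2_inverse m (Top \<circ> Tad) (\<lambda>\<tau>. col (gm \<tau>) l)) w'" if l: "l < p" for l
  proof -
    have "borel_reps m (\<lambda>\<tau>. col (gm \<tau>) l) (\<lambda>i. gr i l)"
      unfolding borel_reps_def
    proof (intro conjI allI impI)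
      show "col (gm t) l \<in> carrier_vec m" if "0 \<le> t" for t using gm[OF that] by (simp add: carrier_vecI)
      fix i assume i: "i < m"
      show "borel_rep (\<lambda>t. col (gm t) l $ i) (gr i l)"
      proof (rule borel_rep_cong[OF gr[OF i l]])
        fix t :: real assume "0 \<le> t"
        then have "dim_row (gm t) = m" "dim_col (gm t) = p" using gm by auto
        then show "col (gm t) l $ i = gm t $$ (i, l)" using i l by simp
      qed
    qed
    then show ?thesis using inverse_rep[OF _ g_vhl2] by metis
  qed
  then obtain w' where w': "\<And>l. l < p \<Longrightarrow> solves (w' l) (\<lambda>i. gr i l)"
     "\<And>l. l < p \<Longrightarrow> borel_reps m (L2_inverse m (Top \<circ> Tad) (\<lambda>\<tau>. col (gm \<tau>) l)) (w' l)" by metis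
  have "borel_rep (\<lambda>t. y t $$ (j, l)) (WHadj (w' l) j)" if "j < p" "l < p" for j l
  proof -
    have "borel_reps p (Tad (L2_inverse m (Top \<circ> Tad) (\<lambda>\<tau>. col (gm \<tau>) l))) (WHadj (w' l))"
      by (rule Tad_rep(2)[OF w'(2)[OF that(2)]]) (use w'(1)[OF that(2)] in \<open>simp add: solves_def\<close>)
    moreover have "y t $$ (j, l) = Tad (L2_inverse m (Top \<circ> Tad) (\<lambda>\<tau>. col (gm \<tau>) l)) t $ j" for t
      using that by (simp add: y columnwise_def mat_of_cols_index)
    ultimately show ?thesis using that by (simp add: borel_reps_def)
  qed
  then show ?thesis using that[of "\<lambda>i l. w' l i"] w'(1) by simp
qed

end

lemma laplace_rep:
  assumes "i < k" "j < r" "borel_rep (\<lambda>t. f t $$ (i, j)) f'"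
  shows "laplace k r f s $$ (i, j) = lap s f'"
proof -
  have "borel_rep (\<lambda>t. exp (- (s * complex_of_real t)) * f t $$ (i, j)) (\<lambda>t. exp (- (s * complex_of_real t)) * f' t)"
    by (rule borel_rep_mult_borel[OF _ assms(3)]) measurable
  then show ?thesis using assms(1,2) by (simp add: laplace_def lap_def borel_rep_integral(1))
qed

section \<open>Matrices\<close>

lemma mat_mult_entry:
  fixes A B :: "complex mat"
  assumes "A \<in> carrier_mat n k" "B \<in> carrier_mat k l" "i < n" "j < l"
  shows "(A * B) $$ (i, j) = (\<Sum>r<k. A $$ (i, r) * B $$ (r, j))"
  using assms by (simp add: scalar_prod_def atLeast0LessThan)

lemma mat_adjoint_carrier: "A \<in> carrier_mat n k \<Longrightarrow> mat_adjoint (A :: complex mat) \<in> carrier_mat k n"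
  by (auto simp: mat_adjoint_def)

lemma mat_adjoint_entry:
  "A \<in> carrier_mat n k \<Longrightarrow> i < k \<Longrightarrow> j < n \<Longrightarrow> mat_adjoint (A :: complex mat) $$ (i, j) = cnj (A $$ (j, i))"
  by (auto simp: mat_adjoint_def mat_of_rows_index)

lemma append_rows_entry:
  assumes "A \<in> carrier_mat k r" "B \<in> carrier_mat l r" "i < k + l" "j < r"
  shows "(A @\<^sub>r B) $$ (i, j) = (if i < k then A $$ (i, j) else B $$ (i - k, j))"
  using assms by (auto simp: append_rows_def)

lemma append_cols_entry:
  assumes "A \<in> carrier_mat r k" "B \<in> carrier_mat r l" "i < r" "j < k + l"
  shows "(A @\<^sub>c B) $$ (i, j) = (if j < k then A $$ (i, j) else B $$ (i, j - k))"
  using assms by (auto simp: append_cols_def)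

lemma append_cols_carrier:
  "A \<in> carrier_mat r k \<Longrightarrow> B \<in> carrier_mat r l \<Longrightarrow> A @\<^sub>c B \<in> carrier_mat r (k + l)"
  by (auto simp: append_cols_def)

lemma append_rows_mult:
  fixes A B C :: "complex mat"
  assumes "A \<in> carrier_mat k r" "B \<in> carrier_mat l r" "C \<in> carrier_mat r n"
  shows "(A @\<^sub>r B) * C = (A * C) @\<^sub>r (B * C)"
proof (rule eq_matI)
  have c: "A @\<^sub>r B \<in> carrier_mat (k + l) r" "(A * C) @\<^sub>r (B * C) \<in> carrier_mat (k + l) n"
    using assms by auto
  show "dim_row ((A @\<^sub>r B) * C) = dim_row ((A * C) @\<^sub>r (B * C))"
    "dim_col ((A @\<^sub>r B) * C) = dim_col ((A * C) @\<^sub>r (B * C))"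
    using carrier_matD[OF c(1)] carrier_matD[OF c(2)] carrier_matD[OF assms(3)] by simp_all
  fix i j assume "i < dim_row ((A * C) @\<^sub>r (B * C))" "j < dim_col ((A * C) @\<^sub>r (B * C))"
  then have ij: "i < k + l" "j < n" using c by auto
  have AC: "A * C \<in> carrier_mat k n" "B * C \<in> carrier_mat l n" using assms by auto
  show "((A @\<^sub>r B) * C) $$ (i, j) = ((A * C) @\<^sub>r (B * C)) $$ (i, j)"
    unfolding append_rows_entry[OF AC ij] mat_mult_entry[OF c(1) assms(3) ij]
    using ij mat_mult_entry[OF assms(1,3) _ ij(2), of i] mat_mult_entry[OF assms(2,3) _ ij(2), of "i - k"]
    by (cases "i < k") (auto simp: append_rows_entry[OF assms(1,2)] intro!: sum.cong)
qed

lemma append_cols_mult: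
  fixes A B C :: "complex mat"
  assumes "A \<in> carrier_mat r k" "B \<in> carrier_mat r l" "C \<in> carrier_mat n r"
  shows "C * (A @\<^sub>c B) = (C * A) @\<^sub>c (C * B)"
proof (rule eq_matI)
  have c: "A @\<^sub>c B \<in> carrier_mat r (k + l)" "(C * A) @\<^sub>c (C * B) \<in> carrier_mat n (k + l)"
    using assms by (auto intro!: append_cols_carrier)
  show "dim_row (C * (A @\<^sub>c B)) = dim_row ((C * A) @\<^sub>c (C * B))"
    "dim_col (C * (A @\<^sub>c B)) = dim_col ((C * A) @\<^sub>c (C * B))"
    using carrier_matD[OF c(1)] carrier_matD[OF c(2)] carrier_matD[OF assms(3)] by simp_all
  fix i j assume "i < dim_row ((C * A) @\<^sub>c (C * B))" "j < dim_col ((C * A) @\<^sub>c (C * B))"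
  then have ij: "i < n" "j < k + l" using c by auto
  have CA: "C * A \<in> carrier_mat n k" "C * B \<in> carrier_mat n l" using assms by auto
  show "(C * (A @\<^sub>c B)) $$ (i, j) = ((C * A) @\<^sub>c (C * B)) $$ (i, j)"
    unfolding append_cols_entry[OF CA ij] mat_mult_entry[OF assms(3) c(1) ij]
    using ij mat_mult_entry[OF assms(3,1) ij(1), of j] mat_mult_entry[OF assms(3,2) ij(1), of "j - k"]
    by (cases "j < k") (auto simp: append_cols_entry[OF assms(1,2)] intro!: sum.cong)
qed

lemma rows_times_cols_one:
  fixes A B C E :: "complex mat"
  assumes c: "A \<in> carrier_mat k r" "B \<in> carrier_mat l r" "C \<in> carrier_mat r k" "E \<in> carrier_mat r l"
    and "A * C = 1\<^sub>m k" "A * E = 0\<^sub>m k l" "B * C = 0\<^sub>m l k" "B * E = 1\<^sub>m l"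
  shows "(A @\<^sub>r B) * (C @\<^sub>c E) = 1\<^sub>m (k + l)"
proof -
  have "(A @\<^sub>r B) * (C @\<^sub>c E) = ((A * C) @\<^sub>c (A * E)) @\<^sub>r ((B * C) @\<^sub>c (B * E))"
    by (simp only: append_rows_mult[OF c(1,2) append_cols_carrier[OF c(3,4)]]
        append_cols_mult[OF c(3,4,1)] append_cols_mult[OF c(3,4,2)])
  also have "\<dots> = (1\<^sub>m k @\<^sub>c 0\<^sub>m k l) @\<^sub>r (0\<^sub>m l k @\<^sub>c 1\<^sub>m l)" by (simp only: assms)
  also have "\<dots> = 1\<^sub>m (k + l)"
    by (rule eq_matI) (auto simp: append_rows_def append_cols_def)
  finally show ?thesis .
qed

lemma minv_det_nonzero:
  assumes A: "A \<in> carrier_mat n n" and d: "det A \<noteq> 0"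
  shows "minv A \<in> carrier_mat n n" "A * minv A = 1\<^sub>m n" "minv A * A = 1\<^sub>m n"
proof -
  have "A \<in> Units (ring_mat TYPE(complex) n ())" by (rule det_non_zero_imp_unit[OF A d])
  then obtain B where B: "mat_inverse A = Some B"
    using mat_inverse(1)[OF A, of "()"] by (cases "mat_inverse A") auto
  then show "minv A \<in> carrier_mat n n" "A * minv A = 1\<^sub>m n" "minv A * A = 1\<^sub>m n"
    using mat_inverse(2)[OF A B] by auto
qed

lemma minv_unique:
  assumes A: "A \<in> carrier_mat n n" and B: "B \<in> carrier_mat n n" and BA: "B * A = 1\<^sub>m n"
  shows "det A \<noteq> 0" "minv A = B" "invertible_mat A"
proof -
  have "det B * det A = 1" using det_mult[OF B A] BA by simp
  then show d: "det A \<noteq> 0" by auto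
  note m = minv_det_nonzero[OF A d]
  have "minv A = (B * A) * minv A" using m(1) BA by simp
  also have "\<dots> = B * (A * minv A)" by (rule assoc_mult_mat[OF B A m(1)])
  finally show "minv A = B" using m(2) B by simp
  then have "A * B = 1\<^sub>m n" using m(2) by simp
  then show "invertible_mat A"
    using A B BA unfolding invertible_mat_def inverts_mat_def by auto
qed

text \<open>Polarization: the norms of the images of \<open>e\<^sub>a + \<zeta> e\<^sub>b\<close> for \<open>\<zeta> = 1\<close> and \<open>\<zeta> = \<i>\<close> determine the real
and imaginary part of the entry \<open>(a, b)\<close> of \<open>E\<^sup>* E\<close>.\<close>

lemma isometry_mat_adjoint:
  assumes E: "E \<in> carrier_mat p n" and iso: "isometry_mat E"
  shows "mat_adjoint E * E = 1\<^sub>m n"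
proof -
  have sq: "(vec_norm v)\<^sup>2 = (\<Sum>i<dim_vec v. (cmod (v $ i))\<^sup>2)" for v
    by (simp add: vec_norm_def L2_set_def sum_nonneg)
  have norm: "(\<Sum>i<p. (cmod (\<Sum>j<n. E $$ (i, j) * x j))\<^sup>2) = (\<Sum>j<n. (cmod (x j))\<^sup>2)" for x
  proof -
    have v: "vec n x \<in> carrier_vec (dim_col E)" using E by simp
    have "(vec_norm (E *\<^sub>v vec n x))\<^sup>2 = (vec_norm (vec n x))\<^sup>2"
      using iso v unfolding isometry_mat_def by simp
    moreover have "(E *\<^sub>v vec n x) $ i = (\<Sum>j<n. E $$ (i, j) * x j)" if "i < p" for i
      using E that by (simp add: scalar_prod_def atLeast0LessThan)
    ultimately show ?thesis using E by (simp add: sq)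
  qed
  let ?S = "\<lambda>a b. \<Sum>i<p. cnj (E $$ (i, a)) * E $$ (i, b)"
  have diag: "?S a a = 1" if a: "a < n" for a
  proof -
    have e: "(\<Sum>j<n. E $$ (i, j) * (if j = a then 1 else 0)) = E $$ (i, a)" for i
      using a by (simp add: if_distrib[of "\<lambda>x. _ * x"] sum.delta cong: if_cong)
    have f: "(\<Sum>j<n. (cmod (if j = a then 1 else 0))\<^sup>2) = 1"
      using a by (simp add: if_distrib[of cmod] if_distrib[of "\<lambda>x. x\<^sup>2"] sum.delta cong: if_cong)
    have "(\<Sum>i<p. (cmod (E $$ (i, a)))\<^sup>2) = 1" using norm[of "\<lambda>j. if j = a then 1 else 0"] unfolding e f .
    then have "complex_of_real (\<Sum>i<p. (cmod (E $$ (i, a)))\<^sup>2) = 1" by simp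
    moreover have "complex_of_real (\<Sum>i<p. (cmod (E $$ (i, a)))\<^sup>2) = ?S a a"
      unfolding of_real_sum by (intro sum.cong refl trans[OF complex_norm_square mult.commute])
    ultimately show ?thesis by simp
  qed
  have off: "?S a b = 0" if a: "a < n" and b: "b < n" and ab: "a \<noteq> b" for a b
  proof -
    have R: "Re (\<zeta> * ?S a b) = 0" if z: "cmod \<zeta> = 1" for \<zeta>
    proof -
      let ?x = "\<lambda>j. if j = a then 1 else if j = b then \<zeta> else 0"
      have e: "(\<Sum>j<n. E $$ (i, j) * ?x j) = E $$ (i, a) + \<zeta> * E $$ (i, b)" for i
      proof -
        have "(\<Sum>j<n. E $$ (i, j) * ?x j) = (\<Sum>j<n. (if j = a then E $$ (i, j) else 0) + (if j = b then \<zeta> * E $$ (i, j) else 0))"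
          using ab by (intro sum.cong refl) auto
        then show ?thesis using a b by (simp add: sum.distrib sum.delta)
      qed
      have f: "(\<Sum>j<n. (cmod (?x j))\<^sup>2) = 2"
      proof -
        have "(\<Sum>j<n. (cmod (?x j))\<^sup>2) = (\<Sum>j<n. (if j = a then 1 else 0) + (if j = b then 1 else 0))"
          using ab z by (intro sum.cong refl) auto
        then show ?thesis using a b by (simp add: sum.distrib sum.delta)
      qed
      have ex: "(cmod (E $$ (i, a) + \<zeta> * E $$ (i, b)))\<^sup>2
        = Re (cnj (E $$ (i, a)) * E $$ (i, a)) + Re (cnj (E $$ (i, b)) * E $$ (i, b)) + 2 * Re (\<zeta> * (cnj (E $$ (i, a)) * E $$ (i, b)))" for i
      proof -
        have "(cmod (\<zeta> * E $$ (i, b)))\<^sup>2 = (cmod (E $$ (i, b)))\<^sup>2" using z by (simp add: norm_mult)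
        then have "(Re (\<zeta> * E $$ (i, b)))\<^sup>2 + (Im (\<zeta> * E $$ (i, b)))\<^sup>2 = Re (cnj (E $$ (i, b)) * E $$ (i, b))"
          unfolding cmod_power2 by (simp add: power2_eq_square)
        then show ?thesis unfolding cmod_power2 by (simp add: power2_eq_square algebra_simps)
      qed
      have "2 = Re (?S a a) + Re (?S b b) + 2 * Re (\<zeta> * ?S a b)"
        using norm[of ?x] unfolding e f ex by (simp add: sum.distrib sum_distrib_left Re_sum)
      then show ?thesis using diag[OF a] diag[OF b] by simp
    qed
    show ?thesis using R[of 1] R[of \<i>] by (simp add: complex_eq_iff)
  qed
  show ?thesis
  proof (rule eq_matI)
    fix a b assume "a < dim_row (1\<^sub>m n :: complex mat)" "b < dim_col (1\<^sub>m n :: complex mat)"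
    then have ab: "a < n" "b < n" by auto
    have "(mat_adjoint E * E) $$ (a, b) = ?S a b"
      unfolding mat_mult_entry[OF mat_adjoint_carrier[OF E] E ab]
      by (intro sum.cong refl) (simp add: mat_adjoint_entry[OF E ab(1)])
    then show "(mat_adjoint E * E) $$ (a, b) = 1\<^sub>m n $$ (a, b)" using diag off ab by auto
  qed (use E mat_adjoint_carrier[OF E] in auto)
qed

section \<open>The Wiener algebra\<close>

lemma exp_mult_integrable:
  assumes "integrable half_line f" "0 \<le> Re s"
  shows "integrable half_line (\<lambda>t. exp (- (s * complex_of_real t)) * f t)"
proof (rule Bochner_Integration.integrable_bound[OF assms(1)])
  have "(\<lambda>t. exp (- (s * complex_of_real t))) \<in> borel_measurable half_line"
    by (intro measurable_restrict_space1 measurable_completion) measurable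
  then show "(\<lambda>t. exp (- (s * complex_of_real t)) * f t) \<in> borel_measurable half_line"
    using assms(1) by (intro borel_measurable_times) auto
  show "AE t in half_line. norm (exp (- (s * complex_of_real t)) * f t) \<le> norm (f t)"
    unfolding AE_half_line using assms(2)
    by (intro AE_I2) (auto simp: norm_mult norm_exp_eq_Re intro!: mult_left_le_one_le)
qed

text \<open>Membership in the matrix Wiener algebra is a condition on the entries, which reduces its closure properties to
linear combinations of scalar functions.\<close>

definition wiener_scalar :: "(complex \<Rightarrow> complex) set" where
  "wiener_scalar = {\<phi>. \<exists>d f. integrable half_line f \<and>
     (\<forall>s. 0 \<le> Re s \<longrightarrow> \<phi> s = d + (LINT t|half_line. exp (- (s * complex_of_real t)) * f t))}"

lemma wiener_scalarI:
  assumes "integrable half_line f"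
    "\<And>s. 0 \<le> Re s \<Longrightarrow> \<phi> s = d + (LINT t|half_line. exp (- (s * complex_of_real t)) * f t)"
  shows "\<phi> \<in> wiener_scalar"
  using assms unfolding wiener_scalar_def by blast

lemma wiener_scalar_cong:
  "\<phi> \<in> wiener_scalar \<Longrightarrow> (\<And>s. 0 \<le> Re s \<Longrightarrow> \<psi> s = \<phi> s) \<Longrightarrow> \<psi> \<in> wiener_scalar"
  unfolding wiener_scalar_def by auto

lemma wiener_scalar_combination:
  assumes "\<And>a. a < k \<Longrightarrow> \<phi> a \<in> wiener_scalar"
  shows "(\<lambda>s. \<Sum>a<k. c a * \<phi> a s) \<in> wiener_scalar"
proof -
  obtain d f where f: "\<And>a. a < k \<Longrightarrow> integrable half_line (f a)"
    and eq: "\<And>a s. a < k \<Longrightarrow> 0 \<le> Re s \<Longrightarrow>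
      \<phi> a s = d a + (LINT t|half_line. exp (- (s * complex_of_real t)) * f a t)"
    using assms unfolding wiener_scalar_def mem_Collect_eq by metis
  show ?thesis
  proof (rule wiener_scalarI)
    show "integrable half_line (\<lambda>t. \<Sum>a<k. c a * f a t)"
      using f by (intro Bochner_Integration.integrable_sum integrable_mult_right) auto
    fix s :: complex assume s: "0 \<le> Re s"
    have "(LINT t|half_line. exp (- (s * complex_of_real t)) * (\<Sum>a<k. c a * f a t))
      = (LINT t|half_line. (\<Sum>a<k. c a * (exp (- (s * complex_of_real t)) * f a t)))"
      by (simp add: sum_distrib_left mult.left_commute)
    also have "\<dots> = (\<Sum>a<k. LINT t|half_line. c a * (exp (- (s * complex_of_real t)) * f a t))"
      using exp_mult_integrable[OF f s] by (intro Bochner_Integration.integral_sum integrable_mult_right) auto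
    finally show "(\<Sum>a<k. c a * \<phi> a s) = (\<Sum>a<k. c a * d a)
        + (LINT t|half_line. exp (- (s * complex_of_real t)) * (\<Sum>a<k. c a * f a t))"
      by (simp add: eq s distrib_left sum.distrib)
  qed
qed

lemma laplace_carrier: "laplace k r f s \<in> carrier_mat k r"
  by (simp add: laplace_def)

lemma wiener_plus_entries:
  "F \<in> wiener_plus k r \<longleftrightarrow> (\<forall>s. 0 \<le> Re s \<longrightarrow> F s \<in> carrier_mat k r) \<and>
     (\<forall>i<k. \<forall>j<r. (\<lambda>s. F s $$ (i, j)) \<in> wiener_scalar)" (is "_ \<longleftrightarrow> ?R")
proof
  assume "F \<in> wiener_plus k r"
  then obtain C f where C: "C \<in> carrier_mat k r" and f: "f \<in> L1_mat k r"
    and eq: "\<And>s. 0 \<le> Re s \<Longrightarrow> F s = C + laplace k r f s" by (auto simp: wiener_plus_def)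
  show ?R
  proof (intro conjI allI impI)
    show "F s \<in> carrier_mat k r" if "0 \<le> Re s" for s using C eq[OF that] laplace_carrier by simp
    fix i j assume ij: "i < k" "j < r"
    show "(\<lambda>s. F s $$ (i, j)) \<in> wiener_scalar"
      by (rule wiener_scalarI[of "\<lambda>t. f t $$ (i, j)" _ "C $$ (i, j)"])
         (use C f ij in \<open>auto simp: eq laplace_def L1_mat_def\<close>)
  qed
next
  assume R: ?R
  then have "\<forall>i j. \<exists>d f. i < k \<longrightarrow> j < r \<longrightarrow> integrable half_line f \<and>
     (\<forall>s. 0 \<le> Re s \<longrightarrow> F s $$ (i, j) = d + (LINT t|half_line. exp (- (s * complex_of_real t)) * f t))"
    unfolding wiener_scalar_def by blast
  then obtain d f where df: "\<forall>i j. i < k \<longrightarrow> j < r \<longrightarrow> integrable half_line (f i j) \<and>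
     (\<forall>s. 0 \<le> Re s \<longrightarrow> F s $$ (i, j) = d i j + (LINT t|half_line. exp (- (s * complex_of_real t)) * f i j t))"
    unfolding choice_iff by blast
  then have f: "\<And>i j. i < k \<Longrightarrow> j < r \<Longrightarrow> integrable half_line (f i j)"
    and eq: "\<And>i j s. i < k \<Longrightarrow> j < r \<Longrightarrow> 0 \<le> Re s \<Longrightarrow>
      F s $$ (i, j) = d i j + (LINT t|half_line. exp (- (s * complex_of_real t)) * f i j t)" by auto
  let ?f = "\<lambda>t. mat k r (\<lambda>(i, j). f i j t)"
  have "?f \<in> L1_mat k r" using f by (simp add: L1_mat_def)
  moreover have "F s = mat k r (\<lambda>(i, j). d i j) + laplace k r ?f s" if s: "0 \<le> Re s" for s
    using R s by (intro eq_matI) (auto simp: eq laplace_def)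
  ultimately show "F \<in> wiener_plus k r"
    unfolding wiener_plus_def by (intro CollectI bexI[of _ "mat k r (\<lambda>(i, j). d i j)"] bexI[of _ ?f]) auto
qed

lemma wiener_plusI:
  assumes "C \<in> carrier_mat k r" "f \<in> L1_mat k r" "\<And>s. 0 \<le> Re s \<Longrightarrow> F s = C + laplace k r f s"
  shows "F \<in> wiener_plus k r"
  using assms unfolding wiener_plus_def by auto

lemma wiener_plus_carrier: "F \<in> wiener_plus k r \<Longrightarrow> 0 \<le> Re s \<Longrightarrow> F s \<in> carrier_mat k r"
  by (simp add: wiener_plus_entries)

lemma wiener_plus_cong:
  "F \<in> wiener_plus k r \<Longrightarrow> (\<And>s. 0 \<le> Re s \<Longrightarrow> H s = F s) \<Longrightarrow> H \<in> wiener_plus k r"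
  unfolding wiener_plus_def by auto

lemma wiener_plus_mult_left:
  assumes F: "F \<in> wiener_plus k r" and C: "C \<in> carrier_mat l k"
  shows "(\<lambda>s. C * F s) \<in> wiener_plus l r"
  unfolding wiener_plus_entries
proof (intro conjI allI impI)
  fix i j assume ij: "i < l" "j < r"
  have "(\<lambda>s. \<Sum>a<k. C $$ (i, a) * F s $$ (a, j)) \<in> wiener_scalar"
    using F ij by (intro wiener_scalar_combination) (simp add: wiener_plus_entries)
  then show "(\<lambda>s. (C * F s) $$ (i, j)) \<in> wiener_scalar"
    by (rule wiener_scalar_cong) (rule mat_mult_entry[OF C wiener_plus_carrier[OF F] ij])
qed (rule mult_carrier_mat[OF C wiener_plus_carrier[OF F]])

lemma wiener_plus_mult_right:
  assumes F: "F \<in> wiener_plus k r" and C: "C \<in> carrier_mat r l"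
  shows "(\<lambda>s. F s * C) \<in> wiener_plus k l"
  unfolding wiener_plus_entries
proof (intro conjI allI impI)
  fix i j assume ij: "i < k" "j < l"
  have "(\<lambda>s. \<Sum>a<r. C $$ (a, j) * F s $$ (i, a)) \<in> wiener_scalar"
    using F ij by (intro wiener_scalar_combination) (simp add: wiener_plus_entries)
  then show "(\<lambda>s. (F s * C) $$ (i, j)) \<in> wiener_scalar"
    by (rule wiener_scalar_cong)
       (simp only: mat_mult_entry[OF wiener_plus_carrier[OF F] C ij] mult.commute)
qed (rule mult_carrier_mat[OF wiener_plus_carrier[OF F] C])

lemma wiener_plus_append_rows:
  assumes F: "F \<in> wiener_plus k r" and H: "H \<in> wiener_plus l r"
  shows "(\<lambda>s. F s @\<^sub>r H s) \<in> wiener_plus (k + l) r"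
  unfolding wiener_plus_entries
proof (intro conjI allI impI)
  fix i j assume ij: "i < k + l" "j < r"
  note entry = append_rows_entry[OF wiener_plus_carrier[OF F] wiener_plus_carrier[OF H] ij]
  show "(\<lambda>s. (F s @\<^sub>r H s) $$ (i, j)) \<in> wiener_scalar"
  proof (cases "i < k")
    case True
    then have "(\<lambda>s. F s $$ (i, j)) \<in> wiener_scalar" using F ij by (simp add: wiener_plus_entries)
    then show ?thesis by (rule wiener_scalar_cong) (simp add: entry True)
  next
    case False
    then have "(\<lambda>s. H s $$ (i - k, j)) \<in> wiener_scalar" using H ij by (simp add: wiener_plus_entries)
    then show ?thesis by (rule wiener_scalar_cong) (simp add: entry False)
  qed
qed (rule carrier_append_rows[OF wiener_plus_carrier[OF F] wiener_plus_carrier[OF H]])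

section \<open>The inverse matrix functions\<close>

lemma (in wh_transfer_positive) D_adjoint_det: "det (Dm * mat_adjoint Dm) \<noteq> 0"
proof
  assume "det (Dm * mat_adjoint Dm) = 0"
  moreover have c: "Dm * mat_adjoint Dm \<in> carrier_mat m m" using Dm mat_adjoint_carrier[OF Dm] by auto
  ultimately obtain v where v: "v \<in> carrier_vec m" "v \<noteq> 0\<^sub>v m" "(Dm * mat_adjoint Dm) *\<^sub>v v = 0\<^sub>v m"
    using det_0_iff_vec_prod_zero by blast
  have zero: "(\<Sum>j<p. Dm $$ (k, j) * (\<Sum>i<m. cnj (Dm $$ (i, j)) * v $ i)) = 0" if k: "k < m" for k
  proof -
    have "0 = ((Dm * mat_adjoint Dm) *\<^sub>v v) $ k" using v k by simp
    also have "((Dm * mat_adjoint Dm) *\<^sub>v v) $ k = (\<Sum>i<m. (Dm * mat_adjoint Dm) $$ (k, i) * v $ i)"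
      using carrier_matD[OF c] v(1) k by (simp add: scalar_prod_def atLeast0LessThan del: index_mult_mat assoc_mult_mat_vec)
    also have "\<dots> = (\<Sum>i<m. (\<Sum>j<p. Dm $$ (k, j) * cnj (Dm $$ (i, j))) * v $ i)"
    proof (intro sum.cong refl)
      fix i assume "i \<in> {..<m}"
      then have i: "i < m" by simp
      have "(Dm * mat_adjoint Dm) $$ (k, i) = (\<Sum>j<p. Dm $$ (k, j) * cnj (Dm $$ (i, j)))"
        unfolding mat_mult_entry[OF Dm mat_adjoint_carrier[OF Dm] k i]
        by (intro sum.cong refl) (simp add: mat_adjoint_entry[OF Dm _ i])
      then show "(Dm * mat_adjoint Dm) $$ (k, i) * v $ i = (\<Sum>j<p. Dm $$ (k, j) * cnj (Dm $$ (i, j))) * v $ i" by simp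
    qed
    also have "\<dots> = (\<Sum>j<p. Dm $$ (k, j) * (\<Sum>i<m. cnj (Dm $$ (i, j)) * v $ i))"
      unfolding sum_distrib_left sum_distrib_right by (subst sum.swap) (simp add: mult.assoc)
    finally show ?thesis by simp
  qed
  have "(\<Sum>i<m. cmod (v $ i)) \<le> real m / c * (\<Sum>k<m. cmod (\<Sum>j<p. Dm $$ (k, j) * (\<Sum>i<m. cnj (Dm $$ (i, j)) * v $ i)))"
    by (rule D_recover)
  also have "\<dots> = 0" using zero by simp
  finally have "(\<Sum>i<m. cmod (v $ i)) = 0" by (simp add: sum_nonneg antisym)
  then have "v $ i = 0" if "i < m" for i using that by (simp add: sum_nonneg_eq_0_iff)
  then have "v = 0\<^sub>v m" using v(1) by (intro eq_vecI) auto
  then show False using v(2) by simp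
qed

text \<open>The two convolution equations \<open>z = y + z * y\<close> and \<open>g = D y + g * y\<close> after the Laplace transform.\<close>

lemma (in wh_transfer_positive) Y_core:
  assumes y: "y = columnwise p p (Tad \<circ> L2_inverse m (Top \<circ> Tad)) gm"
  obtains z where "z \<in> L1_mat p p" "y \<in> L1_mat p p"
    "\<And>s. 0 \<le> Re s \<Longrightarrow> (1\<^sub>m p + laplace p p z s) * (1\<^sub>m p - laplace p p y s) = 1\<^sub>m p"
    "\<And>s. 0 \<le> Re s \<Longrightarrow> (Dm + laplace m p gm s) * (1\<^sub>m p - laplace p p y s) = Dm"
proof -
  obtain w where w: "\<And>l. l < p \<Longrightarrow> solves (\<lambda>i. w i l) (\<lambda>i. gr i l)"
    and yr: "\<And>j l. j < p \<Longrightarrow> l < p \<Longrightarrow> borel_rep (\<lambda>t. y t $$ (j, l)) (WHadj (\<lambda>i. w i l) j)"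
    by (rule y_rep[OF y], rule that)
  define R where "R = minv (Dm * mat_adjoint Dm)"
  have Da: "mat_adjoint Dm \<in> carrier_mat p m" by (rule mat_adjoint_carrier[OF Dm])
  have DDc: "Dm * mat_adjoint Dm \<in> carrier_mat m m" using Dm Da by auto
  note R = minv_det_nonzero[OF DDc D_adjoint_det, folded R_def]
  define Dp where "Dp = mat_adjoint Dm * R"
  have Dp: "Dp \<in> carrier_mat p m" using Da R by (auto simp: Dp_def)
  define P where "P = 1\<^sub>m p - Dp * Dm"
  have P: "P \<in> carrier_mat p p" using Dp Dm by (auto simp: P_def)
  have DP: "(\<Sum>i<m. Dp $$ (j, i) * Dm $$ (i, r)) + P $$ (j, r) = (if j = r then 1 else 0)" if "j < p" "r < p" for j r
  proof -
    have "P $$ (j, r) = 1\<^sub>m p $$ (j, r) - (Dp * Dm) $$ (j, r)"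
      unfolding P_def using that Dp Dm by (simp del: index_mult_mat(1))
    then show ?thesis using that by (simp add: mat_mult_entry[OF Dp Dm] del: index_mult_mat(1))
  qed
  have "P * mat_adjoint Dm = 1\<^sub>m p * mat_adjoint Dm - (Dp * Dm) * mat_adjoint Dm"
    unfolding P_def using Dp Dm Da by (intro minus_mult_distrib_mat) auto
  also have "(Dp * Dm) * mat_adjoint Dm = Dp * (Dm * mat_adjoint Dm)" using Dp Dm Da by simp
  also have "\<dots> = mat_adjoint Dm * (R * (Dm * mat_adjoint Dm))"
    unfolding Dp_def by (rule assoc_mult_mat[OF Da R(1) DDc])
  also have "\<dots> = mat_adjoint Dm" using R(3) Da by simp
  also have "1\<^sub>m p * mat_adjoint Dm - mat_adjoint Dm = 0\<^sub>m p m" using Da by simp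
  finally have PDm: "P * mat_adjoint Dm = 0\<^sub>m p m" .
  have PD: "(\<Sum>k<p. P $$ (j, k) * cnj (Dm $$ (i, k))) = 0" if "j < p" "i < m" for j i
  proof -
    have "(\<Sum>k<p. P $$ (j, k) * cnj (Dm $$ (i, k))) = (P * mat_adjoint Dm) $$ (j, i)"
      unfolding mat_mult_entry[OF P Da that]
      by (intro sum.cong refl) (simp add: mat_adjoint_entry[OF Dm _ that(2)])
    then show ?thesis using PDm that by simp
  qed
  obtain z where zi: "\<And>j l. j < p \<Longrightarrow> l < p \<Longrightarrow> integrable lborel (z j l)" and zneg: "\<And>j l t. t < 0 \<Longrightarrow> z j l t = 0"
    and zeq: "\<And>s j l. 0 \<le> Re s \<Longrightarrow> j < p \<Longrightarrow> l < p \<Longrightarrow>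
      lap s (z j l) = lap s (WHadj (\<lambda>i. w i l) j) + (\<Sum>r<p. lap s (z j r) * lap s (WHadj (\<lambda>i. w i l) r))"
    by (rule resolvent_exists[where Dp="\<lambda>j i. Dp $$ (j, i)" and P="\<lambda>j k. P $$ (j, k)", OF w DP PD], assumption+, rule that)
  define zm where "zm = (\<lambda>t. mat p p (\<lambda>(j, l). z j l t))"
  have zr: "borel_rep (\<lambda>t. zm t $$ (j, l)) (z j l)" if "j < p" "l < p" for j l
    using zi[OF that] zneg that by (auto simp: borel_rep_def zm_def)
  have zL1: "zm \<in> L1_mat p p"
    unfolding L1_mat_def using borel_rep_integral(2)[OF zr] zi by (auto simp: zm_def)
  have yL1: "y \<in> L1_mat p p"
    unfolding L1_mat_def
  proof (intro CollectI conjI allI impI)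
    show "y t \<in> carrier_mat p p" for t by (intro carrier_matI) (simp_all add: y columnwise_def)
    fix j l assume jl: "j < p" "l < p"
    have "integrable lborel (WHadj (\<lambda>i. w i l) j)"
      using w[OF jl(2)] by (intro WHadj_integrable solution_integrable[OF w[OF jl(2)] g_int]) (auto simp: solves_def)
    then show "integrable half_line (\<lambda>t. y t $$ (j, l))" using borel_rep_integral(2)[OF yr[OF jl]] by simp
  qed
  show thesis
  proof (rule that[OF zL1 yL1])
    fix s assume s: "0 \<le> Re s"
    let ?Z = "laplace p p zm s" and ?Y = "laplace p p y s" and ?G = "laplace m p gm s"
    have c: "?Z \<in> carrier_mat p p" "?Y \<in> carrier_mat p p" "?G \<in> carrier_mat m p" by (rule laplace_carrier)+
    have "?Z = ?Y + ?Z * ?Y"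
    proof (rule eq_matI)
      fix j l assume "j < dim_row (?Y + ?Z * ?Y)" "l < dim_col (?Y + ?Z * ?Y)"
      then have jl: "j < p" "l < p" using c by auto
      have "(?Y + ?Z * ?Y) $$ (j, l) = ?Y $$ (j, l) + (\<Sum>r<p. ?Z $$ (j, r) * ?Y $$ (r, l))"
        using c jl mat_mult_entry[OF c(1,2) jl] by (simp del: index_mult_mat(1))
      then show "?Z $$ (j, l) = (?Y + ?Z * ?Y) $$ (j, l)"
        using jl by (simp add: laplace_rep[OF _ _ zr] laplace_rep[OF _ _ yr] zeq[OF s jl])
    qed (use c in auto)
    note Zeq = this
    have "(1\<^sub>m p + ?Z) * (1\<^sub>m p - ?Y) = (1\<^sub>m p + ?Z) * 1\<^sub>m p - (1\<^sub>m p + ?Z) * ?Y"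
      using c by (intro mult_minus_distrib_mat) auto
    also have "(1\<^sub>m p + ?Z) * ?Y = 1\<^sub>m p * ?Y + ?Z * ?Y" using c by (intro add_mult_distrib_mat) auto
    also have "1\<^sub>m p * ?Y + ?Z * ?Y = ?Z" using c Zeq by simp
    also have "(1\<^sub>m p + ?Z) * 1\<^sub>m p - ?Z = 1\<^sub>m p" using c by (intro eq_matI) auto
    finally show "(1\<^sub>m p + ?Z) * (1\<^sub>m p - ?Y) = 1\<^sub>m p" .
    have "?G = (Dm + ?G) * ?Y"
    proof (rule eq_matI)
      fix i l assume "i < dim_row ((Dm + ?G) * ?Y)" "l < dim_col ((Dm + ?G) * ?Y)"
      then have il: "i < m" "l < p" using c Dm by auto
      have DG: "Dm + ?G \<in> carrier_mat m p" using c Dm by auto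
      have "((Dm + ?G) * ?Y) $$ (i, l) = (\<Sum>r<p. (Dm $$ (i, r) + ?G $$ (i, r)) * ?Y $$ (r, l))"
        unfolding mat_mult_entry[OF DG c(2) il] using c Dm il by (intro sum.cong refl) simp
      then show "?G $$ (i, l) = ((Dm + ?G) * ?Y) $$ (i, l)"
        using il by (simp add: laplace_rep[OF _ _ gr] laplace_rep[OF _ _ yr] lap_G[OF w[OF il(2)] s il(1)])
    qed (use c Dm in auto)
    note Geq = this
    have "(Dm + ?G) * (1\<^sub>m p - ?Y) = (Dm + ?G) * 1\<^sub>m p - (Dm + ?G) * ?Y"
      using c Dm by (intro mult_minus_distrib_mat) auto
    also have "(Dm + ?G) * ?Y = ?G" using Geq by simp
    also have "(Dm + ?G) * 1\<^sub>m p - ?G = Dm" using c Dm by (intro eq_matI) auto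
    finally show "(Dm + ?G) * (1\<^sub>m p - ?Y) = Dm" .
  qed
qed

theorem theorem1p2:
  fixes m p :: nat
    and D Dplus E :: "complex mat"
    and g y :: "real \<Rightarrow> complex mat"
    and G Y \<Xi> \<Theta> :: "complex \<Rightarrow> complex mat"
    and T Tadj :: vec_op
  assumes "1 \<le> m" and "m \<le> p"
    and "D \<in> carrier_mat m p"
    and "g \<in> L1_mat m p \<inter> L2_mat m p"
    and "\<And>s. Re s \<ge> 0 \<Longrightarrow> G s = D + laplace m p g s"
    and "T = wiener_hopf D g"
    and "Tadj = L2_adjoint p T"
    and "strictly_positive m (T \<circ> Tadj)"
    and "y = columnwise p p (Tadj \<circ> L2_inverse m (T \<circ> Tadj)) g"
    and "\<And>s. Re s \<ge> 0 \<Longrightarrow> Y s = 1\<^sub>m p - laplace p p y s"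
    and "Dplus = mat_adjoint D * minv (D * mat_adjoint D)"
    and "E \<in> carrier_mat p (p - m)"
    and "isometry_mat E"
    and "mat_image E = mat_kernel D"
    and "\<And>s. Re s \<ge> 0 \<Longrightarrow> \<Xi> s = Y s * Dplus"
    and "\<And>s. Re s \<ge> 0 \<Longrightarrow> \<Theta> s = Y s * E"
  shows "y \<in> L1_mat p p
    \<and> Y \<in> wiener_plus p p
    \<and> (\<forall>s. Re s \<ge> 0 \<longrightarrow> det (Y s) \<noteq> 0)
    \<and> wiener_invertible p Y
    \<and> wiener_invertible p (\<lambda>s. G s @\<^sub>r (mat_adjoint E * minv (Y s)))
    \<and> (\<forall>s. Re s \<ge> 0 \<longrightarrow>
         minv (G s @\<^sub>r (mat_adjoint E * minv (Y s))) = Y s * (Dplus @\<^sub>c E)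
       \<and> Y s * (Dplus @\<^sub>c E) = \<Xi> s @\<^sub>c \<Theta> s)"
proof -
  note mp = assms(2) and D = assms(3) and g = assms(4) and G = assms(5) and T = assms(6)
    and Tadj = assms(7) and spos = assms(8) and y = assms(9) and Y = assms(10) and Dplus = assms(11)
    and E = assms(12) and iso = assms(13) and ker = assms(14) and Xi = assms(15) and Theta = assms(16)
  have "\<exists>f'. borel_rep (\<lambda>t. g t $$ (i, j)) f' \<and> hl2 f' \<and> integrable lborel f'" if "i < m" "j < p" for i j
  proof -
    have L: "(\<lambda>t. g t $$ (i, j)) \<in> L2_scalar" "integrable half_line (\<lambda>t. g t $$ (i, j))"
      using g that by (auto simp: L1_mat_def L2_mat_def)
    then have "(\<lambda>t. g t $$ (i, j)) \<in> borel_measurable half_line" by (simp add: L2_scalar_def)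
    then obtain f' where "borel_rep (\<lambda>t. g t $$ (i, j)) f'" by (rule borel_rep_exists)
    then show ?thesis using L borel_rep_L2_scalar borel_rep_integral(2) by blast
  qed
  then obtain g0 where g0: "\<And>i j. i < m \<Longrightarrow> j < p \<Longrightarrow>
      borel_rep (\<lambda>t. g t $$ (i, j)) (g0 i j) \<and> hl2 (g0 i j) \<and> integrable lborel (g0 i j)" by metis
  define gr where "gr = (\<lambda>i j. if i < m \<and> j < p then g0 i j else (\<lambda>t. 0))"
  interpret wh_transfer m p D gr g
  proof
    show "sqint (gr i j)" "integrable lborel (gr i j)" for i j
      using g0 by (auto simp: gr_def hl2_def)
    show "gr i j t = 0" if "t < 0" for i j t using g0 that by (auto simp: gr_def hl2_def)
    show "D \<in> carrier_mat m p" by (rule D)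
    show "g t \<in> carrier_mat m p" if "0 \<le> t" for t using g that by (simp add: L1_mat_def)
    show "borel_rep (\<lambda>t. g t $$ (i, j)) (gr i j)" if "i < m" "j < p" for i j using g0 that by (simp add: gr_def)
  qed
  obtain c where c: "0 < c" "\<And>h. vhl2 m h \<Longrightarrow> c * (\<Sum>i<m. (l2n (h i))\<^sup>2) \<le> (\<Sum>j<p. (l2n (WHadj h j))\<^sup>2)"
    using spos unfolding T Tadj by (rule positive_transfer) (rule that)
  interpret wh_transfer_positive m p D gr g c
    by unfold_locales (use c in auto)
  have y': "y = columnwise p p (Tad \<circ> L2_inverse m (Top \<circ> Tad)) g" using y unfolding T Tadj .
  obtain z where z: "z \<in> L1_mat p p" and yL1: "y \<in> L1_mat p p"
    and ZY: "\<And>s. 0 \<le> Re s \<Longrightarrow> (1\<^sub>m p + laplace p p z s) * (1\<^sub>m p - laplace p p y s) = 1\<^sub>m p"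
    and GY: "\<And>s. 0 \<le> Re s \<Longrightarrow> (D + laplace m p g s) * (1\<^sub>m p - laplace p p y s) = D"
    by (rule Y_core[OF y'], rule that)
  define B where "B = (\<lambda>s. 1\<^sub>m p + laplace p p z s)"
  have Bc: "B s \<in> carrier_mat p p" for s using laplace_carrier[of p p z s] by (simp add: B_def)
  have Yc: "Y s \<in> carrier_mat p p" if "0 \<le> Re s" for s
    unfolding Y[OF that] by (rule minus_carrier_mat[OF laplace_carrier])
  have BY: "B s * Y s = 1\<^sub>m p" if "0 \<le> Re s" for s using ZY[OF that] Y[OF that] by (simp add: B_def)
  note inv = minv_unique[OF Yc Bc BY]
  have BW: "B \<in> wiener_plus p p" by (rule wiener_plusI[OF one_carrier_mat z]) (simp add: B_def)
  have YW: "Y \<in> wiener_plus p p"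
    unfolding wiener_plus_entries
  proof (intro conjI allI impI)
    fix i j assume ij: "i < p" "j < p"
    show "(\<lambda>s. Y s $$ (i, j)) \<in> wiener_scalar"
      by (rule wiener_scalarI[of "\<lambda>t. - (y t $$ (i, j))" _ "1\<^sub>m p $$ (i, j)"])
         (use yL1 ij in \<open>auto simp: L1_mat_def Y laplace_def\<close>)
  qed (rule Yc)
  have YI: "wiener_invertible p Y"
    unfolding wiener_invertible_def using YW inv(3) wiener_plus_cong[OF BW] inv(2) by auto
  have Ea: "mat_adjoint E \<in> carrier_mat (p - m) p" by (rule mat_adjoint_carrier[OF E])
  have Da: "mat_adjoint D \<in> carrier_mat p m" by (rule mat_adjoint_carrier[OF D])
  have DDc: "D * mat_adjoint D \<in> carrier_mat m m" using D Da by auto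
  note R = minv_det_nonzero[OF DDc D_adjoint_det]
  have Dpc: "Dplus \<in> carrier_mat p m" using Da R by (auto simp: Dplus)
  have DDp: "D * Dplus = 1\<^sub>m m"
    unfolding Dplus using assoc_mult_mat[OF D Da R(1)] R(2) by simp
  have DE: "D * E = 0\<^sub>m m (p - m)"
  proof (rule eq_matI)
    fix i j assume "i < dim_row (0\<^sub>m m (p - m) :: complex mat)" "j < dim_col (0\<^sub>m m (p - m) :: complex mat)"
    then have ij: "i < m" "j < p - m" by auto
    have "E *\<^sub>v unit_vec (p - m) j \<in> mat_image E" using E by (auto simp: mat_image_def)
    then have "D *\<^sub>v (E *\<^sub>v unit_vec (p - m) j) = 0\<^sub>v m" using ker D by (auto simp: mat_kernel_def)
    then have "(D * E) *\<^sub>v unit_vec (p - m) j = 0\<^sub>v m" using assoc_mult_mat_vec[OF D E] by simp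
    moreover have "((D * E) *\<^sub>v unit_vec (p - m) j) $ i = (D * E) $$ (i, j)"
      using D E ij by (simp del: assoc_mult_mat_vec)
    ultimately show "(D * E) $$ (i, j) = 0\<^sub>m m (p - m) $$ (i, j)" using ij by simp
  qed (use D E in auto)
  have EDa: "mat_adjoint E * mat_adjoint D = 0\<^sub>m (p - m) m"
  proof (rule eq_matI)
    fix j i assume "j < dim_row (0\<^sub>m (p - m) m :: complex mat)" "i < dim_col (0\<^sub>m (p - m) m :: complex mat)"
    then have ij: "j < p - m" "i < m" by auto
    have "(mat_adjoint E * mat_adjoint D) $$ (j, i) = (\<Sum>k<p. cnj (E $$ (k, j)) * cnj (D $$ (i, k)))"
      unfolding mat_mult_entry[OF Ea Da ij]
      by (intro sum.cong refl) (simp add: mat_adjoint_entry[OF E ij(1)] mat_adjoint_entry[OF D _ ij(2)])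
    also have "\<dots> = cnj ((D * E) $$ (i, j))"
      unfolding mat_mult_entry[OF D E ij(2,1)] by (simp add: mult.commute)
    finally show "(mat_adjoint E * mat_adjoint D) $$ (j, i) = 0\<^sub>m (p - m) m $$ (j, i)"
      using ij by (simp add: DE)
  qed (use Ea Da in auto)
  have EDp: "mat_adjoint E * Dplus = 0\<^sub>m (p - m) m"
    unfolding Dplus using assoc_mult_mat[OF Ea Da R(1)] EDa R(1) by simp
  have EE: "mat_adjoint E * E = 1\<^sub>m (p - m)" by (rule isometry_mat_adjoint[OF E iso])
  have DpE: "Dplus @\<^sub>c E \<in> carrier_mat p p" using append_cols_carrier[OF Dpc E] mp by simp
  define M where "M = (\<lambda>s. G s @\<^sub>r (mat_adjoint E * minv (Y s)))"
  have GW: "G \<in> wiener_plus m p"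
    by (rule wiener_plusI[OF D _ G]) (use g in auto)
  have MW: "M \<in> wiener_plus p p"
  proof -
    have "(\<lambda>s. G s @\<^sub>r (mat_adjoint E * B s)) \<in> wiener_plus (m + (p - m)) p"
      by (intro wiener_plus_append_rows GW wiener_plus_mult_left[OF BW Ea])
    then show ?thesis unfolding M_def using mp inv(2) by (auto intro: wiener_plus_cong)
  qed
  have NW: "(\<lambda>s. Y s * (Dplus @\<^sub>c E)) \<in> wiener_plus p p" by (rule wiener_plus_mult_right[OF YW DpE])
  have MN: "M s * (Y s * (Dplus @\<^sub>c E)) = 1\<^sub>m p" if s: "0 \<le> Re s" for s
  proof -
    have Gc: "G s \<in> carrier_mat m p" by (rule wiener_plus_carrier[OF GW s])
    have EB: "mat_adjoint E * B s \<in> carrier_mat (p - m) p" using Ea Bc by auto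
    have Mc: "M s \<in> carrier_mat p p" by (rule wiener_plus_carrier[OF MW s])
    have "M s * (Y s * (Dplus @\<^sub>c E)) = (M s * Y s) * (Dplus @\<^sub>c E)"
      by (rule assoc_mult_mat[OF Mc Yc[OF s] DpE, symmetric])
    also have "M s * Y s = (G s * Y s) @\<^sub>r ((mat_adjoint E * B s) * Y s)"
      unfolding M_def inv(2)[OF s s] by (rule append_rows_mult[OF Gc EB Yc[OF s]])
    also have "G s * Y s = D" using GY[OF s] by (simp add: G[OF s] Y[OF s])
    also have "(mat_adjoint E * B s) * Y s = mat_adjoint E"
      using assoc_mult_mat[OF Ea Bc Yc[OF s]] BY[OF s] Ea by simp
    also have "(D @\<^sub>r mat_adjoint E) * (Dplus @\<^sub>c E) = 1\<^sub>m (m + (p - m))"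
      by (rule rows_times_cols_one[OF D Ea Dpc E DDp DE EDp EE])
    finally show ?thesis using mp by simp
  qed
  have Nc: "Y s * (Dplus @\<^sub>c E) \<in> carrier_mat p p" if "0 \<le> Re s" for s using Yc[OF that] DpE by auto
  have Mc: "M s \<in> carrier_mat p p" if "0 \<le> Re s" for s by (rule wiener_plus_carrier[OF MW that])
  have NM: "(Y s * (Dplus @\<^sub>c E)) * M s = 1\<^sub>m p" if "0 \<le> Re s" for s
    by (rule mat_mult_left_right_inverse[OF Mc[OF that] Nc[OF that] MN[OF that]])
  note Minv = minv_unique[OF Mc Nc NM]
  have MI: "wiener_invertible p M"
    unfolding wiener_invertible_def using MW Minv(3) wiener_plus_cong[OF NW] Minv(2) by auto
  have XT: "Y s * (Dplus @\<^sub>c E) = \<Xi> s @\<^sub>c \<Theta> s" if s: "0 \<le> Re s" for s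
    unfolding Xi[OF s] Theta[OF s] by (rule append_cols_mult[OF Dpc E Yc[OF s]])
  show ?thesis
    using yL1 YW inv(1) YI MI Minv(2) XT unfolding M_def by auto
qed

end
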